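(* For all integers $n\geq 3$ and $0\leq r<\frac{n}{2}$ there exists an integer $l\geq 0$ such that one of the following two cases holds, with the corresponding homotopy equivalence: $$\mathrm{Cl}(C_n^r)\simeq\begin{cases}\bigvee^{n-2r-1} S^{2l} & \text{if } r=\frac{l}{2l+1}n,\\[2pt] S^{2l+1} & \text{if } \frac{l}{2l+1}n<r<\frac{l+1}{2l+3}n.\end{cases}$$
   Context: $C_n$ is the cycle with $n$ vertices. $G^r$ denotes the $r$-th distance power of a graph $G$: the graph on $V(G)$ in which two distinct vertices are adjacent iff their distance in $G$ is at most $r$ (so $G^0$ has no edges). The clique complex $\mathrm{Cl}(G)$ is the simplicial complex on $V(G)$ whose simplices are the cliques of $G$. $\bigvee^k X$ is a wedge of $k$ copies of $X$; the wedge of $0$ copies is a point. *)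

theory Defs
  imports "HOL-Analysis.Analysis" "HOL-Library.Extended_Nat"
begin

section \<open>Graphs, distance powers and clique complexes\<close>

(* A simple graph is represented by its vertex set and its adjacency relation, which is meant
   to be symmetric, irreflexive and confined to the vertex set. *)
record 'a graph =
  verts :: "'a set"
  adj :: "'a \<Rightarrow> 'a \<Rightarrow> bool"

definition simple_graph :: "'a graph \<Rightarrow> bool" where
  "simple_graph G \<longleftrightarrow>
     (\<forall>u v. adj G u v \<longrightarrow> u \<in> verts G \<and> v \<in> verts G \<and> u \<noteq> v \<and> adj G v u)"

(* The relational power adj G ^^ k says that there is a walk of length k;
   vertices in different components get distance \<infinity> = Inf {}. *)
definition graph_dist :: "'a graph \<Rightarrow> 'a \<Rightarrow> 'a \<Rightarrow> enat" where
  "graph_dist G u v = Inf {enat k |k. (adj G ^^ k) u v}"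

definition graph_power :: "'a graph \<Rightarrow> nat \<Rightarrow> 'a graph" where
  "graph_power G r =
     \<lparr>verts = verts G,
      adj = (\<lambda>u v. u \<in> verts G \<and> v \<in> verts G \<and> u \<noteq> v \<and> graph_dist G u v \<le> enat r)\<rparr>"

(* This is the n-cycle for n \<ge> 3 only. *)
definition cycle_graph :: "nat \<Rightarrow> nat graph" where
  "cycle_graph n =
     \<lparr>verts = {..<n},
      adj = (\<lambda>i j. i < n \<and> j < n \<and> (j = Suc i mod n \<or> i = Suc j mod n))\<rparr>"

(* The set of nonempty simplices. *)
definition clique_complex :: "'a graph \<Rightarrow> 'a set set" where
  "clique_complex G =
     {\<sigma>. \<sigma> \<subseteq> verts G \<and> finite \<sigma> \<and> \<sigma> \<noteq> {} \<and> (\<forall>u\<in>\<sigma>. \<forall>v\<in>\<sigma>. u \<noteq> v \<longrightarrow> adj G u v)}"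

lemma simple_graph_cycle_graph:
  assumes "n \<ge> 3"
  shows "simple_graph (cycle_graph n)"
proof -
  have "i \<noteq> Suc i mod n" if "i < n" for i
    using assms that by (cases "Suc i = n") auto
  then show ?thesis
    by (fastforce simp: simple_graph_def cycle_graph_def)
qed

section \<open>Geometric realization\<close>

(* Points are given by barycentric coordinates. The topology is the one inherited from the
   product topology on real-valued functions; for complexes with finitely many simplices it is
   the usual (weak) topology of the realization. *)
definition geometric_realization :: "'a set set \<Rightarrow> ('a \<Rightarrow> real) topology" where
  "geometric_realization K =
     subtopology (powertop_real UNIV)
       {\<alpha>. (\<forall>v. 0 \<le> \<alpha> v) \<and> {v. \<alpha> v \<noteq> 0} \<in> K \<and> (\<Sum>v | \<alpha> v \<noteq> 0. \<alpha> v) = 1}"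

section \<open>Wedges of copies of a pointed space\<close>

(* The inclusion of the i-th copy: every copy of the base point x0 goes to None. *)
definition wedge_inj :: "'a \<Rightarrow> nat \<Rightarrow> 'a \<Rightarrow> (nat \<times> 'a) option" where
  "wedge_inj x0 i x = (if x = x0 then None else Some (i, x))"

(* The quotient topology: the finest one making the k inclusions continuous. The point None is
   always present, so that the wedge of 0 copies is a point. *)
definition wedge_copies :: "nat \<Rightarrow> 'a topology \<Rightarrow> 'a \<Rightarrow> (nat \<times> 'a) option topology" where
  "wedge_copies k X x0 =
     topology (\<lambda>U. U \<subseteq> insert None (\<Union>i<k. wedge_inj x0 i ` topspace X) \<and>
                   (\<forall>i<k. openin X {x \<in> topspace X. wedge_inj x0 i x \<in> U}))"

lemma openin_wedge_copies:
  "openin (wedge_copies k X x0) U \<longleftrightarrow>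
     U \<subseteq> insert None (\<Union>i<k. wedge_inj x0 i ` topspace X) \<and>
     (\<forall>i<k. openin X {x \<in> topspace X. wedge_inj x0 i x \<in> U})"
proof -
  have "istopology (\<lambda>U. U \<subseteq> insert None (\<Union>i<k. wedge_inj x0 i ` topspace X) \<and>
                   (\<forall>i<k. openin X {x \<in> topspace X. wedge_inj x0 i x \<in> U}))"
    unfolding istopology_def
  proof (intro conjI allI impI; (elim conjE)?)
    fix S T i
    assume "i < k" "\<forall>i<k. openin X {x \<in> topspace X. wedge_inj x0 i x \<in> S}"
      "\<forall>i<k. openin X {x \<in> topspace X. wedge_inj x0 i x \<in> T}"
    then have "openin X ({x \<in> topspace X. wedge_inj x0 i x \<in> S} \<inter>
                         {x \<in> topspace X. wedge_inj x0 i x \<in> T})"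
      by blast
    then show "openin X {x \<in> topspace X. wedge_inj x0 i x \<in> S \<inter> T}"
      by (rule back_subst[where P = "openin X"]) auto
  next
    fix \<K> i
    assume "i < k" and "\<forall>U\<in>\<K>. U \<subseteq> insert None (\<Union>i<k. wedge_inj x0 i ` topspace X) \<and>
       (\<forall>i<k. openin X {x \<in> topspace X. wedge_inj x0 i x \<in> U})"
    then have "openin X (\<Union>U\<in>\<K>. {x \<in> topspace X. wedge_inj x0 i x \<in> U})"
      by blast
    then show "openin X {x \<in> topspace X. wedge_inj x0 i x \<in> \<Union>\<K>}"
      by (rule back_subst[where P = "openin X"]) auto
  qed blast+
  then show ?thesis
    by (simp add: wedge_copies_def)
qed

lemma topspace_wedge_copies:
  "topspace (wedge_copies k X x0) = insert None (\<Union>i<k. wedge_inj x0 i ` topspace X)"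
proof -
  have "{x \<in> topspace X. wedge_inj x0 i x \<in> insert None (\<Union>i<k. wedge_inj x0 i ` topspace X)}
        = topspace X" if "i < k" for i
    using that by auto
  then have "openin (wedge_copies k X x0) (insert None (\<Union>i<k. wedge_inj x0 i ` topspace X))"
    unfolding openin_wedge_copies by simp
  moreover have "topspace (wedge_copies k X x0) \<subseteq> insert None (\<Union>i<k. wedge_inj x0 i ` topspace X)"
    using openin_topspace[of "wedge_copies k X x0"] unfolding openin_wedge_copies by (rule conjunct1)
  ultimately show ?thesis
    by (intro subset_antisym openin_subset)
qed

definition nsphere_base :: "nat \<Rightarrow> real" where
  "nsphere_base = (\<lambda>i. if i = 0 then 1 else 0)"

lemma nsphere_base_in_nsphere: "nsphere_base \<in> topspace (nsphere m)"
proof -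
  have "(\<Sum>i\<le>m. (nsphere_base i)\<^sup>2) = (\<Sum>i\<le>m. if i = 0 then 1 else 0)"
    by (rule sum.cong) (auto simp: nsphere_base_def)
  then show ?thesis
    by (simp add: nsphere nsphere_base_def)
qed

abbreviation wedge_of_spheres :: "nat \<Rightarrow> nat \<Rightarrow> (nat \<times> (nat \<Rightarrow> real)) option topology" where
  "wedge_of_spheres k m \<equiv> wedge_copies k (nsphere m) nsphere_base"

end

theory Submission
  imports Defs
begin

text \<open>
  Put \<open>k = n - 2 * r\<close>, so that a vertex \<open>x\<close> of the graph power is not adjacent to exactly the \<open>k - 1\<close>
  vertices around its antipode. If \<open>A\<close> and \<open>B\<close> are collapsible subcomplexes, then \<open>A \<union> B\<close> has the
  homotopy type of the suspension of \<open>A \<inter> B\<close>. For \<open>r \<ge> k\<close> take for \<open>B\<close> the star of the vertex 0 and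
  for \<open>A\<close> the union of the stars of its non-neighbours; then \<open>A \<inter> B\<close> is the independence complex of a
  bipartite graph on two copies of the cycle with \<open>r\<close> vertices, and a second decomposition identifies it
  with the suspension of the complex of all sets of vertices of that cycle that avoid \<open>g = k - 1\<close>
  consecutive ones. For these arc complexes, again by two decompositions, passing from \<open>m\<close> to \<open>m - g - 1\<close>
  vertices costs a double suspension. After \<open>l = r div k\<close> double suspensions there remain \<open>k\<close> points if
  \<open>k\<close> divides \<open>r\<close>, and a complex of short arcs, which is a circle, otherwise.

  Suspending is taking the join with the boundary of a cross polytope. The join of \<open>j + 1\<close> points with the
  boundary of the \<open>d\<close>-dimensional cross polytope consists of \<open>j + 1\<close> discs with a common boundary;
  contracting one of them leaves a wedge of \<open>j\<close> spheres.
\<close>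

section \<open>Collapses\<close>

text \<open>With \<open>n = 2 * r + k\<close> the equation \<open>r * (2 * l + 1) = l * n\<close>
  says exactly \<open>r = l * k\<close>, and \<open>r * (2 * l + 3) < (l + 1) * n\<close> says
  \<open>r < (l + 1) * k\<close>. The two cases of the theorem are therefore division of
  \<open>r\<close> by \<open>k\<close> with remainder zero or nonzero, and \<open>l\<close> has to
  be the quotient. The obstacle is to iterate suspensions: knowing the homotopy type of
  \<open>A \<inter> B\<close> is useful only if suspending respects homotopy equivalence. Instead of
  proving this for spaces, every type is asserted for all suspensions at once, and a suspension is
  compared with a union through collapses of one larger finite complex. The only topology left is
  that a collapse is a deformation retraction, that relabelling vertices is a homeomorphism, and one
  explicit comparison of glued discs with a wedge. For \<open>r < k\<close> no decomposition takes
  place: as \<open>3 * r < n\<close>, three steps of length \<open>r\<close> cannot go around the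
  cycle, and the cliques are the sets inside an arc of \<open>r + 1\<close> vertices. For
  \<open>k = 1\<close> the complex is a full simplex.\<close>

text \<open>A family may contain the empty simplex, which the geometric realization ignores.\<close>

definition simplicial :: "'a set set \<Rightarrow> bool" where
  "simplicial K \<longleftrightarrow> (\<forall>\<sigma>\<in>K. finite \<sigma> \<and> Pow \<sigma> \<subseteq> K)"

lemma simplicialD:
  assumes "simplicial K" "\<sigma> \<in> K"
  shows "finite \<sigma>" "\<tau> \<subseteq> \<sigma> \<Longrightarrow> \<tau> \<in> K"
  using assms by (auto simp: simplicial_def)

section \<open>Membership and continuity in barycentric coordinates\<close>

lemma topspace_geometric_realization:
  "topspace (geometric_realization K) =
     {\<alpha>. (\<forall>v. 0 \<le> \<alpha> v) \<and> {v. \<alpha> v \<noteq> 0} \<in> K \<and> (\<Sum>v | \<alpha> v \<noteq> 0. \<alpha> v) = 1}"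
  by (simp add: geometric_realization_def)

lemma geometric_realizationI:
  assumes "\<And>v. 0 \<le> \<alpha> v" "{v. \<alpha> v \<noteq> 0} \<in> K" "finite F" "{v. \<alpha> v \<noteq> 0} \<subseteq> F" "sum \<alpha> F = 1"
  shows "\<alpha> \<in> topspace (geometric_realization K)"
proof -
  have "(\<Sum>v | \<alpha> v \<noteq> 0. \<alpha> v) = sum \<alpha> F"
    by (rule sum.mono_neutral_left) (use assms in auto)
  then show ?thesis
    using assms by (simp add: topspace_geometric_realization)
qed

lemma geometric_realizationD:
  assumes "\<alpha> \<in> topspace (geometric_realization K)"
  shows "0 \<le> \<alpha> v" "{v. \<alpha> v \<noteq> 0} \<in> K" "(\<Sum>v | \<alpha> v \<noteq> 0. \<alpha> v) = 1"
    and "finite F \<Longrightarrow> {v. \<alpha> v \<noteq> 0} \<subseteq> F \<Longrightarrow> sum \<alpha> F = 1"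
proof -
  show *: "0 \<le> \<alpha> v" "{v. \<alpha> v \<noteq> 0} \<in> K" "(\<Sum>v | \<alpha> v \<noteq> 0. \<alpha> v) = 1"
    using assms by (auto simp: topspace_geometric_realization)
  assume "finite F" "{v. \<alpha> v \<noteq> 0} \<subseteq> F"
  then have "(\<Sum>v | \<alpha> v \<noteq> 0. \<alpha> v) = sum \<alpha> F"
    by (intro sum.mono_neutral_left) auto
  with * show "sum \<alpha> F = 1" by simp
qed

text \<open>A point with empty support would have total weight 0 instead of 1.\<close>

lemma geometric_realization_insert_empty:
  "geometric_realization (insert {} K) = geometric_realization K"
proof -
  have "{\<alpha>. (\<forall>v. 0 \<le> \<alpha> v) \<and> {v. \<alpha> v \<noteq> 0} \<in> insert {} K \<and> (\<Sum>v | \<alpha> v \<noteq> 0. \<alpha> v) = (1::real)}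
      = {\<alpha>. (\<forall>v. 0 \<le> \<alpha> v) \<and> {v. \<alpha> v \<noteq> 0} \<in> K \<and> (\<Sum>v | \<alpha> v \<noteq> 0. \<alpha> v) = 1}"
    by (intro Collect_cong) (metis insert_iff sum.empty zero_neq_one)
  then show ?thesis
    by (simp add: geometric_realization_def)
qed

lemma continuous_map_geometric_realization:
  "continuous_map X (geometric_realization K) f \<longleftrightarrow>
     (\<forall>v. continuous_map X euclideanreal (\<lambda>x. f x v)) \<and>
     (\<forall>x\<in>topspace X. f x \<in> topspace (geometric_realization K))"
  unfolding geometric_realization_def continuous_map_in_subtopology continuous_map_componentwise_UNIV
  by (auto simp: Pi_iff image_subset_iff)

lemma continuous_map_realization_coordinate [continuous_intros]:
  "continuous_map (geometric_realization K) euclideanreal (\<lambda>\<alpha>. \<alpha> v)"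
  unfolding geometric_realization_def
  by (intro continuous_map_from_subtopology continuous_map_product_projection) simp

text \<open>A point and its image span a common simplex of \<open>K\<close>, so the segment between
  them stays in the realization and the affine homotopy is well defined.\<close>

lemma straight_line_retract:
  assumes K: "simplicial K" and "L \<subseteq> K"
    and cont: "continuous_map (geometric_realization K) (geometric_realization L) f"
    and fixes_L: "\<And>\<alpha>. \<alpha> \<in> topspace (geometric_realization L) \<Longrightarrow> f \<alpha> = \<alpha>"
    and carrier: "\<And>\<alpha>. \<alpha> \<in> topspace (geometric_realization K) \<Longrightarrow>
                    {v. \<alpha> v \<noteq> 0} \<union> {v. f \<alpha> v \<noteq> 0} \<in> K"
  shows "geometric_realization K homotopy_equivalent_space geometric_realization L"
proof (rule deformation_retract_imp_homotopy_equivalent_space)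
  let ?X = "geometric_realization K" and ?Y = "geometric_realization L"
  have sub: "topspace ?Y \<subseteq> topspace ?X"
    using \<open>L \<subseteq> K\<close> by (auto simp: topspace_geometric_realization)
  show "retraction_maps ?X ?Y f id"
    using cont fixes_L sub
    by (auto simp: retraction_maps_def continuous_map_geometric_realization[of ?Y] continuous_intros)
  define h where "h = (\<lambda>(t::real, \<alpha>) v. (1 - t) * f \<alpha> v + t * \<alpha> v)"
  have fcoord: "continuous_map ?X euclideanreal (\<lambda>\<alpha>. f \<alpha> v)" for v
    using cont by (simp add: continuous_map_geometric_realization)
  have "continuous_map (prod_topology (top_of_set {0..1}) ?X) ?X h"
    unfolding continuous_map_geometric_realization
  proof (intro conjI allI ballI)
    fix v
    let ?P = "prod_topology (top_of_set {0..1::real}) ?X"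
    have 1: "continuous_map ?P euclideanreal fst"
      by (metis continuous_map_fst continuous_map_into_fulltopology)
    have 2: "continuous_map ?P euclideanreal (\<lambda>p. f (snd p) v)"
      using continuous_map_compose[OF continuous_map_snd fcoord[of v]] by (simp add: o_def)
    have 3: "continuous_map ?P euclideanreal (\<lambda>p. snd p v)"
      using continuous_map_compose[OF continuous_map_snd continuous_map_realization_coordinate]
      by (simp add: o_def)
    show "continuous_map ?P euclideanreal (\<lambda>p. h p v)"
      unfolding h_def case_prod_beta by (intro continuous_intros 1 2 3)
  next
    fix p :: "real \<times> ('a \<Rightarrow> real)"
    assume "p \<in> topspace (prod_topology (top_of_set {0..1}) ?X)"
    then obtain t \<alpha> where p: "p = (t, \<alpha>)" "0 \<le> t" "t \<le> 1" and \<alpha>: "\<alpha> \<in> topspace ?X"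
      by auto
    have f\<alpha>: "f \<alpha> \<in> topspace ?X"
      using \<alpha> cont sub by (auto simp: continuous_map_geometric_realization)
    let ?F = "{v. \<alpha> v \<noteq> 0} \<union> {v. f \<alpha> v \<noteq> 0}"
    have F: "?F \<in> K" "finite ?F"
      using carrier[OF \<alpha>] simplicialD[OF K] by auto
    have sub: "{v. h p v \<noteq> 0} \<subseteq> ?F"
      by (auto simp: p h_def)
    show "h p \<in> topspace ?X"
    proof (rule geometric_realizationI[where F = ?F])
      show "0 \<le> h p v" for v
        using geometric_realizationD(1)[OF \<alpha>] geometric_realizationD(1)[OF f\<alpha>] p by (simp add: h_def)
      have "sum (h p) ?F = (1 - t) * sum (f \<alpha>) ?F + t * sum \<alpha> ?F"
        by (simp add: p h_def sum.distrib sum_distrib_left)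
      also have "sum (f \<alpha>) ?F = 1"
        using geometric_realizationD(4)[OF f\<alpha> F(2)] by auto
      also have "sum \<alpha> ?F = 1"
        using geometric_realizationD(4)[OF \<alpha> F(2)] by auto
      finally show "sum (h p) ?F = 1" by simp
    qed (use F sub simplicialD[OF K] in auto)
  qed
  then show "homotopic_with (\<lambda>x. True) ?X ?X f id"
    unfolding homotopic_with_def by (intro exI[of _ h]) (auto simp: h_def)
qed

text \<open>The open star of \<open>\<sigma>\<close> is deleted when the link of
  \<open>\<sigma>\<close> is a cone with apex \<open>w\<close>. Deleting whole stars at once
  replaces the matching of free faces in elementary collapses.\<close>

definition star_removal :: "'a set set \<Rightarrow> 'a set set \<Rightarrow> bool" where
  "star_removal K L \<longleftrightarrow>
     (\<exists>\<sigma> w. finite \<sigma> \<and> \<sigma> \<noteq> {} \<and> w \<notin> \<sigma> \<and> (\<forall>\<tau>\<in>K. \<sigma> \<subseteq> \<tau> \<longrightarrow> insert w \<tau> \<in> K) \<and>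
            L = {\<tau> \<in> K. \<not> \<sigma> \<subseteq> \<tau>})"

abbreviation collapses :: "'a set set \<Rightarrow> 'a set set \<Rightarrow> bool" where
  "collapses \<equiv> star_removal\<^sup>*\<^sup>*"

lemma star_removalI:
  assumes "finite \<sigma>" "\<sigma> \<noteq> {}" "w \<notin> \<sigma>" "\<And>\<tau>. \<tau> \<in> K \<Longrightarrow> \<sigma> \<subseteq> \<tau> \<Longrightarrow> insert w \<tau> \<in> K"
    "L = {\<tau> \<in> K. \<not> \<sigma> \<subseteq> \<tau>}"
  shows "star_removal K L"
  unfolding star_removal_def using assms by blast

lemma simplicial_collapses:
  assumes "collapses K L" "simplicial K"
  shows "simplicial L"
  using assms
proof (induction rule: rtranclp_induct)
  case (step L M)
  then have "simplicial L" by simp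
  with step.hyps(2) show ?case
    unfolding star_removal_def simplicial_def by blast
qed

lemma Min_image_eq_0_iff:
  fixes \<alpha> :: "'a \<Rightarrow> real"
  assumes "finite \<sigma>" "\<sigma> \<noteq> {}" "\<And>v. 0 \<le> \<alpha> v"
  shows "Min (\<alpha> ` \<sigma>) = 0 \<longleftrightarrow> (\<exists>v\<in>\<sigma>. \<alpha> v = 0)"
proof -
  have "Min (\<alpha> ` \<sigma>) = 0 \<longleftrightarrow> 0 \<in> \<alpha> ` \<sigma> \<and> (\<forall>y\<in>\<alpha> ` \<sigma>. 0 \<le> y)"
    using assms by (intro Min_eq_iff) auto
  then show ?thesis using assms by force
qed

lemma continuous_map_Min:
  fixes f :: "'b \<Rightarrow> 'a \<Rightarrow> real"
  assumes "finite I" "I \<noteq> {}" "\<And>i. i \<in> I \<Longrightarrow> continuous_map X euclideanreal (\<lambda>x. f x i)"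
  shows "continuous_map X euclideanreal (\<lambda>x. Min (f x ` I))"
  using assms by (induction I rule: finite_ne_induct) (auto intro!: continuous_intros)

text \<open>The retraction moves the common weight of the vertices of \<open>\<sigma>\<close> to the apex \<open>w\<close>.\<close>

lemma star_removal_homotopy_equivalent:
  assumes K: "simplicial K" and "star_removal K L"
  shows "geometric_realization K homotopy_equivalent_space geometric_realization L"
proof -
  obtain \<sigma> w where \<sigma>: "finite \<sigma>" "\<sigma> \<noteq> {}" "w \<notin> \<sigma>"
    and apex: "\<And>\<tau>. \<tau> \<in> K \<Longrightarrow> \<sigma> \<subseteq> \<tau> \<Longrightarrow> insert w \<tau> \<in> K" and L: "L = {\<tau> \<in> K. \<not> \<sigma> \<subseteq> \<tau>}"
    using assms(2) unfolding star_removal_def by blast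
  define m :: "('a \<Rightarrow> real) \<Rightarrow> real" where "m \<alpha> = Min (\<alpha> ` \<sigma>)" for \<alpha>
  define f where "f \<alpha> v = (if v = w then \<alpha> w + card \<sigma> * m \<alpha> else if v \<in> \<sigma> then \<alpha> v - m \<alpha> else \<alpha> v)"
    for \<alpha> v
  have m_le: "m \<alpha> \<le> \<alpha> v" if "v \<in> \<sigma>" for \<alpha> v
    using \<sigma> that by (simp add: m_def)
  have id: "f \<alpha> = \<alpha>" if "m \<alpha> = 0" for \<alpha>
    using that by (auto simp: f_def)
  have m0: "0 \<le> m \<alpha>" if "\<And>v. 0 \<le> \<alpha> v" for \<alpha>
    using \<sigma> that by (simp add: m_def)
  have meq: "m \<alpha> = 0 \<longleftrightarrow> \<not> \<sigma> \<subseteq> {v. \<alpha> v \<noteq> 0}" if "\<And>v. 0 \<le> \<alpha> v" for \<alpha>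
    using Min_image_eq_0_iff[of \<sigma> \<alpha>] that \<sigma> by (auto simp: m_def)
  have carrier: "{v. \<alpha> v \<noteq> 0} \<union> {v. f \<alpha> v \<noteq> 0} \<in> K"
    if \<alpha>: "\<alpha> \<in> topspace (geometric_realization K)" for \<alpha>
  proof (cases "m \<alpha> = 0")
    case True
    then show ?thesis using geometric_realizationD(2)[OF \<alpha>] by (simp add: id)
  next
    case False
    then have "\<sigma> \<subseteq> {v. \<alpha> v \<noteq> 0}"
      using meq geometric_realizationD(1)[OF \<alpha>] by blast
    then have "insert w {v. \<alpha> v \<noteq> 0} \<in> K"
      using apex geometric_realizationD(2)[OF \<alpha>] by blast
    moreover have "{v. \<alpha> v \<noteq> 0} \<union> {v. f \<alpha> v \<noteq> 0} \<subseteq> insert w {v. \<alpha> v \<noteq> 0}"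
      using \<open>\<sigma> \<subseteq> _\<close> by (auto simp: f_def split: if_splits)
    ultimately show ?thesis
      using simplicialD[OF K] by blast
  qed
  have fL: "f \<alpha> \<in> topspace (geometric_realization L)"
    if \<alpha>: "\<alpha> \<in> topspace (geometric_realization K)" for \<alpha>
  proof -
    note nn = geometric_realizationD(1)[OF \<alpha>]
    let ?F = "insert w (\<sigma> \<union> {v. \<alpha> v \<noteq> 0})"
    have fin: "finite ?F"
      using \<sigma> simplicialD(1)[OF K geometric_realizationD(2)[OF \<alpha>]] by simp
    show ?thesis
    proof (rule geometric_realizationI[OF _ _ fin])
      show "0 \<le> f \<alpha> v" for v
        using nn m0[of \<alpha>] m_le[of v \<alpha>] by (simp add: f_def)
      have "{v. f \<alpha> v \<noteq> 0} \<in> K"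
        using carrier[OF \<alpha>] simplicialD[OF K] by blast
      moreover have "\<not> \<sigma> \<subseteq> {v. f \<alpha> v \<noteq> 0}"
      proof -
        \<comment> \<open>A vertex of \<open>\<sigma>\<close> attaining the minimum loses all its
          weight, so \<open>\<sigma>\<close> leaves the support.\<close>
        have "m \<alpha> \<in> \<alpha> ` \<sigma>"
          using \<sigma> by (simp add: m_def)
        then obtain v where "v \<in> \<sigma>" "m \<alpha> = \<alpha> v" by auto
        with \<sigma> show ?thesis by (auto simp: f_def)
      qed
      ultimately show "{v. f \<alpha> v \<noteq> 0} \<in> L" by (simp add: L)
      show "{v. f \<alpha> v \<noteq> 0} \<subseteq> ?F"
        by (auto simp: f_def split: if_splits)
      have "f \<alpha> v = \<alpha> v + (if v = w then card \<sigma> * m \<alpha> else 0) - (if v \<in> \<sigma> then m \<alpha> else 0)" for v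
        using \<sigma> by (auto simp: f_def)
      then have "sum (f \<alpha>) ?F = (\<Sum>v\<in>?F. \<alpha> v + (if v = w then card \<sigma> * m \<alpha> else 0)
          - (if v \<in> \<sigma> then m \<alpha> else 0))"
        by (rule sum.cong[OF refl])
      also have "\<dots> = sum \<alpha> ?F + (\<Sum>v\<in>?F. if v = w then card \<sigma> * m \<alpha> else 0)
          - (\<Sum>v\<in>?F. if v \<in> \<sigma> then m \<alpha> else 0)"
        by (simp only: sum.distrib sum_subtractf)
      also have "(\<Sum>v\<in>?F. if v = w then card \<sigma> * m \<alpha> else 0) = card \<sigma> * m \<alpha>"
        using fin by (subst sum.delta) auto
      also have "(\<Sum>v\<in>?F. if v \<in> \<sigma> then m \<alpha> else 0) = (\<Sum>v\<in>\<sigma>. m \<alpha>)"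
        using fin by (intro sum.mono_neutral_cong_right) auto
      also have "sum \<alpha> ?F = 1"
        using geometric_realizationD(4)[OF \<alpha> fin] by auto
      finally show "sum (f \<alpha>) ?F = 1" by simp
    qed
  qed
  have mcont: "continuous_map (geometric_realization K) euclideanreal m"
    unfolding m_def using \<sigma> by (intro continuous_map_Min continuous_intros)
  show ?thesis
  proof (rule straight_line_retract[OF K _ _ _ carrier])
    show "continuous_map (geometric_realization K) (geometric_realization L) f"
      unfolding continuous_map_geometric_realization
    proof (intro conjI allI ballI fL)
      fix v
      show "continuous_map (geometric_realization K) euclideanreal (\<lambda>x. f x v)"
        by (cases "v = w"; cases "v \<in> \<sigma>") (auto simp: f_def intro!: continuous_intros mcont)
    qed
    show "f \<alpha> = \<alpha>" if "\<alpha> \<in> topspace (geometric_realization L)" for \<alpha>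
      using geometric_realizationD(1,2)[OF that] meq[of \<alpha>] by (intro id) (auto simp: L)
  qed (auto simp: L)
qed

lemma collapses_homotopy_equivalent:
  assumes "collapses K L" "simplicial K"
  shows "geometric_realization K homotopy_equivalent_space geometric_realization L"
  using assms
proof (induction rule: rtranclp_induct)
  case base
  then show ?case by (simp add: homotopy_equivalent_space_refl)
next
  case (step L M)
  then show ?case
    by (meson homotopy_eqv_trans simplicial_collapses star_removal_homotopy_equivalent)
qed

text \<open>Simplices are sorted by their trace on \<open>X\<close>, and the traces in
  \<open>SS\<close> are discarded from the maximal ones downwards. The apex may depend on the trace;
  lying outside \<open>X\<close>, it does not change the trace.\<close>

lemma collapses_discard:
  assumes "finite SS" "\<And>S. S \<in> SS \<Longrightarrow> finite S \<and> S \<noteq> {} \<and> S \<subseteq> X"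
    and up: "\<And>S U. S \<in> SS \<Longrightarrow> U \<in> K \<Longrightarrow> S \<subseteq> U \<Longrightarrow> U \<inter> X \<in> SS"
    and apex: "\<And>S. S \<in> SS \<Longrightarrow> \<exists>w. w \<notin> X \<and> (\<forall>U\<in>K. U \<inter> X = S \<longrightarrow> insert w U \<in> K)"
  shows "collapses K {U \<in> K. U \<inter> X \<notin> SS}"
  using assms
proof (induction "card SS" arbitrary: SS K)
  case 0
  then show ?case by simp
next
  case (Suc n)
  then have "SS \<noteq> {}" by auto
  then obtain S where S: "S \<in> SS" and max: "\<And>S'. S' \<in> SS \<Longrightarrow> S \<subseteq> S' \<Longrightarrow> S' = S"
    using finite_has_maximal[OF Suc.prems(1)] by metis
  obtain w where w: "w \<notin> X" "\<And>U. U \<in> K \<Longrightarrow> U \<inter> X = S \<Longrightarrow> insert w U \<in> K"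
    using Suc.prems(4)[OF S] by blast
  define K' where "K' = {U \<in> K. \<not> S \<subseteq> U}"
  \<comment> \<open>The trace of a simplex containing \<open>S\<close> is again in
    \<open>SS\<close>, so maximality of \<open>S\<close> turns the open star of \<open>S\<close>
    into the set of simplices with trace exactly \<open>S\<close>.\<close>
  have iff: "S \<subseteq> U \<longleftrightarrow> U \<inter> X = S" if "U \<in> K" for U
    using Suc.prems(3)[OF S that] max that Suc.prems(2)[OF S] by auto
  have "star_removal K K'"
    using S Suc.prems(2)[OF S] w iff by (intro star_removalI[of S w]) (auto simp: K'_def)
  moreover have "collapses K' {U \<in> K'. U \<inter> X \<notin> SS - {S}}"
  proof (rule Suc.hyps(1))
    show "n = card (SS - {S})"
      using Suc S by simp
    show "U \<inter> X \<in> SS - {S}" if "S' \<in> SS - {S}" "U \<in> K'" "S' \<subseteq> U" for S' U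
      using that Suc.prems(3)[of S' U] by (auto simp: K'_def)
    show "\<exists>w. w \<notin> X \<and> (\<forall>U\<in>K'. U \<inter> X = S' \<longrightarrow> insert w U \<in> K')" if S': "S' \<in> SS - {S}" for S'
    proof -
      obtain w' where w': "w' \<notin> X" "\<And>U. U \<in> K \<Longrightarrow> U \<inter> X = S' \<Longrightarrow> insert w' U \<in> K"
        using Suc.prems(4)[of S'] S' by auto
      have "insert w' U \<in> K'" if "U \<in> K'" "U \<inter> X = S'" for U
        using that w' Suc.prems(2)[OF S] by (auto simp: K'_def)
      with w' show ?thesis by blast
    qed
  qed (use Suc.prems in auto)
  moreover have "U \<in> K' \<and> U \<inter> X \<notin> SS - {S} \<longleftrightarrow> U \<in> K \<and> U \<inter> X \<notin> SS" for U
  proof -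
    have "U \<in> K' \<longleftrightarrow> U \<in> K \<and> U \<inter> X \<noteq> S"
      unfolding K'_def mem_Collect_eq using iff[of U] by argo
    then show ?thesis
      using S by (cases "U \<inter> X = S") simp_all
  qed
  ultimately show ?case
    by (simp add: converse_rtranclp_into_rtranclp)
qed

text \<open>The collapse may stop at any cone; the cone point is used directly where a contractible
  piece is removed.\<close>

definition collapsible :: "'a set set \<Rightarrow> bool" where
  "collapsible K \<longleftrightarrow> (\<exists>C w. collapses K C \<and> (\<forall>\<tau>\<in>C. insert w \<tau> \<in> C))"

lemma collapsible_cone:
  assumes "\<And>\<tau>. \<tau> \<in> K \<Longrightarrow> insert w \<tau> \<in> K"
  shows "collapsible K"
  unfolding collapsible_def using assms by blast

lemma collapsible_if_collapses:
  assumes "collapses K L" "collapsible L"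
  shows "collapsible K"
  using assms unfolding collapsible_def by (meson rtranclp_trans)

section \<open>Joins and suspensions\<close>

text \<open>Barycentric coordinates are transported along \<open>h\<close> and along its inverse,
  with value 0 off the vertex sets. Injectivity is asked only on \<open>V\<close>, which contains
  all vertices that occur.\<close>

lemma realization_image_homeomorphic:
  assumes K: "simplicial K" "K \<subseteq> Pow V" and h: "inj_on h V"
  shows "geometric_realization ((`) h ` K) homeomorphic_space geometric_realization K"
proof -
  let ?X = "geometric_realization ((`) h ` K)" and ?Y = "geometric_realization K"
  define g where "g = inv_into V h"
  define p where "p \<beta> v = (if v \<in> V then \<beta> (h v) else 0)" for \<beta> :: "'b \<Rightarrow> real" and v
  define q where "q \<alpha> u = (if u \<in> h ` V then \<alpha> (g u) else 0)" for \<alpha> :: "'a \<Rightarrow> real" and u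
  have gh: "g (h v) = v" if "v \<in> V" for v
    using h that by (simp add: g_def)
  have p: "p \<beta> \<in> topspace ?Y" "q (p \<beta>) = \<beta>" if \<beta>: "\<beta> \<in> topspace ?X" for \<beta>
  proof -
    obtain \<sigma> where \<sigma>: "\<sigma> \<in> K" "{u. \<beta> u \<noteq> 0} = h ` \<sigma>"
      using geometric_realizationD(2)[OF \<beta>] by auto
    have fin: "finite \<sigma>" and sub: "\<sigma> \<subseteq> V"
      using simplicialD(1)[OF K(1) \<sigma>(1)] K(2) \<sigma>(1) by auto
    have supp: "{v. p \<beta> v \<noteq> 0} = \<sigma>"
      using \<sigma>(2) sub h by (auto simp: p_def inj_on_def)
    show "p \<beta> \<in> topspace ?Y"
    proof (rule geometric_realizationI[OF _ _ fin])
      have "sum (p \<beta>) \<sigma> = sum \<beta> (h ` \<sigma>)"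
        using sub by (subst sum.reindex) (auto simp: p_def intro!: sum.cong inj_on_subset[OF h])
      then show "sum (p \<beta>) \<sigma> = 1"
        using geometric_realizationD(3)[OF \<beta>] \<sigma>(2) by simp
    qed (use supp \<sigma> geometric_realizationD(1)[OF \<beta>] in \<open>auto simp: p_def\<close>)
    show "q (p \<beta>) = \<beta>"
    proof
      show "q (p \<beta>) u = \<beta> u" for u
        using \<sigma>(2) sub by (cases "u \<in> h ` V") (auto simp: q_def p_def gh)
    qed
  qed
  have q: "q \<alpha> \<in> topspace ?X" "p (q \<alpha>) = \<alpha>" if \<alpha>: "\<alpha> \<in> topspace ?Y" for \<alpha>
  proof -
    let ?\<sigma> = "{v. \<alpha> v \<noteq> 0}"
    have \<sigma>: "?\<sigma> \<in> K"
      using geometric_realizationD(2)[OF \<alpha>] .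
    have fin: "finite ?\<sigma>" and sub: "?\<sigma> \<subseteq> V"
      using simplicialD(1)[OF K(1) \<sigma>] K(2) \<sigma> by auto
    have supp: "{u. q \<alpha> u \<noteq> 0} = h ` ?\<sigma>"
      using sub gh by (auto simp: q_def image_iff subset_iff) metis
    show "q \<alpha> \<in> topspace ?X"
    proof (rule geometric_realizationI[OF _ _ finite_imageI[OF fin]])
      have "sum (q \<alpha>) (h ` ?\<sigma>) = sum \<alpha> ?\<sigma>"
        using sub by (subst sum.reindex) (auto simp: q_def gh intro!: sum.cong inj_on_subset[OF h])
      then show "sum (q \<alpha>) (h ` ?\<sigma>) = 1"
        using geometric_realizationD(3)[OF \<alpha>] by simp
    qed (use supp \<sigma> geometric_realizationD(1)[OF \<alpha>] in \<open>auto simp: q_def\<close>)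
    show "p (q \<alpha>) = \<alpha>"
      using sub by (auto simp: fun_eq_iff q_def p_def gh)
  qed
  have "continuous_map ?X ?Y p"
    unfolding continuous_map_geometric_realization
  proof (intro conjI allI ballI p)
    show "continuous_map ?X euclideanreal (\<lambda>\<beta>. p \<beta> v)" for v
      by (cases "v \<in> V") (auto simp: p_def intro: continuous_intros)
  qed
  moreover have "continuous_map ?Y ?X q"
    unfolding continuous_map_geometric_realization
  proof (intro conjI allI ballI q)
    show "continuous_map ?Y euclideanreal (\<lambda>\<alpha>. q \<alpha> u)" for u
      by (cases "u \<in> h ` V") (auto simp: q_def intro: continuous_intros)
  qed
  ultimately have "homeomorphic_maps ?X ?Y p q"
    using p q by (auto simp: homeomorphic_maps_def)
  then show ?thesis
    unfolding homeomorphic_space_def by blast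
qed

definition simplicial_join :: "'a set set \<Rightarrow> 'b set set \<Rightarrow> ('a + 'b) set set" where
  "simplicial_join K M = {U. Inl -` U \<in> K \<and> Inr -` U \<in> M}"

text \<open>The numbers \<open>2 * i\<close> and \<open>Suc (2 * i)\<close> are antipodal. This is
  the join of \<open>d\<close> pairs of points, a sphere of dimension \<open>d - 1\<close>; for
  \<open>d = 0\<close> only the empty simplex is left, so that the join with it changes nothing but
  the names of the vertices.\<close>

definition cross_polytope :: "nat \<Rightarrow> nat set set" where
  "cross_polytope d = {T. T \<subseteq> {..<2 * d} \<and> (\<forall>i. \<not> (2 * i \<in> T \<and> Suc (2 * i) \<in> T))}"

lemma sum_set_eq: "U = Inl ` (Inl -` U) \<union> Inr ` (Inr -` U)"
proof -
  have "x \<in> Inl ` (Inl -` U) \<union> Inr ` (Inr -` U)" if "x \<in> U" for x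
    using that by (cases x) auto
  then show ?thesis by auto
qed

lemma finite_sum_set_iff: "finite U \<longleftrightarrow> finite (Inl -` U) \<and> finite (Inr -` U)"
  by (metis sum_set_eq finite_UnI finite_imageI finite_vimageI inj_Inl inj_Inr)

lemma vimage_sum_insert [simp]:
  "Inl -` insert (Inl x) U = insert x (Inl -` U)" "Inl -` insert (Inr y) U = Inl -` U"
  "Inr -` insert (Inl x) U = Inr -` U" "Inr -` insert (Inr y) U = insert y (Inr -` U)"
  by auto

lemma vimage_sum_image [simp]:
  "Inl -` Inl ` S = S" "Inr -` Inr ` T = T" "Inl -` Inr ` T = {}" "Inr -` Inl ` S = {}"
  by auto

lemma simplicial_cross_polytope: "simplicial (cross_polytope d)"
  unfolding simplicial_def cross_polytope_def
  by (auto intro: finite_subset)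

lemma simplicial_simplicial_join:
  assumes "simplicial K" "simplicial M"
  shows "simplicial (simplicial_join K M)"
  unfolding simplicial_def simplicial_join_def
proof (intro ballI conjI subsetI; clarsimp)
  fix U assume U: "Inl -` U \<in> K" "Inr -` U \<in> M"
  then show "finite U"
    using assms by (simp add: finite_sum_set_iff simplicial_def)
  fix T assume "T \<subseteq> U"
  then show "Inl -` T \<in> K \<and> Inr -` T \<in> M"
    using assms U simplicialD(2) by (metis vimage_mono)
qed

text \<open>Removed face and apex lie in the left factor, so the link of the face in the join is
  still a cone. Thus collapses survive suspension for purely combinatorial reasons.\<close>

lemma star_removal_join:
  assumes "star_removal K L"
  shows "star_removal (simplicial_join K M) (simplicial_join L M)"
proof -
  obtain \<sigma> w where \<sigma>: "finite \<sigma>" "\<sigma> \<noteq> {}" "w \<notin> \<sigma>"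
    and apex: "\<And>\<tau>. \<tau> \<in> K \<Longrightarrow> \<sigma> \<subseteq> \<tau> \<Longrightarrow> insert w \<tau> \<in> K" and L: "L = {\<tau> \<in> K. \<not> \<sigma> \<subseteq> \<tau>}"
    using assms unfolding star_removal_def by blast
  have iff: "Inl ` \<sigma> \<subseteq> U \<longleftrightarrow> \<sigma> \<subseteq> Inl -` U" for U :: "('a + 'b) set"
    by auto
  show ?thesis
    by (rule star_removalI[of "Inl ` \<sigma>" "Inl w"])
      (use \<sigma> apex in \<open>auto simp: simplicial_join_def iff L\<close>)
qed

lemma collapses_join:
  assumes "collapses K L"
  shows "collapses (simplicial_join K M) (simplicial_join L M)"
  using assms
  by (induction rule: rtranclp_induct) (auto intro: star_removal_join rtranclp.rtrancl_into_rtrancl)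

text \<open>In \<open>pole_complex d K F\<close> the last two vertices of the cross polytope are cone points
  over \<open>F (2 * d)\<close> and \<open>F (Suc (2 * d))\<close> only.\<close>

definition pole_complex :: "nat \<Rightarrow> 'a set set \<Rightarrow> (nat \<Rightarrow> 'a set set) \<Rightarrow> ('a + nat) set set" where
  "pole_complex d K F =
     {U. Inl -` U \<in> K \<and> Inr -` U \<in> cross_polytope (Suc d) \<and>
         (\<forall>x \<in> Inr -` U. 2 * d \<le> x \<longrightarrow> Inl -` U \<in> F x)}"

section \<open>Poles of a cross polytope and collapses of the cones attached at them\<close>

lemma cross_polytope_Suc_poles:
  assumes "T \<in> cross_polytope (Suc d)" "x \<in> T" "y \<in> T" "2 * d \<le> x" "2 * d \<le> y"
  shows "x = y"
proof -
  have "{x, y} \<subseteq> {2 * d, Suc (2 * d)}"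
    using assms by (auto simp: cross_polytope_def)
  then show ?thesis
    using assms by (auto simp: cross_polytope_def)
qed

lemma insert_pole_cross_polytope:
  assumes T: "T \<in> cross_polytope (Suc d)" and x: "x = 2 * d \<or> x = Suc (2 * d)"
    and old: "\<And>y. y \<in> T \<Longrightarrow> 2 * d \<le> y \<Longrightarrow> y = x"
  shows "insert x T \<in> cross_polytope (Suc d)"
proof -
  have "\<not> (2 * i \<in> insert x T \<and> Suc (2 * i) \<in> insert x T)" for i
  proof (cases "i = d")
    case True
    have "Suc (2 * d) \<in> T \<Longrightarrow> Suc (2 * d) = x" "2 * d \<in> T \<Longrightarrow> 2 * d = x"
      using old by auto
    then show ?thesis
      using True x by force
  next
    case False
    then have "2 * i \<noteq> x" "Suc (2 * i) \<noteq> x"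
      using x by presburger+
    then show ?thesis
      using T by (simp add: cross_polytope_def)
  qed
  then show ?thesis
    using T x by (auto simp: cross_polytope_def)
qed

lemma simplicial_pole_complex:
  assumes "simplicial K" "\<And>x. simplicial (F x)"
  shows "simplicial (pole_complex d K F)"
proof -
  have *: "T \<in> pole_complex d K F" if U: "U \<in> pole_complex d K F" and TU: "T \<subseteq> U" for U T
  proof -
    have "Inl -` T \<subseteq> Inl -` U" "Inr -` T \<subseteq> Inr -` U"
      using TU by auto
    moreover have "Inl -` U \<in> K" "Inr -` U \<in> cross_polytope (Suc d)"
      and "\<And>x. x \<in> Inr -` U \<Longrightarrow> 2 * d \<le> x \<Longrightarrow> Inl -` U \<in> F x"
      using U by (auto simp: pole_complex_def)
    ultimately have "Inl -` T \<in> K" "Inr -` T \<in> cross_polytope (Suc d)"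
      and "\<And>x. x \<in> Inr -` T \<Longrightarrow> 2 * d \<le> x \<Longrightarrow> Inl -` T \<in> F x"
      using simplicialD(2)[OF assms(1)] simplicialD(2)[OF assms(2)]
        simplicialD(2)[OF simplicial_cross_polytope] by (metis, metis, metis subsetD)
    then show ?thesis
      by (simp add: pole_complex_def)
  qed
  have "finite U" if "U \<in> pole_complex d K F" for U
    using that simplicialD(1)[OF assms(1)] simplicialD(1)[OF simplicial_cross_polytope[of "Suc d"]]
    by (auto simp: pole_complex_def finite_sum_set_iff)
  with * show ?thesis
    by (auto simp: simplicial_def)
qed

text \<open>A simplex contains at most one pole, so a removal in \<open>F x\<close> can be copied to
  the simplices containing \<open>x\<close> without touching the condition at the other pole. The
  face \<open>\<sigma>\<close> may be empty, because \<open>x\<close> itself belongs to the removed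
  face.\<close>

lemma star_removal_pole:
  assumes "finite \<sigma>" "w \<notin> \<sigma>" and apex: "\<And>\<tau>. \<tau> \<in> F x \<Longrightarrow> \<sigma> \<subseteq> \<tau> \<Longrightarrow> insert w \<tau> \<in> F x"
    and x: "2 * d \<le> x" and FK: "F x \<subseteq> K"
  shows "star_removal (pole_complex d K F) (pole_complex d K (F(x := {\<tau> \<in> F x. \<not> \<sigma> \<subseteq> \<tau>})))"
proof (rule star_removalI[of "insert (Inr x) (Inl ` \<sigma>)" "Inl w"])
  have iff: "insert (Inr x) (Inl ` \<sigma>) \<subseteq> U \<longleftrightarrow> x \<in> Inr -` U \<and> \<sigma> \<subseteq> Inl -` U" for U
    by auto
  show "insert (Inl w) U \<in> pole_complex d K F"
    if "U \<in> pole_complex d K F" "insert (Inr x) (Inl ` \<sigma>) \<subseteq> U" for U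
    using that apex[of "Inl -` U"] x FK cross_polytope_Suc_poles[of "Inr -` U" d x]
    unfolding iff by (auto simp: pole_complex_def)
  show "pole_complex d K (F(x := {\<tau> \<in> F x. \<not> \<sigma> \<subseteq> \<tau>})) =
      {\<tau> \<in> pole_complex d K F. \<not> insert (Inr x) (Inl ` \<sigma>) \<subseteq> \<tau>}"
    unfolding iff using x by (auto simp: pole_complex_def)
qed (use assms in auto)

lemma collapses_pole:
  assumes "collapses A A'" "A \<subseteq> K" "2 * d \<le> x"
  shows "A' \<subseteq> K \<and> collapses (pole_complex d K (F(x := A))) (pole_complex d K (F(x := A')))"
  using assms(1)
proof (induction rule: rtranclp_induct)
  case base
  show ?case using assms(2) by simp
next
  case (step L M)
  obtain \<sigma> w where \<sigma>: "finite \<sigma>" "\<sigma> \<noteq> {}" "w \<notin> \<sigma>"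
    and apex: "\<And>\<tau>. \<tau> \<in> L \<Longrightarrow> \<sigma> \<subseteq> \<tau> \<Longrightarrow> insert w \<tau> \<in> L" and M: "M = {\<tau> \<in> L. \<not> \<sigma> \<subseteq> \<tau>}"
    using step.hyps(2) unfolding star_removal_def by blast
  have "star_removal (pole_complex d K (F(x := L))) (pole_complex d K (F(x := M)))"
    using star_removal_pole[of \<sigma> w "F(x := L)" x d K] \<sigma> apex step.IH assms(3) by (simp add: M)
  with step.IH show ?case
    by (metis (no_types, lifting) M mem_Collect_eq rtranclp.rtrancl_into_rtrancl subset_iff)
qed

text \<open>Once \<open>F x\<close> has shrunk to a cone, the link of the pole \<open>x\<close> is a
  cone too, and the removal with empty \<open>\<sigma>\<close> deletes the whole open star of
  \<open>x\<close>.\<close>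

lemma collapses_pole_remove:
  assumes "collapsible A" "A \<subseteq> K" "2 * d \<le> x"
  shows "collapses (pole_complex d K (F(x := A))) (pole_complex d K (F(x := {})))"
proof -
  obtain C w where C: "collapses A C" "\<And>\<tau>. \<tau> \<in> C \<Longrightarrow> insert w \<tau> \<in> C"
    using assms(1) unfolding collapsible_def by blast
  then have "C \<subseteq> K" and *: "collapses (pole_complex d K (F(x := A))) (pole_complex d K (F(x := C)))"
    using collapses_pole[OF C(1) assms(2,3)] by auto
  then have "star_removal (pole_complex d K (F(x := C))) (pole_complex d K (F(x := {})))"
    using star_removal_pole[of "{}" w "F(x := C)" x d K] C(2) assms(3) by simp
  with * show ?thesis
    by (rule rtranclp.rtrancl_into_rtrancl)
qed

text \<open>Both complexes are collapses of \<open>A \<union> B\<close> with a cone attached to \<open>A\<close> and another one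
  attached to \<open>B\<close>: the cones themselves can be removed again, and the simplices outside
  \<open>A \<inter> B\<close> can be pushed into the cone points.\<close>

lemma union_homotopy_equivalent_suspension:
  fixes A B :: "'a set set"
  assumes A: "simplicial A" "collapsible A" "finite A"
    and B: "simplicial B" "collapsible B" "finite B" and ne: "{} \<in> A \<inter> B"
  shows "geometric_realization (simplicial_join (A \<union> B) (cross_polytope d)) homotopy_equivalent_space
         geometric_realization (simplicial_join (A \<inter> B) (cross_polytope (Suc d)))"
proof -
  define F where "F = (\<lambda>x::nat. {} :: 'a set set)(2 * d := A, Suc (2 * d) := B)"
  define E where "E = pole_complex d (A \<union> B) F"
  have "simplicial E"
    unfolding E_def using A B by (intro simplicial_pole_complex) (auto simp: F_def simplicial_def)
  have cross: "T \<in> cross_polytope d \<longleftrightarrow> T \<in> cross_polytope (Suc d) \<and> (\<forall>x\<in>T. \<not> 2 * d \<le> x)" for T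
    by (auto simp: cross_polytope_def)
  have "collapses E (pole_complex d (A \<union> B) (F(Suc (2 * d) := {})))"
    using collapses_pole_remove[of B "A \<union> B" d "Suc (2 * d)" "(\<lambda>x. {})(2 * d := A)"] B
    by (simp add: E_def F_def)
  also have "collapses \<dots> (pole_complex d (A \<union> B) (\<lambda>x. {}))"
    using collapses_pole_remove[of A "A \<union> B" d "2 * d" "\<lambda>x. {}"] A
    by (simp add: F_def fun_upd_twist fun_upd_idem)
  also have "pole_complex d (A \<union> B) (\<lambda>x. {}) = simplicial_join (A \<union> B) (cross_polytope d)"
    by (auto simp: pole_complex_def simplicial_join_def cross)
  finally have 1: "collapses E (simplicial_join (A \<union> B) (cross_polytope d))" .
  \<comment> \<open>These are the traces to be pushed into a pole: a simplex outside
    \<open>A \<inter> B\<close> lies below exactly one of the two cones.\<close>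
  let ?SS = "(`) Inl ` (A \<union> B - A \<inter> B) :: ('a + nat) set set"
  have Inl_part: "U \<inter> range Inl \<in> ?SS \<longleftrightarrow> Inl -` U \<in> A \<union> B - A \<inter> B" for U :: "('a + nat) set"
  proof -
    have "U \<inter> range Inl = Inl ` (Inl -` U)" by auto
    moreover have "inj ((`) Inl :: 'a set \<Rightarrow> ('a + nat) set)"
      by (simp add: inj_image_eq_iff inj_on_def)
    ultimately show ?thesis by (simp only: inj_image_mem_iff)
  qed
  have "collapses E {U \<in> E. U \<inter> range Inl \<notin> ?SS}"
  proof (rule collapses_discard)
    show "finite ?SS" using A B by auto
    show "finite S \<and> S \<noteq> {} \<and> S \<subseteq> range Inl" if "S \<in> ?SS" for S
      using that A B ne by (auto simp: simplicial_def)
    show "U \<inter> range Inl \<in> ?SS" if S: "S \<in> ?SS" and U: "U \<in> E" "S \<subseteq> U" for S U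
    proof -
      have "Inl -` S \<in> A \<union> B - A \<inter> B" "Inl -` S \<subseteq> Inl -` U"
        using S U by auto
      moreover have "Inl -` U \<in> A \<union> B"
        using U by (simp add: E_def pole_complex_def)
      ultimately show ?thesis
        unfolding Inl_part using simplicialD(2)[OF A(1)] simplicialD(2)[OF B(1)] by blast
    qed
    show "\<exists>w. w \<notin> range Inl \<and> (\<forall>U\<in>E. U \<inter> range Inl = S \<longrightarrow> insert w U \<in> E)" if S: "S \<in> ?SS" for S
    proof -
      define x where "x = (if Inl -` S \<in> A then 2 * d else Suc (2 * d))"
      have "insert (Inr x) U \<in> E" if U: "U \<in> E" "U \<inter> range Inl = S" for U
      proof -
        have S': "Inl -` S = Inl -` U" using U by auto
        have AB: "Inl -` U \<in> A \<union> B - A \<inter> B"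
          using S U Inl_part by blast
        \<comment> \<open>The opposite pole cannot be present, since its cone stands over the piece
          that does not contain this simplex.\<close>
        have old: "y = x" if "y \<in> Inr -` U" "2 * d \<le> y" for y
        proof -
          have "y < Suc (Suc (2 * d))" "Inl -` U \<in> F y"
            using that U by (auto simp: E_def pole_complex_def cross_polytope_def)
          then show ?thesis
            using that AB by (auto simp: x_def S' F_def split: if_splits)
        qed
        have "insert x (Inr -` U) \<in> cross_polytope (Suc d)"
          using U old by (intro insert_pole_cross_polytope) (auto simp: E_def pole_complex_def x_def)
        moreover have "Inl -` U \<in> F x"
          using AB by (auto simp: F_def x_def S')
        moreover have "Inl -` U \<in> F y" if "y \<in> insert x (Inr -` U)" "2 * d \<le> y" for y
          using that old \<open>Inl -` U \<in> F x\<close> by auto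
        ultimately show ?thesis
          using U by (simp add: E_def pole_complex_def)
      qed
      then show ?thesis
        by (intro exI[of _ "Inr x"]) auto
    qed
  qed
  also have "{U \<in> E. U \<inter> range Inl \<notin> ?SS} = simplicial_join (A \<inter> B) (cross_polytope (Suc d))"
  proof -
    have "Inl -` U \<in> F x" if "Inl -` U \<in> A \<inter> B" "x \<in> Inr -` U" "2 * d \<le> x"
      "Inr -` U \<in> cross_polytope (Suc d)" for U x
    proof -
      have "x = 2 * d \<or> x = Suc (2 * d)"
        using that by (auto simp: cross_polytope_def)
      then show ?thesis using that by (auto simp: F_def)
    qed
    then show ?thesis
      unfolding Inl_part by (auto simp: E_def pole_complex_def simplicial_join_def)
  qed
  finally have 2: "collapses E (simplicial_join (A \<inter> B) (cross_polytope (Suc d)))" .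
  from 1 2 \<open>simplicial E\<close> show ?thesis
    by (meson collapses_homotopy_equivalent homotopy_eqv_trans homotopy_equivalent_space_sym)
qed

section \<open>Discs with a common boundary\<close>

text \<open>The end of the homotopy is constant on the fibres of \<open>F\<close> and descends to a
  homotopy inverse \<open>G\<close>. The whole homotopy maps fibres into fibres and descends to a
  homotopy \<open>M\<close> from the identity of \<open>W\<close> to
  \<open>F \<circ> G\<close>.\<close>

lemma quotient_homotopy_equivalent:
  assumes F: "quotient_map Z W F"
    and H: "continuous_map (prod_topology (top_of_set {0..1::real}) Z) Z H"
    and H0: "\<And>x. x \<in> topspace Z \<Longrightarrow> H (0, x) = x"
    and Ht: "\<And>t x y. \<lbrakk>t \<in> {0..1}; x \<in> topspace Z; y \<in> topspace Z; F x = F y\<rbrakk> \<Longrightarrow> F (H (t, x)) = F (H (t, y))"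
    and H1: "\<And>x y. \<lbrakk>x \<in> topspace Z; y \<in> topspace Z; F x = F y\<rbrakk> \<Longrightarrow> H (1, x) = H (1, y)"
  shows "Z homotopy_equivalent_space W"
proof -
  let ?I = "top_of_set {0..1::real}"
  have Fcont: "continuous_map Z W F" and Fsurj: "F ` topspace Z = topspace W"
    using F by (simp_all add: quotient_imp_continuous_map quotient_imp_surjective_map)
  have "continuous_map Z Z (H \<circ> Pair 1)"
    by (rule continuous_map_o_Pair[OF H]) simp
  moreover have "(H \<circ> Pair 1) x = (H \<circ> Pair 1) y"
    if "x \<in> topspace Z" "y \<in> topspace Z" "F x = F y" for x y
    unfolding o_def by (rule H1[OF that])
  ultimately obtain G where G: "continuous_map W Z G"
    "\<And>x. x \<in> topspace Z \<Longrightarrow> G (F x) = (H \<circ> Pair 1) x"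
    by (rule quotient_map_lift_exists[OF F]) auto
  have "locally_compact_space ?I"
    by (simp add: compact_imp_locally_compact_space compact_space_subtopology)
  \<comment> \<open>Continuity of the descended homotopy needs a quotient map on the product; local
    compactness of the interval provides it.\<close>
  then have Q: "quotient_map (prod_topology ?I Z) (prod_topology ?I W) (\<lambda>(t, x). (t, F x))"
    by (intro quotient_map_prod_right F) (auto simp: Hausdorff_space_subtopology)
  have "continuous_map (prod_topology ?I Z) W (F \<circ> H)"
    using H Fcont by (rule continuous_map_compose)
  moreover have "(F \<circ> H) p = (F \<circ> H) q"
    if "p \<in> topspace (prod_topology ?I Z)" "q \<in> topspace (prod_topology ?I Z)"
      "(\<lambda>(t, x). (t, F x)) p = (\<lambda>(t, x). (t, F x)) q" for p q
    using that Ht[of "fst p" "snd p" "snd q"] by (cases p; cases q) simp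
  ultimately obtain M where M: "continuous_map (prod_topology ?I W) W M"
    "\<And>p. p \<in> topspace (prod_topology ?I Z) \<Longrightarrow> M ((\<lambda>(t, x). (t, F x)) p) = (F \<circ> H) p"
    by (rule quotient_map_lift_exists[OF Q]) auto
  have M': "M (t, F x) = F (H (t, x))" if "t \<in> {0..1}" "x \<in> topspace Z" for t x
    using M(2)[of "(t, x)"] that by simp
  have "homotopic_with (\<lambda>x. True) Z Z id (G \<circ> F)"
    by (subst homotopic_with, simp) (use H H0 G in auto)
  moreover have "homotopic_with (\<lambda>x. True) W W id (F \<circ> G)"
  proof (subst homotopic_with, simp, intro exI[of _ M] conjI ballI)
    fix w assume "w \<in> topspace W"
    then obtain x where x: "x \<in> topspace Z" "w = F x"
      using Fsurj by auto
    show "M (0, w) = id w" "M (1, w) = (F \<circ> G) w"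
      using M'[of 0 x] M'[of 1 x] x H0 G(2) by auto
  qed (use M in auto)
  ultimately show ?thesis
    unfolding homotopy_equivalent_space_def using Fcont G(1) by (metis homotopic_with_sym)
qed

definition discrete_complex :: "'a set \<Rightarrow> 'a set set" where
  "discrete_complex V = insert {} ((\<lambda>v. {v}) ` V)"

lemma simplicial_discrete_complex: "simplicial (discrete_complex V)"
  by (auto simp: simplicial_def discrete_complex_def subset_singleton_iff)

text \<open>The join of \<open>j + 1\<close> points with the boundary of the \<open>d\<close>-dimensional cross polytope
  is a union of \<open>j + 1\<close> discs glued along their boundaries.\<close>

definition disc_fan :: "nat \<Rightarrow> nat \<Rightarrow> (nat + nat \<Rightarrow> real) topology" where
  "disc_fan j d = geometric_realization (simplicial_join (discrete_complex {..j}) (cross_polytope d))"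

text \<open>Membership is rewritten as weak inequalities, equations and disjunctions of equations
  between coordinates, which shows closedness and lets points be built explicitly.\<close>

lemma topspace_disc_fan:
  "\<phi> \<in> topspace (disc_fan j d) \<longleftrightarrow>
     (\<forall>x. 0 \<le> \<phi> x) \<and> (\<forall>v>j. \<phi> (Inl v) = 0) \<and>
     (\<forall>v w. v \<noteq> w \<longrightarrow> \<phi> (Inl v) = 0 \<or> \<phi> (Inl w) = 0) \<and>
     (\<forall>x\<ge>2 * d. \<phi> (Inr x) = 0) \<and>
     (\<forall>i. \<phi> (Inr (2 * i)) = 0 \<or> \<phi> (Inr (Suc (2 * i))) = 0) \<and>
     (\<Sum>v\<le>j. \<phi> (Inl v)) + (\<Sum>x<2 * d. \<phi> (Inr x)) = 1"
  (is "?L \<longleftrightarrow> ?R")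
proof -
  let ?F = "Inl ` {..j} \<union> Inr ` {..<2 * d} :: (nat + nat) set"
  have fin: "finite ?F" by simp
  have sum: "sum \<phi> ?F = (\<Sum>v\<le>j. \<phi> (Inl v)) + (\<Sum>x<2 * d. \<phi> (Inr x))"
    by (subst sum.union_disjoint) (auto simp: sum.reindex)
  have supp: "{x. \<phi> x \<noteq> 0} \<in> simplicial_join (discrete_complex {..j}) (cross_polytope d) \<longleftrightarrow>
     (\<forall>v>j. \<phi> (Inl v) = 0) \<and> (\<forall>v w. v \<noteq> w \<longrightarrow> \<phi> (Inl v) = 0 \<or> \<phi> (Inl w) = 0) \<and>
     (\<forall>x\<ge>2 * d. \<phi> (Inr x) = 0) \<and> (\<forall>i. \<phi> (Inr (2 * i)) = 0 \<or> \<phi> (Inr (Suc (2 * i))) = 0)"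
  proof -
    have "Inl -` {x. \<phi> x \<noteq> 0} \<in> discrete_complex {..j} \<longleftrightarrow>
      (\<forall>v>j. \<phi> (Inl v) = 0) \<and> (\<forall>v w. v \<noteq> w \<longrightarrow> \<phi> (Inl v) = 0 \<or> \<phi> (Inl w) = 0)"
    proof (cases "\<exists>v. \<phi> (Inl v) \<noteq> 0")
      case True
      then obtain v where v: "\<phi> (Inl v) \<noteq> 0" by blast
      have "Inl -` {x. \<phi> x \<noteq> 0} \<in> discrete_complex {..j} \<longleftrightarrow> v \<le> j \<and> (\<forall>w. \<phi> (Inl w) \<noteq> 0 \<longrightarrow> w = v)"
        using v by (auto simp: discrete_complex_def set_eq_iff image_iff)
      also have "\<dots> \<longleftrightarrow> (\<forall>v>j. \<phi> (Inl v) = 0) \<and> (\<forall>v w. v \<noteq> w \<longrightarrow> \<phi> (Inl v) = 0 \<or> \<phi> (Inl w) = 0)"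
        using v by (metis leD leI)
      finally show ?thesis .
    qed (auto simp: discrete_complex_def)
    moreover have "Inr -` {x. \<phi> x \<noteq> 0} \<in> cross_polytope d \<longleftrightarrow>
      (\<forall>x\<ge>2 * d. \<phi> (Inr x) = 0) \<and> (\<forall>i. \<phi> (Inr (2 * i)) = 0 \<or> \<phi> (Inr (Suc (2 * i))) = 0)"
      by (auto simp: cross_polytope_def subset_iff not_less[symmetric])
    ultimately show ?thesis
      by (simp add: simplicial_join_def)
  qed
  show ?thesis
  proof
    assume L: ?L
    then have nn: "\<And>x. 0 \<le> \<phi> x" and S: "{x. \<phi> x \<noteq> 0} \<in> simplicial_join (discrete_complex {..j}) (cross_polytope d)"
      unfolding disc_fan_def by (auto dest: geometric_realizationD)
    have "{x. \<phi> x \<noteq> 0} \<subseteq> ?F"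
    proof
      fix x assume "x \<in> {x. \<phi> x \<noteq> 0}"
      then show "x \<in> ?F"
        using S unfolding supp by (cases x) (simp_all add: image_iff, (meson not_le)+)
    qed
    then have "sum \<phi> ?F = 1"
      using L geometric_realizationD(4)[OF _ fin] unfolding disc_fan_def by blast
    with nn S show ?R unfolding supp sum by blast
  next
    assume R: ?R
    show ?L
      unfolding disc_fan_def
    proof (rule geometric_realizationI[OF _ _ fin])
      show "{x. \<phi> x \<noteq> 0} \<subseteq> ?F"
      proof
        fix x assume "x \<in> {x. \<phi> x \<noteq> 0}"
        then show "x \<in> ?F"
          using R by (cases x) (simp_all add: image_iff, (meson not_le)+)
      qed
    qed (use R in \<open>simp_all only: supp sum, blast+\<close>)
  qed
qed

lemma disc_fanD:
  assumes "\<phi> \<in> topspace (disc_fan j d)"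
  shows "0 \<le> \<phi> x" "j < v \<Longrightarrow> \<phi> (Inl v) = 0" "\<phi> (Inl v) \<noteq> 0 \<Longrightarrow> v \<noteq> w \<Longrightarrow> \<phi> (Inl w) = 0"
    "2 * d \<le> k \<Longrightarrow> \<phi> (Inr k) = 0" "\<phi> (Inr (2 * i)) = 0 \<or> \<phi> (Inr (Suc (2 * i))) = 0"
    "(\<Sum>v\<le>j. \<phi> (Inl v)) + (\<Sum>x<2 * d. \<phi> (Inr x)) = 1"
  using assms unfolding topspace_disc_fan by blast+

lemma continuous_map_disc_fan_coordinate [continuous_intros]:
  "continuous_map (disc_fan j d) euclideanreal (\<lambda>\<phi>. \<phi> x)"
  unfolding disc_fan_def by (rule continuous_map_realization_coordinate)

lemma disc_fan_eq: "disc_fan j d = top_of_set (topspace (disc_fan j d))"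
  unfolding disc_fan_def geometric_realization_def euclidean_product_topology by simp

text \<open>The space is a closed subset of a product of unit intervals, which is compact by
  Tychonoff's theorem. Compactness later makes the maps onto spheres quotient maps.\<close>

lemma compact_disc_fan: "compact (topspace (disc_fan j d))"
proof -
  have "compactin (powertop_real UNIV) (PiE UNIV (\<lambda>x :: nat + nat. {0..1::real}))"
    by (subst compactin_PiE) auto
  then have box: "compact (PiE UNIV (\<lambda>x :: nat + nat. {0..1::real}))"
    by (simp add: euclidean_product_topology)
  have "\<phi> \<in> PiE UNIV (\<lambda>x :: nat + nat. {0..1::real})" if \<phi>: "\<phi> \<in> topspace (disc_fan j d)" for \<phi>
  proof -
    have "\<phi> x \<le> 1" for x
    proof -
      have "\<phi> (Inl v) \<le> (\<Sum>v\<le>j. \<phi> (Inl v))" if "v \<le> j" for v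
        using that disc_fanD(1)[OF \<phi>] by (intro member_le_sum) auto
      moreover have "\<phi> (Inr k) \<le> (\<Sum>x<2 * d. \<phi> (Inr x))" if "k < 2 * d" for k
        using that disc_fanD(1)[OF \<phi>] by (intro member_le_sum) auto
      moreover have "0 \<le> (\<Sum>v\<le>j. \<phi> (Inl v))" "0 \<le> (\<Sum>x<2 * d. \<phi> (Inr x))"
        using disc_fanD(1)[OF \<phi>] by (auto intro: sum_nonneg)
      ultimately show ?thesis
        using disc_fanD(2)[OF \<phi>] disc_fanD(4)[OF \<phi>] disc_fanD(6)[OF \<phi>]
        by (cases x) (smt (verit) linorder_not_le)+
    qed
    then show ?thesis
      using disc_fanD(1)[OF \<phi>] by auto
  qed
  moreover have "closed (topspace (disc_fan j d))"
  proof -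
    have "topspace (disc_fan j d) = {\<phi>. (\<forall>x. 0 \<le> \<phi> x) \<and> (\<forall>v. v > j \<longrightarrow> \<phi> (Inl v) = 0) \<and>
     (\<forall>v w. v \<noteq> w \<longrightarrow> \<phi> (Inl v) = 0 \<or> \<phi> (Inl w) = 0) \<and>
     (\<forall>x. x \<ge> 2 * d \<longrightarrow> \<phi> (Inr x) = 0) \<and>
     (\<forall>i. \<phi> (Inr (2 * i)) = 0 \<or> \<phi> (Inr (Suc (2 * i))) = 0) \<and>
     (\<Sum>v\<le>j. \<phi> (Inl v)) + (\<Sum>x<2 * d. \<phi> (Inr x)) = 1}"
      using topspace_disc_fan by blast
    then show ?thesis
      by (simp only:) (intro closed_Collect_conj closed_Collect_all closed_Collect_imp closed_Collect_disj
        closed_Collect_le closed_Collect_eq open_Collect_const continuous_intros continuous_on_product_coordinates)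
  qed
  ultimately show ?thesis
    using compact_Int_closed[OF box] by (metis inf.absorb_iff2 subsetI)
qed

text \<open>At most one of two antipodal weights is nonzero, so the signed difference determines
  both. It turns the boundary of the cross polytope into a sphere of the 1-norm.\<close>

definition cross_coordinate :: "(nat + nat \<Rightarrow> real) \<Rightarrow> nat \<Rightarrow> real" where
  "cross_coordinate \<phi> i = \<phi> (Inr (2 * i)) - \<phi> (Inr (Suc (2 * i)))"

text \<open>On the disc with centre \<open>v\<close> this is the squared Euclidean norm of the cross
  coordinates. The second summand vanishes there; it keeps the denominator of the projection nonzero
  at the centres of the other discs.\<close>

definition other_weight :: "nat \<Rightarrow> nat \<Rightarrow> nat \<Rightarrow> (nat + nat \<Rightarrow> real) \<Rightarrow> real" where
  "other_weight j d v \<phi> = (\<Sum>i<d. (cross_coordinate \<phi> i)\<^sup>2) + (\<Sum>w\<in>{..j} - {v}. \<phi> (Inl w))\<^sup>2"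

text \<open>On the disc with centre \<open>v\<close> this is inverse stereographic projection of the point with
  coordinates \<open>cross_coordinate \<phi> i / \<phi> (Inl v)\<close>, written without that quotient, which makes
  no sense on the boundary; all other discs go to the base point.\<close>

definition disc_to_sphere :: "nat \<Rightarrow> nat \<Rightarrow> nat \<Rightarrow> (nat + nat \<Rightarrow> real) \<Rightarrow> nat \<Rightarrow> real" where
  "disc_to_sphere j d v \<phi> k =
     (case k of 0 \<Rightarrow> (other_weight j d v \<phi> - (\<phi> (Inl v))\<^sup>2) / (other_weight j d v \<phi> + (\<phi> (Inl v))\<^sup>2)
      | Suc i \<Rightarrow> if i < d then 2 * \<phi> (Inl v) * cross_coordinate \<phi> i
                            / (other_weight j d v \<phi> + (\<phi> (Inl v))\<^sup>2) else 0)"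

section \<open>Inverse stereographic projection on a single disc\<close>

lemma sum_lessThan_double: "(\<Sum>x<2 * d. f x) = (\<Sum>i<d. f (2 * i) + f (Suc (2 * i)))"
  for f :: "nat \<Rightarrow> real"
  by (induction d) (auto simp: algebra_simps)

lemma disc_fan_abs_cross:
  assumes "\<phi> \<in> topspace (disc_fan j d)"
  shows "\<phi> (Inr (2 * i)) = max 0 (cross_coordinate \<phi> i)"
    and "\<phi> (Inr (Suc (2 * i))) = max 0 (- cross_coordinate \<phi> i)"
  using disc_fanD(1)[OF assms, of "Inr (2 * i)"] disc_fanD(1)[OF assms, of "Inr (Suc (2 * i))"]
    disc_fanD(5)[OF assms, of i]
  by (auto simp: cross_coordinate_def)

lemma disc_fan_zero_others:
  assumes "\<phi> \<in> topspace (disc_fan j d)" "\<phi> (Inl v) \<noteq> 0"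
  shows "(\<Sum>w\<in>{..j} - {v}. \<phi> (Inl w)) = 0"
  using disc_fanD(3)[OF assms] by (intro sum.neutral) auto

text \<open>If this sum of squares vanished, all cross polytope weights and all centre weights would
  be 0, although the total weight is 1.\<close>

lemma disc_fan_denominator_pos:
  assumes \<phi>: "\<phi> \<in> topspace (disc_fan j d)" and v: "v \<le> j"
  shows "0 < other_weight j d v \<phi> + (\<phi> (Inl v))\<^sup>2"
proof (rule ccontr)
  assume neg: "\<not> ?thesis"
  have "0 \<le> (\<Sum>i<d. (cross_coordinate \<phi> i)\<^sup>2)"
    by (simp add: sum_nonneg)
  with neg have 0: "(\<Sum>i<d. (cross_coordinate \<phi> i)\<^sup>2) = 0" "(\<Sum>w\<in>{..j} - {v}. \<phi> (Inl w)) = 0" "\<phi> (Inl v) = 0"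
    unfolding other_weight_def by (smt (verit) zero_le_power2 power2_eq_iff zero_eq_power2)+
  have "cross_coordinate \<phi> i = 0" if "i < d" for i
    using 0(1) that by (subst (asm) sum_nonneg_eq_0_iff) auto
  then have "(\<Sum>x<2 * d. \<phi> (Inr x)) = 0"
    unfolding sum_lessThan_double disc_fan_abs_cross[OF \<phi>] by (intro sum.neutral) auto
  moreover have "(\<Sum>v\<le>j. \<phi> (Inl v)) = 0"
    using 0 v by (simp add: sum.remove[of "{..j}" v])
  ultimately show False
    using disc_fanD(6)[OF \<phi>] by simp
qed

lemma disc_to_sphere_in_nsphere:
  assumes \<phi>: "\<phi> \<in> topspace (disc_fan j d)" and v: "v \<le> j"
  shows "disc_to_sphere j d v \<phi> \<in> topspace (nsphere d)"
proof -
  define N where "N = other_weight j d v \<phi>"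
  define s where "s = \<phi> (Inl v)"
  define Z where "Z = (\<Sum>i<d. (cross_coordinate \<phi> i)\<^sup>2)"
  have pos: "0 < N + s\<^sup>2"
    using disc_fan_denominator_pos[OF assms] by (simp add: N_def s_def)
  \<comment> \<open>Either \<open>s = 0\<close>, or the other centres have weight 0 and
    \<open>N = Z\<close>. With this the norm reduces to \<open>(N - s\<^sup>2)\<^sup>2 + 4 *
    s\<^sup>2 * N = (N + s\<^sup>2)\<^sup>2\<close>.\<close>
  have sN: "s\<^sup>2 * Z = s\<^sup>2 * N"
    using disc_fan_zero_others[OF \<phi>, of v] by (cases "s = 0") (auto simp: s_def N_def Z_def other_weight_def)
  have "(\<Sum>i\<le>d. (disc_to_sphere j d v \<phi> i)\<^sup>2) =
      ((N - s\<^sup>2) / (N + s\<^sup>2))\<^sup>2 + (\<Sum>i<d. (2 * s * cross_coordinate \<phi> i / (N + s\<^sup>2))\<^sup>2)"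
    unfolding lessThan_Suc_atMost[symmetric] sum.lessThan_Suc_shift
    by (simp add: disc_to_sphere_def N_def s_def)
  also have "(\<Sum>i<d. (2 * s * cross_coordinate \<phi> i / (N + s\<^sup>2))\<^sup>2) = 4 * (s\<^sup>2 * Z) / (N + s\<^sup>2)\<^sup>2"
    by (simp add: Z_def sum_divide_distrib sum_distrib_left power_divide power_mult_distrib mult.assoc)
  also have "((N - s\<^sup>2) / (N + s\<^sup>2))\<^sup>2 + 4 * (s\<^sup>2 * Z) / (N + s\<^sup>2)\<^sup>2 = (N + s\<^sup>2)\<^sup>2 / (N + s\<^sup>2)\<^sup>2"
    unfolding sN power_divide add_divide_distrib[symmetric]
    by (rule arg_cong2[where f = "(/)"]) (simp_all add: power2_eq_square algebra_simps)
  also have "\<dots> = 1"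
    using pos by simp
  finally show ?thesis
    by (auto simp: nsphere disc_to_sphere_def split: nat.split)
qed

lemma continuous_map_disc_to_sphere:
  assumes "v \<le> j"
  shows "continuous_map (disc_fan j d) (nsphere d) (disc_to_sphere j d v)"
proof -
  have "continuous_map (disc_fan j d) euclideanreal (\<lambda>\<phi>. disc_to_sphere j d v \<phi> k)" for k
    unfolding disc_to_sphere_def other_weight_def cross_coordinate_def
    by (cases k) (auto intro!: continuous_intros
        simp: disc_fan_denominator_pos[OF _ assms, unfolded other_weight_def cross_coordinate_def, THEN less_imp_neq, symmetric])
  then show ?thesis
    using disc_to_sphere_in_nsphere[OF _ assms]
    by (auto simp: nsphere continuous_map_in_subtopology continuous_map_componentwise_UNIV)
qed

lemma disc_to_sphere_eq_base:
  assumes \<phi>: "\<phi> \<in> topspace (disc_fan j d)" and v: "v \<le> j"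
  shows "disc_to_sphere j d v \<phi> = nsphere_base \<longleftrightarrow> \<phi> (Inl v) = 0"
proof
  assume "disc_to_sphere j d v \<phi> = nsphere_base"
  then have "disc_to_sphere j d v \<phi> 0 = 1"
    by (simp add: nsphere_base_def)
  then show "\<phi> (Inl v) = 0"
    using disc_fan_denominator_pos[OF assms] by (simp add: disc_to_sphere_def)
next
  assume "\<phi> (Inl v) = 0"
  then show "disc_to_sphere j d v \<phi> = nsphere_base"
    using disc_fan_denominator_pos[OF assms]
    by (auto simp: disc_to_sphere_def nsphere_base_def fun_eq_iff split: nat.split)
qed

text \<open>Projecting back from the base point recovers the quotients of the cross coordinates by
  the weight of the centre, so two preimages are proportional with factor \<open>c\<close>; the
  total weight 1 forces \<open>c = 1\<close>.\<close>

lemma disc_to_sphere_inject: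
  assumes \<phi>: "\<phi> \<in> topspace (disc_fan j d)" and \<psi>: "\<psi> \<in> topspace (disc_fan j d)" and v: "v \<le> j"
    and nz: "\<phi> (Inl v) \<noteq> 0" and eq: "disc_to_sphere j d v \<phi> = disc_to_sphere j d v \<psi>"
  shows "\<phi> = \<psi>"
proof -
  have nz': "\<psi> (Inl v) \<noteq> 0"
    using disc_to_sphere_eq_base[OF \<phi> v] disc_to_sphere_eq_base[OF \<psi> v] nz eq by simp
  have quot: "cross_coordinate \<phi> i / \<phi> (Inl v) = disc_to_sphere j d v \<phi> (Suc i) / (1 - disc_to_sphere j d v \<phi> 0)"
    if "\<phi> \<in> topspace (disc_fan j d)" "\<phi> (Inl v) \<noteq> 0" "i < d" for \<phi> i
  proof -
    let ?D = "other_weight j d v \<phi> + (\<phi> (Inl v))\<^sup>2"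
    have D: "?D > 0" using disc_fan_denominator_pos[OF that(1) v] .
    then have "1 - disc_to_sphere j d v \<phi> 0 = 2 * (\<phi> (Inl v))\<^sup>2 / ?D"
      by (simp add: disc_to_sphere_def field_simps)
    moreover have "disc_to_sphere j d v \<phi> (Suc i) = 2 * \<phi> (Inl v) * cross_coordinate \<phi> i / ?D"
      using that by (simp add: disc_to_sphere_def)
    ultimately show ?thesis
      using D that(2) by (simp add: power2_eq_square)
  qed
  define s where "s = \<phi> (Inl v)"
  define s' where "s' = \<psi> (Inl v)"
  have s: "0 < s" "0 < s'"
    using nz nz' disc_fanD(1)[OF \<phi>, of "Inl v"] disc_fanD(1)[OF \<psi>, of "Inl v"] by (auto simp: s_def s'_def)
  define c where "c = s' / s"
  have c: "0 < c" "s' = c * s"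
    using s by (auto simp: c_def)
  have cross: "cross_coordinate \<psi> i = c * cross_coordinate \<phi> i" if "i < d" for i
    using quot[OF \<phi> nz that] quot[OF \<psi> nz' that] eq s by (simp add: s_def s'_def c_def field_simps)
  have max: "max 0 (c * b) = c * max 0 b" "max 0 (- (c * b)) = c * max 0 (- b)" for b
    using c by (auto simp: max_def zero_le_mult_iff mult_le_0_iff)
  have Inr: "\<psi> (Inr x) = c * \<phi> (Inr x)" for x
  proof (cases "x < 2 * d")
    case True
    show ?thesis
    proof (cases "even x")
      case True
      then obtain i where "x = 2 * i" by blast
      then show ?thesis
        using cross[of i] \<open>x < 2 * d\<close> by (simp add: disc_fan_abs_cross[OF \<phi>] disc_fan_abs_cross[OF \<psi>] max del: mult_Suc_right)
    next
      case False
      then obtain i where "x = Suc (2 * i)" by (metis Suc_eq_plus1 oddE)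
      then show ?thesis
        using cross[of i] \<open>x < 2 * d\<close> by (simp add: disc_fan_abs_cross[OF \<phi>] disc_fan_abs_cross[OF \<psi>] max)
    qed
  qed (simp add: disc_fanD(4)[OF \<phi>] disc_fanD(4)[OF \<psi>])
  have total: "\<phi> (Inl v) + (\<Sum>x<2 * d. \<phi> (Inr x)) = 1"
    if "\<phi> \<in> topspace (disc_fan j d)" "\<phi> (Inl v) \<noteq> 0" for \<phi>
    using disc_fanD(6)[OF that(1)] disc_fan_zero_others[OF that] v by (simp add: sum.remove[of "{..j}" v])
  have "c * (s + (\<Sum>x<2 * d. \<phi> (Inr x))) = s' + (\<Sum>x<2 * d. \<psi> (Inr x))"
    by (simp add: c Inr sum_distrib_left distrib_left)
  then have "c = 1"
    using total[OF \<phi> nz] total[OF \<psi> nz'] by (simp add: s_def s'_def)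
  then have "s' = s" "\<psi> (Inr x) = \<phi> (Inr x)" for x
    using c Inr by auto
  moreover have "\<psi> (Inl w) = \<phi> (Inl w)" for w
    using \<open>s' = s\<close> disc_fanD(3)[OF \<phi> nz, of w] disc_fanD(3)[OF \<psi> nz', of w]
    by (cases "w = v") (auto simp: s_def s'_def)
  ultimately have "\<phi> x = \<psi> x" for x
    by (cases x) auto
  then show ?thesis ..
qed

text \<open>The stereographic coordinates \<open>x i\<close> of \<open>y\<close> fix a ray, and
  \<open>s\<close> is the weight of the centre for which the total weight becomes 1.\<close>

lemma disc_to_sphere_onto:
  assumes y: "y \<in> topspace (nsphere d)" "y \<noteq> nsphere_base" and v: "v \<le> j"
  obtains \<phi> where "\<phi> \<in> topspace (disc_fan j d)" "\<phi> (Inl v) \<noteq> 0" "disc_to_sphere j d v \<phi> = y"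
proof -
  have "(\<Sum>i\<le>d. (y i)\<^sup>2) = 1" and beyond: "\<And>i. d < i \<Longrightarrow> y i = 0"
    using y(1) by (auto simp: nsphere)
  then have norm: "(y 0)\<^sup>2 + (\<Sum>i<d. (y (Suc i))\<^sup>2) = 1"
    unfolding lessThan_Suc_atMost[symmetric] sum.lessThan_Suc_shift by simp
  have "y 0 \<noteq> 1"
  proof
    assume "y 0 = 1"
    with norm have "(\<Sum>i<d. (y (Suc i))\<^sup>2) = 0" by simp
    then have "y (Suc i) = 0" if "i < d" for i
      using that by (subst (asm) sum_nonneg_eq_0_iff) auto
    then have "y i = nsphere_base i" for i
      using beyond[of i] \<open>y 0 = 1\<close> by (cases i) (simp_all add: nsphere_base_def, metis less_Suc_eq_le not_less)
    with y(2) show False by blast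
  qed
  moreover have "y 0 \<le> 1"
    using norm sum_nonneg[of "{..<d}" "\<lambda>i. (y (Suc i))\<^sup>2"] abs_square_le_1[of "y 0"] by simp
  ultimately have y0: "y 0 < 1" by simp
  define x where "x i = y (Suc i) / (1 - y 0)" for i
  define s where "s = 1 / (1 + (\<Sum>i<d. \<bar>x i\<bar>))"
  have L: "0 < 1 + (\<Sum>i<d. \<bar>x i\<bar>)"
    by (simp add: add_pos_nonneg sum_nonneg)
  then have s: "0 < s" "s + s * (\<Sum>i<d. \<bar>x i\<bar>) = 1"
    by (simp_all add: s_def field_simps)
  define \<phi> :: "nat + nat \<Rightarrow> real" where "\<phi> = case_sum (\<lambda>w. if w = v then s else 0)
    (\<lambda>k. if 2 * d \<le> k then 0 else s * (if even k then max 0 (x (k div 2)) else max 0 (- x (k div 2))))"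
  have cross: "cross_coordinate \<phi> i = s * x i" if "i < d" for i
    using that by (simp add: cross_coordinate_def \<phi>_def max_def)
  have \<phi>: "\<phi> \<in> topspace (disc_fan j d)"
    unfolding topspace_disc_fan
  proof (intro conjI allI impI)
    show "0 \<le> \<phi> k" for k
      using s by (auto simp: \<phi>_def split: sum.split)
    show "\<phi> (Inr (2 * i)) = 0 \<or> \<phi> (Inr (Suc (2 * i))) = 0" for i
      by (simp add: \<phi>_def max_def)
    have "(\<Sum>k<2 * d. \<phi> (Inr k)) = (\<Sum>i<d. s * \<bar>x i\<bar>)"
      unfolding sum_lessThan_double by (rule sum.cong) (auto simp: \<phi>_def max_def)
    moreover have "(\<Sum>w\<le>j. \<phi> (Inl w)) = s"
      using v by (simp add: \<phi>_def)
    ultimately show "(\<Sum>w\<le>j. \<phi> (Inl w)) + (\<Sum>k<2 * d. \<phi> (Inr k)) = 1"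
      using s(2) by (simp add: sum_distrib_left)
  qed (use v in \<open>auto simp: \<phi>_def\<close>)
  \<comment> \<open>\<open>R\<close> is the squared Euclidean norm of the stereographic image, by
    the norm equation of \<open>y\<close>.\<close>
  define R where "R = (1 + y 0) / (1 - y 0)"
  have R: "1 + R = 2 / (1 - y 0)" "R - 1 = 2 * y 0 / (1 - y 0)"
    using y0 by (simp_all add: R_def field_simps)
  have "(\<Sum>i<d. (x i)\<^sup>2) = (1 - (y 0)\<^sup>2) / (1 - y 0)\<^sup>2"
    using norm by (simp add: x_def power_divide flip: sum_divide_distrib)
  also have "\<dots> = (1 + y 0) * (1 - y 0) / ((1 - y 0) * (1 - y 0))"
    by (simp add: power2_eq_square algebra_simps)
  also have "\<dots> = R"
    using y0 by (simp add: R_def)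
  finally have "other_weight j d v \<phi> = s\<^sup>2 * R"
    using cross disc_fan_zero_others[OF \<phi>, of v] s(1)
    by (simp add: other_weight_def \<phi>_def power_mult_distrib flip: sum_distrib_left)
  then have D: "other_weight j d v \<phi> + (\<phi> (Inl v))\<^sup>2 = s\<^sup>2 * (1 + R)"
    "other_weight j d v \<phi> - (\<phi> (Inl v))\<^sup>2 = s\<^sup>2 * (R - 1)"
    by (simp_all add: \<phi>_def algebra_simps)
  have "disc_to_sphere j d v \<phi> k = y k" for k
  proof (cases k)
    case 0
    have "disc_to_sphere j d v \<phi> 0 = (R - 1) / (1 + R)"
      unfolding disc_to_sphere_def D using s(1) by simp
    then show ?thesis
      using y0 0 unfolding R by simp
  next
    case (Suc i)
    show ?thesis
    proof (cases "i < d")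
      case True
      have "disc_to_sphere j d v \<phi> (Suc i) = 2 * s * (s * x i) / (s\<^sup>2 * (1 + R))"
        using True by (simp add: disc_to_sphere_def D cross) (simp add: \<phi>_def)
      also have "\<dots> = 2 * x i / (1 + R)"
        using s(1) by (simp add: power2_eq_square)
      also have "\<dots> = y (Suc i)"
        using y0 unfolding R by (simp add: x_def)
      finally show ?thesis using Suc by simp
    qed (use Suc beyond in \<open>simp add: disc_to_sphere_def\<close>)
  qed
  then have "disc_to_sphere j d v \<phi> = y" ..
  with \<phi> s(1) show thesis
    by (intro that) (auto simp: \<phi>_def)
qed

section \<open>The quotient map that sends the disc with centre 0 to the base point\<close>

definition fan_to_wedge :: "nat \<Rightarrow> nat \<Rightarrow> (nat + nat \<Rightarrow> real) \<Rightarrow> (nat \<times> (nat \<Rightarrow> real)) option" where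
  "fan_to_wedge j d \<phi> =
     (if \<exists>i. \<phi> (Inl (Suc i)) \<noteq> 0
      then let i = THE i. \<phi> (Inl (Suc i)) \<noteq> 0 in wedge_inj nsphere_base i (disc_to_sphere j d (Suc i) \<phi>)
      else None)"

lemma wedge_inj_eq_None [simp]: "wedge_inj x0 i x = None \<longleftrightarrow> x = x0"
  by (simp add: wedge_inj_def)

text \<open>The formula also covers the disc with centre 0 and the common boundary, where both sides
  are \<open>None\<close>. Hence it holds on a closed set, as the quotient argument
  requires.\<close>

lemma fan_to_wedge_eq:
  assumes \<phi>: "\<phi> \<in> topspace (disc_fan j d)" and i: "i < j"
    and others: "\<And>k. k \<noteq> i \<Longrightarrow> \<phi> (Inl (Suc k)) = 0"
  shows "fan_to_wedge j d \<phi> = wedge_inj nsphere_base i (disc_to_sphere j d (Suc i) \<phi>)"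
proof (cases "\<phi> (Inl (Suc i)) = 0")
  case True
  with others have "fan_to_wedge j d \<phi> = None"
    unfolding fan_to_wedge_def by metis
  with True show ?thesis
    using disc_to_sphere_eq_base[OF \<phi>, of "Suc i"] i by (simp add: wedge_inj_def)
next
  case False
  then have "(THE i. \<phi> (Inl (Suc i)) \<noteq> 0) = i"
    using others by (intro the_equality) auto
  with False show ?thesis
    by (auto simp: fan_to_wedge_def)
qed

lemma fan_to_wedge_cases:
  assumes \<phi>: "\<phi> \<in> topspace (disc_fan j d)"
  obtains (base) "\<And>k. \<phi> (Inl (Suc k)) = 0" "fan_to_wedge j d \<phi> = None"
  | (sphere) i where "i < j" "\<phi> (Inl (Suc i)) \<noteq> 0"
      "fan_to_wedge j d \<phi> = Some (i, disc_to_sphere j d (Suc i) \<phi>)"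
proof (cases "\<exists>i. \<phi> (Inl (Suc i)) \<noteq> 0")
  case True
  then obtain i where i: "\<phi> (Inl (Suc i)) \<noteq> 0" by blast
  then have "i < j"
    using disc_fanD(2)[OF \<phi>, of "Suc i"] by (meson Suc_le_eq not_le)
  moreover have "\<phi> (Inl (Suc k)) = 0" if "k \<noteq> i" for k
    using disc_fanD(3)[OF \<phi> i, of "Suc k"] that by simp
  ultimately show ?thesis
    using fan_to_wedge_eq[OF \<phi>, of i] sphere i disc_to_sphere_eq_base[OF \<phi>, of "Suc i"]
    by (simp add: wedge_inj_def)
next
  case False
  then show ?thesis
    by (intro base) (auto simp: fan_to_wedge_def)
qed

text \<open>Each single-sphere map sends everything outside its own disc to the base point. Hence
  the preimage of an open set is the intersection of the preimages under these finitely many maps if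
  it contains the base point, and their union otherwise.\<close>

lemma continuous_map_fan_to_wedge:
  "continuous_map (disc_fan j d) (wedge_of_spheres j d) (fan_to_wedge j d)"
proof -
  let ?Z = "disc_fan j d" and ?W = "wedge_of_spheres j d"
  define r where "r i = disc_to_sphere j d (Suc i)" for i
  have r: "continuous_map ?Z (nsphere d) (r i)" if "i < j" for i
    unfolding r_def using that by (intro continuous_map_disc_to_sphere) simp
  have base_iff: "r i \<phi> = nsphere_base \<longleftrightarrow> \<phi> (Inl (Suc i)) = 0" if "\<phi> \<in> topspace ?Z" "i < j" for i \<phi>
    unfolding r_def using that by (intro disc_to_sphere_eq_base) auto
  have off: "r k \<phi> = nsphere_base"
    if "\<phi> \<in> topspace ?Z" "\<phi> (Inl (Suc i)) \<noteq> 0" "k < j" "k \<noteq> i" for i k \<phi>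
    using base_iff[OF that(1,3)] disc_fanD(3)[OF that(1,2), of "Suc k"] that by simp
  have "fan_to_wedge j d \<phi> \<in> topspace ?W" if \<phi>: "\<phi> \<in> topspace ?Z" for \<phi>
    using \<phi>
  proof (cases rule: fan_to_wedge_cases)
    case base
    then show ?thesis by (simp add: topspace_wedge_copies)
  next
    case (sphere i)
    then have "wedge_inj nsphere_base i (r i \<phi>) = fan_to_wedge j d \<phi>"
      using base_iff[OF \<phi>, of i] by (simp add: wedge_inj_def r_def)
    moreover have "r i \<phi> \<in> topspace (nsphere d)"
      using r[OF sphere(1)] \<phi> by (auto simp: continuous_map_def)
    ultimately show ?thesis
      using sphere(1) unfolding topspace_wedge_copies by (metis UN_I imageI insertI2 lessThan_iff)
  qed
  moreover have "openin ?Z {\<phi> \<in> topspace ?Z. fan_to_wedge j d \<phi> \<in> U}" if U: "openin ?W U" for U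
  proof -
    define V where "V i = {\<phi> \<in> topspace ?Z. wedge_inj nsphere_base i (r i \<phi>) \<in> U}" for i
    have openin_V: "openin ?Z (V i)" if "i < j" for i
    proof -
      have "openin (nsphere d) {x \<in> topspace (nsphere d). wedge_inj nsphere_base i x \<in> U}"
        using U that by (simp add: openin_wedge_copies)
      then have "openin ?Z {\<phi> \<in> topspace ?Z. r i \<phi> \<in> {x \<in> topspace (nsphere d). wedge_inj nsphere_base i x \<in> U}}"
        using r[OF that] by (rule openin_continuous_map_preimage[rotated])
      also have "{\<phi> \<in> topspace ?Z. r i \<phi> \<in> {x \<in> topspace (nsphere d). wedge_inj nsphere_base i x \<in> U}} = V i"
        using r[OF that] by (auto simp: V_def continuous_map_def)
      finally show ?thesis .
    qed
    moreover have "{\<phi> \<in> topspace ?Z. fan_to_wedge j d \<phi> \<in> U} = topspace ?Z \<inter> (\<Inter>i<j. V i)"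
      if None: "None \<in> U"
    proof -
      have "fan_to_wedge j d \<phi> \<in> U \<longleftrightarrow> (\<forall>i<j. wedge_inj nsphere_base i (r i \<phi>) \<in> U)"
        if \<phi>: "\<phi> \<in> topspace ?Z" for \<phi>
        using \<phi>
      proof (cases rule: fan_to_wedge_cases)
        case base
        then show ?thesis
          using None base_iff[OF \<phi>] base(1)
          by (simp add: wedge_inj_def)
      next
        case (sphere i)
        then have "wedge_inj nsphere_base i (r i \<phi>) = fan_to_wedge j d \<phi>"
          using base_iff[OF \<phi>, of i] by (simp add: wedge_inj_def r_def)
        moreover have "wedge_inj nsphere_base k (r k \<phi>) = None" if "k < j" "k \<noteq> i" for k
          using off[OF \<phi> sphere(2) that] by simp
        ultimately show ?thesis
          using None sphere(1) by metis
      qed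
      then show ?thesis by (auto simp: V_def)
    qed
    moreover have "{\<phi> \<in> topspace ?Z. fan_to_wedge j d \<phi> \<in> U} = (\<Union>i<j. V i)"
      if None: "None \<notin> U"
    proof -
      have "fan_to_wedge j d \<phi> \<in> U \<longleftrightarrow> (\<exists>i<j. wedge_inj nsphere_base i (r i \<phi>) \<in> U)"
        if \<phi>: "\<phi> \<in> topspace ?Z" for \<phi>
        using \<phi>
      proof (cases rule: fan_to_wedge_cases)
        case base
        then show ?thesis
          using None base_iff[OF \<phi>] base(1)
          by (simp add: wedge_inj_def)
      next
        case (sphere i)
        then have "wedge_inj nsphere_base i (r i \<phi>) = fan_to_wedge j d \<phi>"
          using base_iff[OF \<phi>, of i] by (simp add: wedge_inj_def r_def)
        moreover have "wedge_inj nsphere_base k (r k \<phi>) = None" if "k < j" "k \<noteq> i" for k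
          using off[OF \<phi> sphere(2) that] by simp
        ultimately show ?thesis
          using None sphere(1) by metis
      qed
      then show ?thesis by (auto simp: V_def)
    qed
    moreover have "openin ?Z (topspace ?Z \<inter> (\<Inter>i<j. V i))"
    proof (cases "j = 0")
      case False
      then have "openin ?Z (\<Inter>i<j. V i)"
        using openin_V by (intro openin_Inter) auto
      then show ?thesis by (intro openin_Int) auto
    qed simp
    ultimately show ?thesis
      by (cases "None \<in> U") (auto intro: openin_Union)
  qed
  ultimately show ?thesis
    by (auto simp: continuous_map_def)
qed

text \<open>Openness in the wedge is tested on each sphere. The union \<open>D\<close> of the disc
  over that sphere and the disc with centre 0 is compact and maps onto the Hausdorff sphere, so its
  map is a quotient map and openness is tested in \<open>D\<close>.\<close>

lemma quotient_map_fan_to_wedge: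
  "quotient_map (disc_fan j d) (wedge_of_spheres j d) (fan_to_wedge j d)"
  unfolding quotient_map_def
proof (intro conjI allI impI iffI)
  let ?Z = "disc_fan j d" and ?W = "wedge_of_spheres j d" and ?F = "fan_to_wedge j d"
  have cont: "continuous_map ?Z ?W ?F"
    by (rule continuous_map_fan_to_wedge)
  \<comment> \<open>The centre of the contracted disc is a preimage of the base point even for
    \<open>d = 0\<close>, when the discs have no boundary.\<close>
  define c :: "nat + nat \<Rightarrow> real" where "c x = (if x = Inl 0 then 1 else 0)" for x
  have c: "c \<in> topspace ?Z"
    by (simp add: topspace_disc_fan c_def)
  have Fc: "?F c = None"
    by (simp add: fan_to_wedge_def c_def)
  have preimage: "\<exists>\<phi>\<in>topspace ?Z. (\<forall>k. k \<noteq> i \<longrightarrow> \<phi> (Inl (Suc k)) = 0) \<and> disc_to_sphere j d (Suc i) \<phi> = y"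
    if i: "i < j" and y: "y \<in> topspace (nsphere d)" for i y
  proof (cases "y = nsphere_base")
    case True
    then show ?thesis
      using c disc_to_sphere_eq_base[OF c, of "Suc i"] i by (intro bexI[of _ c]) (auto simp: c_def)
  next
    case False
    then obtain \<phi> where \<phi>: "\<phi> \<in> topspace ?Z" "\<phi> (Inl (Suc i)) \<noteq> 0" "disc_to_sphere j d (Suc i) \<phi> = y"
      using disc_to_sphere_onto[of y d "Suc i" j] i y by auto
    then show ?thesis
      using disc_fanD(3)[OF \<phi>(1,2)] by (intro bexI[of _ \<phi>]) auto
  qed
  show "?F ` topspace ?Z = topspace ?W"
  proof
    show "?F ` topspace ?Z \<subseteq> topspace ?W"
      using cont by (auto simp: continuous_map_def)
    have "wedge_inj nsphere_base i y \<in> ?F ` topspace ?Z" if iy: "i < j" "y \<in> topspace (nsphere d)" for i y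
      using preimage[OF iy] fan_to_wedge_eq[OF _ iy(1)] by (metis imageI)
    then show "topspace ?W \<subseteq> ?F ` topspace ?Z"
      using c Fc unfolding topspace_wedge_copies by force
  qed
  fix U assume "U \<subseteq> topspace ?W"
  show "openin ?W U \<Longrightarrow> openin ?Z {x \<in> topspace ?Z. ?F x \<in> U}"
    using cont by (auto simp: continuous_map_def)
  assume U: "openin ?Z {x \<in> topspace ?Z. ?F x \<in> U}"
  have "openin (nsphere d) {y \<in> topspace (nsphere d). wedge_inj nsphere_base i y \<in> U}" if i: "i < j" for i
  proof -
    define D where "D = {\<phi> \<in> topspace ?Z. \<forall>k. k \<noteq> i \<longrightarrow> \<phi> (Inl (Suc k)) = 0}"
    define r where "r = disc_to_sphere j d (Suc i)"
    have r: "continuous_map ?Z (nsphere d) r"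
      unfolding r_def using i by (intro continuous_map_disc_to_sphere) simp
    have "D = topspace ?Z \<inter> {\<phi>. \<forall>k. k \<noteq> i \<longrightarrow> \<phi> (Inl (Suc k)) = 0}"
      by (auto simp: D_def)
    also have "compact \<dots>"
      by (intro compact_Int_closed compact_disc_fan closed_Collect_all closed_Collect_imp
          open_Collect_const closed_Collect_eq continuous_intros continuous_on_product_coordinates)
    finally have "compactin ?Z D"
      by (subst disc_fan_eq) (auto simp: compactin_subtopology D_def)
    then have "compact_space (subtopology ?Z D)"
      by (rule compact_space_subtopology)
    have top_D: "topspace (subtopology ?Z D) = D"
      by (auto simp: D_def)
    have "quotient_map (subtopology ?Z D) (nsphere d) r"
    proof (rule continuous_imp_quotient_map)
      show "Hausdorff_space (nsphere d)"
        unfolding nsphere by (intro Hausdorff_space_subtopology) (simp add: Hausdorff_space_product_topology)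
      show "r ` topspace (subtopology ?Z D) = topspace (nsphere d)"
        unfolding top_D
      proof
        show "r ` D \<subseteq> topspace (nsphere d)"
          using r by (auto simp: D_def continuous_map_def)
        show "topspace (nsphere d) \<subseteq> r ` D"
          using preimage[OF i] by (fastforce simp: D_def r_def image_iff)
      qed
    qed (use r \<open>compact_space _\<close> in \<open>simp_all add: continuous_map_from_subtopology\<close>)
    moreover have "openin (subtopology ?Z D) {\<phi> \<in> D. r \<phi> \<in> {y \<in> topspace (nsphere d). wedge_inj nsphere_base i y \<in> U}}"
    proof -
      have "{\<phi> \<in> D. r \<phi> \<in> {y \<in> topspace (nsphere d). wedge_inj nsphere_base i y \<in> U}}
          = {x \<in> topspace ?Z. ?F x \<in> U} \<inter> D"
        using fan_to_wedge_eq[OF _ i] r by (auto simp: D_def r_def continuous_map_def)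
      then show ?thesis
        using U by (simp add: openin_subtopology_Int)
    qed
    moreover have "{y \<in> topspace (nsphere d). wedge_inj nsphere_base i y \<in> U} \<subseteq> topspace (nsphere d)"
      by auto
    ultimately show ?thesis
      using top_D by (simp only: quotient_map_def)
  qed
  then show "openin ?W U"
    using \<open>U \<subseteq> topspace ?W\<close> unfolding topspace_wedge_copies openin_wedge_copies by blast
qed

text \<open>The homotopy shrinks the disc with centre \<open>0\<close> to its centre while pushing a collar of every
  other disc into it. The total weight of the cross polytope vertices, which is \<open>x = 1 - s\<close> on a disc
  with weight \<open>s\<close> at its centre, first grows to \<open>(1 + t) * x\<close>; where this exceeds 1 the point has
  entered the disc with centre \<open>0\<close>, and the weight there is \<open>2 - (1 + t) * x\<close>.\<close>

definition fan_scale :: "real \<Rightarrow> real \<Rightarrow> real" where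
  "fan_scale t x = min (1 + t) (2 / max x (1/2) - (1 + t))"

definition fan_homotopy :: "nat \<Rightarrow> nat \<Rightarrow> real \<times> (nat + nat \<Rightarrow> real) \<Rightarrow> nat + nat \<Rightarrow> real" where
  "fan_homotopy j d = (\<lambda>(t, \<phi>).
     let scale = fan_scale t (1 - (\<Sum>v<j. \<phi> (Inl (Suc v))));
         height = (\<lambda>v. max 0 (\<phi> (Inl v) - t * (1 - \<phi> (Inl v))))
     in case_sum
          (\<lambda>v. if v = 0 then 1 - (\<Sum>x<2 * d. scale * \<phi> (Inr x)) - (\<Sum>v<j. height (Suc v)) else height v)
          (\<lambda>x. scale * \<phi> (Inr x)))"

text \<open>Without weight on the other centres the scale is evaluated at 1, where it equals
  \<open>1 - t\<close>; the disc with centre 0 is thus contracted linearly.\<close>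

lemma fan_homotopy_base:
  assumes \<phi>: "\<phi> \<in> topspace (disc_fan j d)" and t: "0 \<le> t" "t \<le> 1"
    and 0: "\<And>k. \<phi> (Inl (Suc k)) = 0"
  shows "fan_homotopy j d (t, \<phi>) =
    case_sum (\<lambda>v. if v = 0 then 1 - (1 - t) * (\<Sum>x<2 * d. \<phi> (Inr x)) else 0) (\<lambda>x. (1 - t) * \<phi> (Inr x))"
proof -
  have "fan_scale t (1 - (\<Sum>v<j. \<phi> (Inl (Suc v)))) = 1 - t"
    using t by (simp add: 0 fan_scale_def)
  then show ?thesis
    using t 0 by (auto simp: fan_homotopy_def Let_def fun_eq_iff sum_distrib_left gr0_conv_Suc split: sum.split)
qed

lemma fan_homotopy_disc:
  assumes \<phi>: "\<phi> \<in> topspace (disc_fan j d)" and t: "0 \<le> t" "t \<le> 1"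
    and i: "i < j" "\<phi> (Inl (Suc i)) \<noteq> 0"
  defines "x \<equiv> 1 - \<phi> (Inl (Suc i))"
  shows "fan_homotopy j d (t, \<phi>) =
    case_sum (\<lambda>v. if v = 0 then max 0 ((1 + t) * x - 1) else if v = Suc i then max 0 (1 - (1 + t) * x) else 0)
      (\<lambda>k. fan_scale t x * \<phi> (Inr k))"
    and "0 \<le> fan_scale t x"
proof -
  have off: "\<phi> (Inl v) = 0" if "v \<noteq> Suc i" for v
    using disc_fanD(3)[OF \<phi> i(2)] that by metis
  have sum: "(\<Sum>v<j. \<phi> (Inl (Suc v))) = \<phi> (Inl (Suc i))"
    using i(1) by (subst sum.remove[of _ i]) (auto simp: off intro!: sum.neutral)
  have "(\<Sum>v\<le>j. \<phi> (Inl v)) = \<phi> (Inl (Suc i))"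
    using i(1) by (subst sum.remove[of _ "Suc i"]) (auto simp: off intro!: sum.neutral)
  then have weight: "(\<Sum>k<2 * d. \<phi> (Inr k)) = x"
    using disc_fanD(6)[OF \<phi>] by (simp add: x_def)
  have x: "0 \<le> x" "x < 1"
  proof -
    show "0 \<le> x"
      unfolding weight[symmetric] by (intro sum_nonneg disc_fanD(1)[OF \<phi>])
    show "x < 1"
      using i(2) disc_fanD(1)[OF \<phi>, of "Inl (Suc i)"] by (simp add: x_def)
  qed
  have height: "max 0 (\<phi> (Inl (Suc v)) - t * (1 - \<phi> (Inl (Suc v)))) = (if v = i then max 0 (1 - (1 + t) * x) else 0)" for v
    using t by (auto simp: off x_def algebra_simps)
  have heights: "(\<Sum>v<j. max 0 (\<phi> (Inl (Suc v)) - t * (1 - \<phi> (Inl (Suc v))))) = max 0 (1 - (1 + t) * x)"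
    unfolding height using i(1) by simp
  \<comment> \<open>The cut-off at 1/2 only protects the division: for \<open>x \<le> 1/2\<close>
    the second argument of the minimum is \<open>4 - (1 + t)\<close>, so the minimum is
    \<open>1 + t\<close>. Beyond 1/2 the two arguments cross where
    \<open>(1 + t) * x = 1\<close>.\<close>
  have scale: "fan_scale t x * x = (if (1 + t) * x \<le> 1 then (1 + t) * x else 2 - (1 + t) * x)"
    "0 \<le> fan_scale t x"
  proof -
    have "fan_scale t x = 1 + t" if "(1 + t) * x \<le> 1"
    proof -
      have "(1 + t) * max x (1/2) \<le> 1"
        using that t by (auto simp: max_def)
      then have "2 * ((1 + t) * max x (1/2)) \<le> 2"
        by linarith
      then have "2 * (1 + t) * max x (1/2) \<le> 2"
        by (simp only: mult.assoc)
      moreover have "0 < max x (1/2)"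
        by (simp add: less_max_iff_disj)
      ultimately have "2 * (1 + t) \<le> 2 / max x (1/2)"
        by (simp only: pos_le_divide_eq)
      then show ?thesis by (simp add: fan_scale_def)
    qed
    moreover have "fan_scale t x = 2 / x - (1 + t)" "0 \<le> 2 / x - (1 + t)" "x \<noteq> 0" if "\<not> (1 + t) * x \<le> 1"
    proof -
      have "(1 + t) * x \<le> 2 * x"
        using t x by (intro mult_right_mono) auto
      then have "1/2 < x"
        using that by linarith
      moreover have "2 < 2 * ((1 + t) * x)"
        using that by linarith
      then have "2 / x < 2 * (1 + t)"
        using \<open>1/2 < x\<close> by (simp only: pos_divide_less_eq mult.assoc)
      moreover have "2 \<le> 2 / x"
        using x \<open>1/2 < x\<close> by (simp add: pos_le_divide_eq)
      ultimately show "fan_scale t x = 2 / x - (1 + t)" "0 \<le> 2 / x - (1 + t)" "x \<noteq> 0"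
        using t by (simp_all add: fan_scale_def)
    qed
    ultimately show "fan_scale t x * x = (if (1 + t) * x \<le> 1 then (1 + t) * x else 2 - (1 + t) * x)"
      "0 \<le> fan_scale t x"
      using t by (cases "(1 + t) * x \<le> 1"; simp add: left_diff_distrib)+
  qed
  then show "0 \<le> fan_scale t x" by simp
  have "(\<Sum>k<2 * d. fan_scale t x * \<phi> (Inr k)) = fan_scale t x * x"
    by (simp add: weight flip: sum_distrib_left)
  then have top: "1 - (\<Sum>k<2 * d. fan_scale t x * \<phi> (Inr k)) - max 0 (1 - (1 + t) * x) = max 0 ((1 + t) * x - 1)"
    using scale(1) by (auto simp: max_def)
  show "fan_homotopy j d (t, \<phi>) =
    case_sum (\<lambda>v. if v = 0 then max 0 ((1 + t) * x - 1) else if v = Suc i then max 0 (1 - (1 + t) * x) else 0)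
      (\<lambda>k. fan_scale t x * \<phi> (Inr k))"
  proof
    fix y :: "nat + nat"
    show "fan_homotopy j d (t, \<phi>) y =
      case_sum (\<lambda>v. if v = 0 then max 0 ((1 + t) * x - 1) else if v = Suc i then max 0 (1 - (1 + t) * x) else 0)
      (\<lambda>k. fan_scale t x * \<phi> (Inr k)) y"
    proof (cases y)
      case (Inl v)
      then show ?thesis
        using top height[of "v - 1"] by (cases v) (simp_all add: fan_homotopy_def Let_def sum heights flip: x_def)
    qed (simp add: fan_homotopy_def Let_def sum x_def)
  qed
qed

text \<open>The total weight is 1 by construction, since the centre 0 receives the remainder. What
  has to be checked is that this remainder is nonnegative and that no two centres carry weight at
  once.\<close>

lemma fan_homotopy_in_disc_fan:
  assumes \<phi>: "\<phi> \<in> topspace (disc_fan j d)" and t: "0 \<le> t" "t \<le> 1"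
  shows "fan_homotopy j d (t, \<phi>) \<in> topspace (disc_fan j d)"
proof -
  note nn = disc_fanD(1)[OF \<phi>]
  have total: "(\<Sum>v\<le>j. fan_homotopy j d (t, \<phi>) (Inl v)) + (\<Sum>x<2 * d. fan_homotopy j d (t, \<phi>) (Inr x)) = 1"
    unfolding lessThan_Suc_atMost[symmetric] sum.lessThan_Suc_shift by (simp add: fan_homotopy_def Let_def)
  from \<phi> show ?thesis
  proof (cases rule: fan_to_wedge_cases)
    case base
    note eq = fan_homotopy_base[OF \<phi> t base(1)]
    have "(\<Sum>x<2 * d. \<phi> (Inr x)) \<le> 1"
      using disc_fanD(6)[OF \<phi>] nn by (smt (verit) sum_nonneg)
    then have "(1 - t) * (\<Sum>x<2 * d. \<phi> (Inr x)) \<le> 1"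
      using t nn by (intro mult_le_one) (auto intro: sum_nonneg)
    then show ?thesis
      unfolding topspace_disc_fan
      using total disc_fanD(4,5)[OF \<phi>] t nn by (auto simp: eq split: sum.split)
  next
    case (sphere i)
    note eq = fan_homotopy_disc[OF \<phi> t sphere(1,2)]
    show ?thesis
      unfolding topspace_disc_fan
      using total disc_fanD(4,5)[OF \<phi>] t nn sphere(1) eq(2) by (auto simp: eq(1) max_def split: sum.split)
  qed
qed

lemma fan_homotopy_0:
  assumes \<phi>: "\<phi> \<in> topspace (disc_fan j d)"
  shows "fan_homotopy j d (0, \<phi>) = \<phi>"
  using \<phi>
proof (cases rule: fan_to_wedge_cases)
  case base
  have "(\<Sum>v\<le>j. \<phi> (Inl v)) = \<phi> (Inl 0)"
    unfolding lessThan_Suc_atMost[symmetric] sum.lessThan_Suc_shift by (simp add: base(1))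
  then have "\<phi> (Inl 0) = 1 - (\<Sum>x<2 * d. \<phi> (Inr x))"
    using disc_fanD(6)[OF \<phi>] by simp
  then show ?thesis
    unfolding fan_homotopy_base[OF \<phi> order_refl zero_le_one base(1)]
    by (auto simp: fun_eq_iff base(1) gr0_conv_Suc split: sum.split)
next
  case (sphere i)
  have nn: "0 \<le> \<phi> (Inl (Suc i))"
    by (rule disc_fanD(1)[OF \<phi>])
  have "fan_scale 0 (1 - \<phi> (Inl (Suc i))) = 1"
    using nn by (simp add: fan_scale_def pos_le_divide_eq)
  moreover have "\<phi> (Inl v) = 0" if "v \<noteq> Suc i" for v
    using disc_fanD(3)[OF \<phi> sphere(2)] that by metis
  ultimately show ?thesis
    unfolding fan_homotopy_disc(1)[OF \<phi> order_refl zero_le_one sphere(1,2)]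
    using nn by (auto simp: fun_eq_iff split: sum.split)
qed

lemma continuous_map_fan_homotopy:
  "continuous_map (prod_topology (top_of_set {0..1}) (disc_fan j d)) (disc_fan j d) (fan_homotopy j d)"
proof -
  let ?P = "prod_topology (top_of_set {0..1::real}) (disc_fan j d)"
  have t: "continuous_map ?P euclideanreal fst"
    by (metis continuous_map_fst continuous_map_into_fulltopology)
  have \<phi>: "continuous_map ?P euclideanreal (\<lambda>p. snd p x)" for x
    using continuous_map_compose[OF continuous_map_snd continuous_map_disc_fan_coordinate] by (simp add: o_def)
  have scale: "continuous_map ?P euclideanreal (\<lambda>p. fan_scale (fst p) (1 - (\<Sum>v<j. snd p (Inl (Suc v)))))"
    unfolding fan_scale_def by (intro continuous_intros t \<phi>) auto
  have "continuous_map ?P euclideanreal (\<lambda>p. fan_homotopy j d p y)" for y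
  proof (cases y)
    case (Inl v)
    then show ?thesis
      unfolding fan_homotopy_def case_prod_beta Let_def
      by (cases "v = 0") (auto intro!: continuous_intros t \<phi> scale)
  next
    case (Inr x)
    then show ?thesis
      unfolding fan_homotopy_def case_prod_beta Let_def by (auto intro!: continuous_intros \<phi> scale)
  qed
  then show ?thesis
    using fan_homotopy_in_disc_fan
    unfolding disc_fan_def continuous_map_geometric_realization by auto
qed

text \<open>Only the fibre over the base point has more than one element, and it is the disc with
  centre 0.\<close>

lemma fan_to_wedge_eq_cases:
  assumes \<phi>: "\<phi> \<in> topspace (disc_fan j d)" and \<psi>: "\<psi> \<in> topspace (disc_fan j d)"
    and eq: "fan_to_wedge j d \<phi> = fan_to_wedge j d \<psi>"
  obtains "\<phi> = \<psi>" | "\<And>k. \<phi> (Inl (Suc k)) = 0" "\<And>k. \<psi> (Inl (Suc k)) = 0"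
  using \<phi>
proof (cases rule: fan_to_wedge_cases)
  case base
  from \<psi> show ?thesis
    by (cases rule: fan_to_wedge_cases) (use base eq that in auto)
next
  case (sphere i)
  from \<psi> show ?thesis
  proof (cases rule: fan_to_wedge_cases)
    case base
    then show ?thesis using sphere eq by simp
  next
    case (sphere i')
    then have "i' = i" "disc_to_sphere j d (Suc i) \<phi> = disc_to_sphere j d (Suc i) \<psi>"
      using \<open>fan_to_wedge j d \<phi> = Some _\<close> eq by auto
    then have "\<phi> = \<psi>"
      using disc_to_sphere_inject[OF \<phi> \<psi>, of "Suc i"] \<open>i < j\<close> \<open>\<phi> (Inl (Suc i)) \<noteq> 0\<close> by simp
    then show ?thesis by (rule that(1))
  qed
qed

lemma disc_fan_homotopy_equivalent_wedge:
  "disc_fan j d homotopy_equivalent_space wedge_of_spheres j d"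
proof (rule quotient_homotopy_equivalent[OF quotient_map_fan_to_wedge continuous_map_fan_homotopy])
  fix \<phi> \<psi> assume \<phi>: "\<phi> \<in> topspace (disc_fan j d)" and \<psi>: "\<psi> \<in> topspace (disc_fan j d)"
    and eq: "fan_to_wedge j d \<phi> = fan_to_wedge j d \<psi>"
  from \<phi> \<psi> eq show "fan_homotopy j d (1, \<phi>) = fan_homotopy j d (1, \<psi>)"
  proof (cases rule: fan_to_wedge_eq_cases)
    case 2
    then show ?thesis
      by (auto simp: fan_homotopy_base[OF \<phi>] fan_homotopy_base[OF \<psi>] fun_eq_iff split: sum.split)
  qed simp
  fix t :: real assume t: "t \<in> {0..1}"
  from \<phi> \<psi> eq show "fan_to_wedge j d (fan_homotopy j d (t, \<phi>)) = fan_to_wedge j d (fan_homotopy j d (t, \<psi>))"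
  proof (cases rule: fan_to_wedge_eq_cases)
    case 2
    then have "fan_homotopy j d (t, \<phi>) (Inl (Suc k)) = 0" "fan_homotopy j d (t, \<psi>) (Inl (Suc k)) = 0" for k
      using t by (simp_all add: fan_homotopy_base[OF \<phi>] fan_homotopy_base[OF \<psi>])
    then show ?thesis
      by (simp add: fan_to_wedge_def)
  qed simp
qed (rule fan_homotopy_0)

lemma wedge_copies_1_homeomorphic:
  assumes "x0 \<in> topspace X"
  shows "wedge_copies 1 X x0 homeomorphic_space X"
proof -
  have inj: "inj_on (wedge_inj x0 0) (topspace X)"
    by (auto simp: inj_on_def wedge_inj_def split: if_splits)
  have "homeomorphic_map X (wedge_copies 1 X x0) (wedge_inj x0 0)"
  proof (rule bijective_open_imp_homeomorphic_map)
    show "continuous_map X (wedge_copies 1 X x0) (wedge_inj x0 0)"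
      by (auto simp: continuous_map_def topspace_wedge_copies openin_wedge_copies)
    show "open_map X (wedge_copies 1 X x0) (wedge_inj x0 0)"
      unfolding open_map_def
    proof (intro allI impI)
      fix U assume U: "openin X U"
      then have "{x \<in> topspace X. wedge_inj x0 0 x \<in> wedge_inj x0 0 ` U} = U"
        using inj openin_subset[OF U] by (auto simp: inj_on_def)
      with U show "openin (wedge_copies 1 X x0) (wedge_inj x0 0 ` U)"
        using openin_subset[OF U] by (auto simp: openin_wedge_copies)
    qed
    show "wedge_inj x0 0 ` topspace X = topspace (wedge_copies 1 X x0)"
      using assms by (auto simp: topspace_wedge_copies wedge_inj_def image_iff)
  qed (rule inj)
  then show ?thesis
    using homeomorphic_space homeomorphic_space_sym by blast
qed

section \<open>Complexes of the homotopy type of a wedge of spheres\<close>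

text \<open>The quantification over \<open>e\<close> makes the property stable under further suspensions.\<close>

definition sphere_type :: "nat \<Rightarrow> nat \<Rightarrow> 'a set set \<Rightarrow> bool" where
  "sphere_type j d K \<longleftrightarrow> (\<forall>e. geometric_realization (simplicial_join K (cross_polytope e))
     homotopy_equivalent_space disc_fan j (e + d))"

section \<open>Stability of the type under relabelling, collapses and unions\<close>

lemma vimage_map_sum:
  "Inl -` map_sum h g ` T = h ` (Inl -` T)" "Inr -` map_sum h g ` T = g ` (Inr -` T)"
proof -
  have "Inl x \<in> map_sum h g ` T \<longleftrightarrow> x \<in> h ` (Inl -` T)" for x
  proof
    assume "Inl x \<in> map_sum h g ` T"
    then obtain y where "y \<in> T" "Inl x = map_sum h g y" by blast
    then show "x \<in> h ` (Inl -` T)"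
      by (cases y) auto
  next
    assume "x \<in> h ` (Inl -` T)"
    then show "Inl x \<in> map_sum h g ` T"
      by (metis imageE image_eqI map_sum.simps(1) vimageE)
  qed
  then show "Inl -` map_sum h g ` T = h ` (Inl -` T)" by blast
  have "Inr x \<in> map_sum h g ` T \<longleftrightarrow> x \<in> g ` (Inr -` T)" for x
  proof
    assume "Inr x \<in> map_sum h g ` T"
    then obtain y where "y \<in> T" "Inr x = map_sum h g y" by blast
    then show "x \<in> g ` (Inr -` T)"
      by (cases y) auto
  next
    assume "x \<in> g ` (Inr -` T)"
    then show "Inr x \<in> map_sum h g ` T"
      by (metis imageE image_eqI map_sum.simps(2) vimageE)
  qed
  then show "Inr -` map_sum h g ` T = g ` (Inr -` T)" by blast
qed

lemma simplicial_join_image: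
  "simplicial_join ((`) h ` K) M = (`) (map_sum h id) ` simplicial_join K M"
proof (intro subset_antisym subsetI)
  fix U assume "U \<in> simplicial_join ((`) h ` K) M"
  then obtain S where S: "S \<in> K" "Inl -` U = h ` S" and M: "Inr -` U \<in> M"
    by (auto simp: simplicial_join_def)
  have "U = map_sum h id ` (Inl ` S \<union> Inr ` (Inr -` U))"
    by (subst sum_set_eq[of U]) (simp add: S(2) image_Un image_image)
  moreover have "Inl ` S \<union> Inr ` (Inr -` U) \<in> simplicial_join K M"
    using S(1) M by (simp add: simplicial_join_def vimage_Un) 
  ultimately show "U \<in> (`) (map_sum h id) ` simplicial_join K M" by blast
next
  fix U assume "U \<in> (`) (map_sum h id) ` simplicial_join K M"
  then obtain T where T: "T \<in> simplicial_join K M" "U = map_sum h id ` T" by blast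
  have "Inl -` U = h ` (Inl -` T)" "Inr -` U = Inr -` T"
    unfolding T(2) vimage_map_sum by simp_all
  then show "U \<in> simplicial_join ((`) h ` K) M"
    using T(1) by (simp add: simplicial_join_def)
qed

lemma sphere_type_image:
  assumes "simplicial K" "K \<subseteq> Pow V" "inj_on h V" "sphere_type j d K"
  shows "sphere_type j d ((`) h ` K)"
  unfolding sphere_type_def
proof
  fix e
  let ?J = "simplicial_join K (cross_polytope e)"
  have "?J \<subseteq> Pow (Inl ` V \<union> range Inr)"
  proof
    fix U assume "U \<in> ?J"
    then have "Inl -` U \<subseteq> V"
      using assms(2) by (auto simp: simplicial_join_def)
    then show "U \<in> Pow (Inl ` V \<union> range Inr)"
      using sum_set_eq[of U] by blast
  qed
  moreover have "inj_on (map_sum h (id :: nat \<Rightarrow> nat)) (Inl ` V \<union> range Inr)"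
  proof (rule inj_onI)
    fix x y :: "'a + nat"
    assume "x \<in> Inl ` V \<union> range Inr" "y \<in> Inl ` V \<union> range Inr" "map_sum h id x = map_sum h id y"
    then show "x = y"
      by (cases x; cases y) (auto dest: inj_onD[OF assms(3)])
  qed
  ultimately have "geometric_realization (simplicial_join ((`) h ` K) (cross_polytope e))
      homeomorphic_space geometric_realization ?J"
    unfolding simplicial_join_image using assms(1)
    by (intro realization_image_homeomorphic simplicial_simplicial_join simplicial_cross_polytope)
  then show "geometric_realization (simplicial_join ((`) h ` K) (cross_polytope e))
      homotopy_equivalent_space disc_fan j (e + d)"
    using assms(4) unfolding sphere_type_def
    by (meson homeomorphic_imp_homotopy_equivalent_space homotopy_eqv_trans)
qed

lemma sphere_type_collapses:
  assumes "collapses K L" "simplicial K" "sphere_type j d L"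
  shows "sphere_type j d K"
  using assms unfolding sphere_type_def
  by (meson collapses_homotopy_equivalent collapses_join homotopy_eqv_trans simplicial_cross_polytope
      simplicial_simplicial_join)

text \<open>The \<open>e\<close>-fold suspension of the union is compared with the
  \<open>(e + 1)\<close>-fold suspension of the intersection, whose type is part of the
  hypothesis.\<close>

lemma sphere_type_union:
  assumes "simplicial A" "collapsible A" "finite A" "simplicial B" "collapsible B" "finite B"
    and "{} \<in> A \<inter> B" "sphere_type j d (A \<inter> B)"
  shows "sphere_type j (Suc d) (A \<union> B)"
  unfolding sphere_type_def
proof
  fix e
  have "geometric_realization (simplicial_join (A \<inter> B) (cross_polytope (Suc e)))
      homotopy_equivalent_space disc_fan j (Suc e + d)"
    using assms(8) unfolding sphere_type_def by blast
  then show "geometric_realization (simplicial_join (A \<union> B) (cross_polytope e))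
      homotopy_equivalent_space disc_fan j (e + Suc d)"
    using union_homotopy_equivalent_suspension[OF assms(1-7), of e]
    by (metis add_Suc_shift homotopy_eqv_trans)
qed

lemma sphere_type_discrete:
  assumes "finite V" "card V = Suc j"
  shows "sphere_type j 0 (discrete_complex V)"
proof -
  obtain h where h: "bij_betw h {..j} V"
    using assms by (metis card_atMost finite_atMost finite_same_card_bij)
  have "sphere_type j 0 (discrete_complex {..j})"
    by (simp add: sphere_type_def disc_fan_def homotopy_equivalent_space_refl)
  then have "sphere_type j 0 ((`) h ` discrete_complex {..j})"
    using h by (intro sphere_type_image[where V = "{..j}"] simplicial_discrete_complex)
      (auto simp: discrete_complex_def bij_betw_def)
  also have "(`) h ` discrete_complex {..j} = discrete_complex V"
    using h by (auto simp: discrete_complex_def bij_betw_def image_image)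
  finally show ?thesis .
qed

text \<open>This is the instance \<open>e = 0\<close>, in which the join is a relabelled copy of
  \<open>K\<close>.\<close>

lemma sphere_type_imp_wedge:
  assumes "sphere_type j d K" "simplicial K"
  shows "geometric_realization K homotopy_equivalent_space wedge_of_spheres j d"
proof -
  have "simplicial_join K (cross_polytope 0) = (`) Inl ` K"
  proof (intro subset_antisym subsetI)
    fix U assume U: "U \<in> simplicial_join K (cross_polytope 0)"
    then have "Inr -` U = {}" "Inl -` U \<in> K"
      by (auto simp: simplicial_join_def cross_polytope_def)
    moreover have "U = Inl ` (Inl -` U)"
      using sum_set_eq[of U] \<open>Inr -` U = {}\<close> by (metis image_empty sup_bot.right_neutral)
    ultimately show "U \<in> (`) Inl ` K"
      by blast
  qed (auto simp: simplicial_join_def cross_polytope_def)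
  then have "geometric_realization (simplicial_join K (cross_polytope 0)) homeomorphic_space geometric_realization K"
    using realization_image_homeomorphic[OF assms(2), of UNIV Inl] by (simp add: inj_Inl)
  moreover have "geometric_realization (simplicial_join K (cross_polytope 0)) homotopy_equivalent_space disc_fan j d"
    using assms(1) unfolding sphere_type_def by (metis add_0)
  ultimately show ?thesis
    using disc_fan_homotopy_equivalent_wedge
    by (meson homeomorphic_imp_homotopy_equivalent_space homotopy_eqv_trans homotopy_equivalent_space_sym)
qed

lemma sphere_type_imp_nsphere:
  assumes "sphere_type 1 d K" "simplicial K"
  shows "geometric_realization K homotopy_equivalent_space nsphere d"
  using sphere_type_imp_wedge[OF assms] wedge_copies_1_homeomorphic[OF nsphere_base_in_nsphere]
  by (meson homeomorphic_imp_homotopy_equivalent_space homotopy_eqv_trans)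

lemma simplicialI:
  assumes "finite V" "\<And>S. S \<in> K \<Longrightarrow> S \<subseteq> V" "\<And>S T. S \<in> K \<Longrightarrow> T \<subseteq> S \<Longrightarrow> T \<in> K"
  shows "simplicial K"
  unfolding simplicial_def using assms by (meson PowD finite_subset subsetI)

text \<open>A wedge of no spheres is a point whatever their dimension. The dimension is raised by
  writing the simplex as the union of two copies of itself.\<close>

lemma sphere_type_simplex:
  assumes "0 < (m :: nat)"
  shows "sphere_type 0 d (Pow {..<m})"
proof (induction d)
  case 0
  have "collapses (Pow {..<m}) {U \<in> Pow {..<m}. U \<inter> {1..<m} \<notin> Pow {1..<m} - {{}}}"
    using assms by (intro collapses_discard) (auto intro: finite_subset intro!: exI[of _ 0])
  also have "{U \<in> Pow {..<m}. U \<inter> {1..<m} \<notin> Pow {1..<m} - {{}}} = discrete_complex {0}"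
  proof -
    have "U \<subseteq> {..<m} \<and> U \<inter> {1..<m} = {} \<longleftrightarrow> U \<subseteq> {0}" for U
      using assms by (auto simp: subset_iff)
    then show ?thesis
      by (auto simp: discrete_complex_def subset_singleton_iff)
  qed
  finally show ?case
    by (rule sphere_type_collapses) (auto intro: simplicialI sphere_type_discrete)
next
  case (Suc d)
  have "collapsible (Pow {..<m})"
    using assms by (intro collapsible_cone[of _ 0]) auto
  then show ?case
    using sphere_type_union[of "Pow {..<m}" "Pow {..<m}" 0 d] Suc
    by (auto intro: simplicialI)
qed

section \<open>Arc complexes\<close>

text \<open>The avoided \<open>g\<close> consecutive vertices of the cycle are \<open>{u..<u + g}\<close> in the first alternative and
  \<open>{n - (g - b)..<n} \<union> {..<b}\<close> in the second one.\<close>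

definition arc_complex :: "nat \<Rightarrow> nat \<Rightarrow> nat set set" where
  "arc_complex n g = {S. S \<subseteq> {..<n} \<and>
     ((\<exists>u. u + g \<le> n \<and> (\<forall>x\<in>S. x < u \<or> u + g \<le> x)) \<or> (\<exists>b\<le>g. \<forall>x\<in>S. b \<le> x \<and> x + g < n + b))}"

text \<open>The avoided arc can be chosen to miss 0: this is the star of the vertex 0.\<close>

definition arc_complex_star :: "nat \<Rightarrow> nat \<Rightarrow> nat set set" where
  "arc_complex_star n g = {S. S \<subseteq> {..<n} \<and> (\<exists>u\<ge>1. u + g \<le> n \<and> (\<forall>x\<in>S. x < u \<or> u + g \<le> x))}"

text \<open>The avoided arc can be chosen to contain 0.\<close>

definition arc_complex_rest :: "nat \<Rightarrow> nat \<Rightarrow> nat set set" where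
  "arc_complex_rest n g = {S. S \<subseteq> {..<n} \<and> (\<exists>b\<ge>1. b \<le> g \<and> (\<forall>x\<in>S. b \<le> x \<and> x + g < n + b))}"

text \<open>The two descriptions of arcs overlap: \<open>u = 0\<close> is the arc with
  \<open>b = g\<close>, and \<open>b = 0\<close> is the arc with \<open>u = n - g\<close>. Trading
  these makes both lower bounds 1.\<close>

lemma arc_complex_decomposition:
  assumes "1 \<le> g" "g < n"
  shows "arc_complex n g = arc_complex_star n g \<union> arc_complex_rest n g"
proof (intro subset_antisym subsetI)
  fix S assume S: "S \<in> arc_complex n g"
  then have sub: "S \<subseteq> {..<n}" by (simp add: arc_complex_def)
  consider u where "u + g \<le> n" "\<forall>x\<in>S. x < u \<or> u + g \<le> x"
    | b where "b \<le> g" "\<forall>x\<in>S. b \<le> x \<and> x + g < n + b"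
    using S by (auto simp: arc_complex_def)
  then show "S \<in> arc_complex_star n g \<union> arc_complex_rest n g"
  proof cases
    case 1
    show ?thesis
    proof (cases "u = 0")
      case True
      then have "\<forall>x\<in>S. g \<le> x \<and> x + g < n + g"
        using 1 sub by auto
      then show ?thesis
        using assms sub by (auto simp: arc_complex_rest_def)
    qed (use 1 sub in \<open>auto simp: arc_complex_star_def intro!: exI[of _ u]\<close>)
  next
    case 2
    show ?thesis
    proof (cases "b = 0")
      case True
      then have "\<forall>x\<in>S. x < n - g"
        using 2 by auto
      then show ?thesis
        using assms sub by (auto simp: arc_complex_star_def intro!: exI[of _ "n - g"])
    qed (use 2 sub in \<open>auto simp: arc_complex_rest_def intro!: exI[of _ b]\<close>)
  qed
qed (auto simp: arc_complex_def arc_complex_star_def arc_complex_rest_def)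

section \<open>Collapsibility of the two pieces of an arc complex\<close>

lemma simplicial_arc_complex_star: "simplicial (arc_complex_star n g)"
proof (rule simplicialI[of "{..<n}"])
  fix S T assume "S \<in> arc_complex_star n g" "T \<subseteq> S"
  then show "T \<in> arc_complex_star n g"
    unfolding arc_complex_star_def by blast
qed (auto simp: arc_complex_star_def)

lemma simplicial_arc_complex_rest: "simplicial (arc_complex_rest n g)"
proof (rule simplicialI[of "{..<n}"])
  fix S T assume "S \<in> arc_complex_rest n g" "T \<subseteq> S"
  then show "T \<in> arc_complex_rest n g"
    unfolding arc_complex_rest_def by blast
qed (auto simp: arc_complex_rest_def)

lemma simplicial_arc_complex: "simplicial (arc_complex n g)"
proof (rule simplicialI[of "{..<n}"])
  fix S T assume "S \<in> arc_complex n g" "T \<subseteq> S"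
  then show "T \<in> arc_complex n g"
    unfolding arc_complex_def by blast
qed (auto simp: arc_complex_def)

lemma finite_arc_complex_pieces: "finite (arc_complex_star n g)" "finite (arc_complex_rest n g)"
proof -
  have "arc_complex_star n g \<subseteq> Pow {..<n}" "arc_complex_rest n g \<subseteq> Pow {..<n}"
    by (auto simp: arc_complex_star_def arc_complex_rest_def)
  then show "finite (arc_complex_star n g)" "finite (arc_complex_rest n g)"
    by (meson finite_Pow_iff finite_lessThan finite_subset)+
qed

lemma collapsible_arc_complex_star:
  assumes "g < n"
  shows "collapsible (arc_complex_star n g)"
proof (rule collapsible_cone[of _ 0])
  fix S assume "S \<in> arc_complex_star n g"
  then obtain u where "S \<subseteq> {..<n}" "1 \<le> u" "u + g \<le> n" "\<forall>x\<in>S. x < u \<or> u + g \<le> x"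
    by (auto simp: arc_complex_star_def)
  then show "insert 0 S \<in> arc_complex_star n g"
    using assms by (auto simp: arc_complex_star_def intro!: exI[of _ u])
qed

text \<open>The vertices 1, 2, ... are removed in increasing order. When \<open>v\<close> is the
  least vertex left, every simplex containing it can be enlarged by \<open>v + 1\<close>; at last
  only the vertex \<open>n - 1\<close> remains.\<close>

lemma collapsible_arc_complex_rest:
  assumes g: "1 \<le> g" and n: "g + 2 \<le> n"
  shows "collapsible (arc_complex_rest n g)"
proof -
  define B where "B v = {S \<in> arc_complex_rest n g. S \<subseteq> {v..}}" for v
  have insert: "insert w S \<in> arc_complex_rest n g"
    if S: "S \<in> arc_complex_rest n g" "S \<subseteq> {v..}" "v \<in> S \<or> Suc v = n"
      and v: "1 \<le> v" and w: "w < n" "w = v \<or> w = Suc v" for S v w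
  proof -
    obtain b where b: "1 \<le> b" "b \<le> g" "\<forall>x\<in>S. b \<le> x \<and> x + g < n + b" and "S \<subseteq> {..<n}"
      using S(1) by (auto simp: arc_complex_rest_def)
    have "b \<le> v" using S(3) b n by auto
    \<comment> \<open>The avoided arc through 0 is rotated forward until its last vertex is
      \<open>v - 1\<close>, but not beyond \<open>g - 1\<close>, so that it still contains
      0.\<close>
    then have "\<forall>x\<in>insert w S. min v g \<le> x \<and> x + g < n + min v g"
      using b w n S(2) v \<open>S \<subseteq> {..<n}\<close> by (auto simp: min_def)
    then show ?thesis
      using g v w \<open>S \<subseteq> {..<n}\<close> unfolding arc_complex_rest_def
      by (intro CollectI conjI exI[of _ "min v g"]) auto
  qed
  have step: "star_removal (B v) (B (Suc v))" if v: "1 \<le> v" "Suc v < n" for v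
  proof (rule star_removalI[of "{v}" "Suc v"])
    show "insert (Suc v) S \<in> B v" if "S \<in> B v" "{v} \<subseteq> S" for S
      using that v insert[of S v "Suc v"] by (auto simp: B_def)
    have "S \<subseteq> {Suc v..} \<longleftrightarrow> S \<subseteq> {v..} \<and> v \<notin> S" for S
      by (auto simp: subset_iff Suc_le_eq le_less)
    then show "B (Suc v) = {S \<in> B v. \<not> {v} \<subseteq> S}"
      by (auto simp: B_def)
  qed auto
  have "collapses (B 1) (B (Suc v))" if "Suc v < n" for v
    using that
  proof (induction v)
    case (Suc v)
    then have "collapses (B 1) (B (Suc v))" by simp
    with step[of "Suc v"] Suc.prems show ?case
      by (simp add: rtranclp.rtrancl_into_rtrancl)
  qed simp
  from this[of "n - 2"] have "collapses (B 1) (B (n - 1))"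
    using n by (simp add: Suc_diff_Suc numeral_2_eq_2)
  moreover have "B 1 = arc_complex_rest n g"
    by (auto simp: B_def arc_complex_rest_def)
  moreover have "collapsible (B (n - 1))"
    using insert[of _ "n - 1" "n - 1"] n by (intro collapsible_cone[of _ "n - 1"]) (auto simp: B_def)
  ultimately show ?thesis
    using collapsible_if_collapses by metis
qed

text \<open>The complement of an avoided arc has at most \<open>g + 1\<close> vertices. Therefore
  the two pieces meet in two disjoint simplices, which collapse to the vertices 1 and
  \<open>g + 1\<close>, and the suspension of two points is a circle.\<close>

lemma sphere_type_arc_complex_circle:
  assumes n: "g + 2 \<le> n" "n \<le> 2 * g + 1"
  shows "sphere_type 1 1 (arc_complex n g)"
proof -
  let ?A = "arc_complex_star n g" and ?B = "arc_complex_rest n g"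
  have eq: "?A \<inter> ?B = Pow {1..<n - g} \<union> Pow {g + 1..<n}"
  proof (intro subset_antisym subsetI)
    fix S assume "S \<in> ?A \<inter> ?B"
    then obtain u b where S: "S \<subseteq> {..<n}" and u: "1 \<le> u" "u + g \<le> n" "\<forall>x\<in>S. x < u \<or> u + g \<le> x"
      and b: "1 \<le> b" "b \<le> g" "\<forall>x\<in>S. b \<le> x \<and> x + g < n + b"
      by (auto simp: arc_complex_star_def arc_complex_rest_def)
    show "S \<in> Pow {1..<n - g} \<union> Pow {g + 1..<n}"
    \<comment> \<open>The two avoided arcs always meet or touch: in front when
      \<open>u \<le> b\<close>, and otherwise at the end because \<open>n \<le> 2 * g + 1\<close>.
      In either case \<open>g + 1\<close> consecutive vertices, 0 among them, are avoided.\<close>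
    proof (cases "u \<le> b")
      case True
      then have "\<forall>x\<in>S. g + 1 \<le> x \<and> x < n"
        using u b S by fastforce
      then show ?thesis by auto
    next
      case False
      have "1 \<le> x \<and> x < n - g" if "x \<in> S" for x
      proof -
        have "x < u \<or> u + g \<le> x" "b \<le> x" "x + g < n + b"
          using u b that by auto
        then show ?thesis
          using False u b n by linarith
      qed
      then show ?thesis by auto
    qed
  next
    fix S assume "S \<in> Pow {1..<n - g} \<union> Pow {g + 1..<n}"
    then consider "S \<subseteq> {1..<n - g}" | "S \<subseteq> {g + 1..<n}" by auto
    then show "S \<in> ?A \<inter> ?B"
    proof cases
      case 1
      then have "\<forall>x\<in>S. 1 \<le> x \<and> x < n - g"
        by auto
      then have "\<forall>x\<in>S. 1 \<le> x \<and> x < n - g \<and> x < n"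
        by auto
      then have "S \<in> ?A"
        using n by (auto simp: arc_complex_star_def intro!: exI[of _ "n - g"])
      moreover have "S \<in> ?B"
        using \<open>\<forall>x\<in>S. 1 \<le> x \<and> x < n - g \<and> x < n\<close> n by (auto simp: arc_complex_rest_def intro!: exI[of _ 1])
      ultimately show ?thesis by blast
    next
      case 2
      then have "S \<in> ?A"
        using n by (auto simp: arc_complex_star_def intro!: exI[of _ 1])
      moreover have "S \<in> ?B"
        using 2 n by (auto simp: arc_complex_rest_def intro!: exI[of _ g])
      ultimately show ?thesis by blast
    qed
  qed
  let ?X = "{2..<n - g} \<union> {g + 2..<n}"
  let ?SS = "(Pow {2..<n - g} \<union> Pow {g + 2..<n}) - {{}}"
  have disj: "{2..<n - g} \<inter> {g + 1..<n} = {}" "{1..<n - g} \<inter> {g + 2..<n} = {}"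
    using n by auto
  have collapse: "collapses (?A \<inter> ?B) {U \<in> ?A \<inter> ?B. U \<inter> ?X \<notin> ?SS}"
    unfolding eq
  proof (rule collapses_discard)
    fix S U assume SS: "S \<in> ?SS" "U \<in> Pow {1..<n - g} \<union> Pow {g + 1..<n}" "S \<subseteq> U"
    have "S \<subseteq> ?X" "S \<noteq> {}" using SS by auto
    with SS(3) have "U \<inter> ?X \<noteq> {}" by blast
    moreover have "{1..<n - g} \<inter> ?X \<subseteq> {2..<n - g}" "{g + 1..<n} \<inter> ?X \<subseteq> {g + 2..<n}"
      using n by auto
    ultimately show "U \<inter> ?X \<in> ?SS"
      using SS(2) by blast
  next
    fix S assume S: "S \<in> ?SS"
    then consider "S \<subseteq> {2..<n - g}" "S \<noteq> {}" | "S \<subseteq> {g + 2..<n}" "S \<noteq> {}" by blast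
    then show "\<exists>w. w \<notin> ?X \<and> (\<forall>U\<in>Pow {1..<n - g} \<union> Pow {g + 1..<n}. U \<inter> ?X = S \<longrightarrow>
        insert w U \<in> Pow {1..<n - g} \<union> Pow {g + 1..<n})"
    proof cases
      case 1
      show ?thesis
      proof (intro exI[of _ "1"] conjI ballI impI)
        show "1 \<notin> ?X" using n by auto
        fix U assume U: "U \<in> Pow {1..<n - g} \<union> Pow {g + 1..<n}" "U \<inter> ?X = S"
        have "S \<subseteq> U" using U(2) by auto
        then have "\<not> U \<subseteq> {g + 1..<n}" using 1 disj by blast
        then have "U \<subseteq> {1..<n - g}" using U(1) by blast
        then have "insert (1) U \<subseteq> {1..<n - g}" using n by auto
        then show "insert (1) U \<in> Pow {1..<n - g} \<union> Pow {g + 1..<n}" by blast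
      qed
    next
      case 2
      show ?thesis
      proof (intro exI[of _ "g + 1"] conjI ballI impI)
        show "g + 1 \<notin> ?X" using n by auto
        fix U assume U: "U \<in> Pow {1..<n - g} \<union> Pow {g + 1..<n}" "U \<inter> ?X = S"
        have "S \<subseteq> U" using U(2) by auto
        then have "\<not> U \<subseteq> {1..<n - g}" using 2 disj by blast
        then have "U \<subseteq> {g + 1..<n}" using U(1) by blast
        then have "insert (g + 1) U \<subseteq> {g + 1..<n}" using n by auto
        then show "insert (g + 1) U \<in> Pow {1..<n - g} \<union> Pow {g + 1..<n}" by blast
      qed
    qed
  qed (auto intro: finite_subset)
  have "{U \<in> ?A \<inter> ?B. U \<inter> ?X \<notin> ?SS} = discrete_complex {1, g + 1}"
  proof (intro subset_antisym subsetI)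
    fix U assume "U \<in> {U \<in> ?A \<inter> ?B. U \<inter> ?X \<notin> ?SS}"
    then have U: "U \<subseteq> {1..<n - g} \<or> U \<subseteq> {g + 1..<n}" "U \<inter> ?X \<notin> ?SS"
      unfolding eq by auto
    have "U \<inter> ?X \<subseteq> {2..<n - g} \<or> U \<inter> ?X \<subseteq> {g + 2..<n}"
      using U(1) disj by blast
    then have "U \<inter> ?X = {}" using U(2) by blast
    then have "U \<subseteq> {1} \<or> U \<subseteq> {g + 1}"
      using U(1) by (fastforce simp: disjoint_iff subset_iff Suc_le_eq le_less)
    then show "U \<in> discrete_complex {1, g + 1}"
      by (auto simp: discrete_complex_def subset_singleton_iff)
  next
    fix U assume "U \<in> discrete_complex {1, g + 1}"
    then have U: "U \<subseteq> {1} \<or> U \<subseteq> {g + 1}"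
      by (auto simp: discrete_complex_def)
    have "1 \<notin> ?X" "g + 1 \<notin> ?X" using n by auto
    then have "U \<inter> ?X = {}" using U by blast
    moreover have "{1} \<subseteq> {1..<n - g}" "{g + 1} \<subseteq> {g + 1..<n}" using n by auto
    ultimately show "U \<in> {U \<in> ?A \<inter> ?B. U \<inter> ?X \<notin> ?SS}"
      unfolding eq using U by (metis (no_types, lifting) CollectI DiffE PowI UnI1 UnI2 singletonI subset_trans)
  qed
  with collapse have collapse: "collapses (?A \<inter> ?B) (discrete_complex {1, g + 1})"
    by (simp only:)
  have discrete: "sphere_type 1 0 (discrete_complex {1, g + 1})"
    using n by (intro sphere_type_discrete) auto
  have "simplicial (?A \<inter> ?B)"
  proof (rule simplicialI[of "{..<n}"])
    show "T \<in> ?A \<inter> ?B" if "S \<in> ?A \<inter> ?B" "T \<subseteq> S" for S T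
      using that simplicialD(2)[OF simplicial_arc_complex_star] simplicialD(2)[OF simplicial_arc_complex_rest]
      by blast
  qed (auto simp: arc_complex_star_def)
  then have "sphere_type 1 0 (?A \<inter> ?B)"
    using sphere_type_collapses[OF collapse _ discrete] by blast
  then have "sphere_type 1 (Suc 0) (?A \<union> ?B)"
    using n by (intro sphere_type_union simplicial_arc_complex_star simplicial_arc_complex_rest
      collapsible_arc_complex_star collapsible_arc_complex_rest finite_arc_complex_pieces)
      (auto simp: eq)
  then show ?thesis
    using arc_complex_decomposition[of g n] n by simp
qed

lemma sphere_type_arc_complex_discrete: "sphere_type g 0 (arc_complex (Suc g) g)"
proof -
  have "arc_complex (Suc g) g = discrete_complex {..<Suc g}"
  proof (intro subset_antisym subsetI)
    fix S assume S: "S \<in> arc_complex (Suc g) g"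
    then have "S \<subseteq> {..<Suc g}" by (simp add: arc_complex_def)
    consider u where "u + g \<le> Suc g" "\<forall>x\<in>S. x < u \<or> u + g \<le> x"
      | b where "b \<le> g" "\<forall>x\<in>S. b \<le> x \<and> x + g < Suc g + b"
      using S by (auto simp: arc_complex_def)
    then have "\<exists>b. S \<subseteq> {b}"
    proof cases
      case 1
      then have "u = 0 \<or> u = 1" by auto
      then have "S \<subseteq> {g} \<or> S \<subseteq> {0}"
        using 1 \<open>S \<subseteq> {..<Suc g}\<close> by fastforce
      then show ?thesis by blast
    next
      case 2
      then have "S \<subseteq> {b}" by fastforce
      then show ?thesis by blast
    qed
    then show "S \<in> discrete_complex {..<Suc g}"
      using \<open>S \<subseteq> {..<Suc g}\<close> by (auto simp: discrete_complex_def subset_singleton_iff)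
  next
    fix S assume "S \<in> discrete_complex {..<Suc g}"
    then consider "S = {}" | b where "b \<le> g" "S = {b}"
      by (auto simp: discrete_complex_def)
    then show "S \<in> arc_complex (Suc g) g"
      by cases (auto simp: arc_complex_def)
  qed
  then show ?thesis
    by (simp add: sphere_type_discrete)
qed

text \<open>Simplices of the intersection avoid an arc through 0 and an arc missing 0. If these meet
  or touch in front, the simplex lies in \<open>A'\<close>; if they do so at the end, or are
  separated on both sides, it lies in \<open>B'\<close>. Both are collapsible, and they meet in the
  arc complex of the cycle shortened by the vertices up to \<open>g\<close>.\<close>

lemma arc_complex_reduction:
  assumes g: "1 \<le> g" and n: "2 * g + 2 \<le> n" and "sphere_type j d (arc_complex (n - g - 1) g)"
  shows "sphere_type j (Suc (Suc d)) (arc_complex n g)"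
proof -
  let ?A = "arc_complex_star n g" and ?B = "arc_complex_rest n g"
  define A' where "A' = Pow {g + 1..<n}"
  \<comment> \<open>Both inequalities between \<open>b\<close> and \<open>u\<close> are strict
    separations: at least one vertex lies between the two avoided arcs on each side.\<close>
  define inner where "inner S \<longleftrightarrow> S \<subseteq> {..<n} \<and>
     (\<exists>b u. 1 \<le> b \<and> b \<le> g \<and> b < u \<and> u + 2 * g + 1 \<le> n + b \<and>
            (\<forall>x\<in>S. b \<le> x \<and> x + g < n + b \<and> (x < u \<or> u + g \<le> x)))" for S
  define B' where "B' = Pow {1..<n - g} \<union> {S. inner S}"
  have AB: "?A \<inter> ?B = A' \<union> B'"
  proof (intro subset_antisym subsetI)
    fix S assume "S \<in> ?A \<inter> ?B"
    then obtain u b where S: "S \<subseteq> {..<n}" and u: "1 \<le> u" "u + g \<le> n" "\<forall>x\<in>S. x < u \<or> u + g \<le> x"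
      and b: "1 \<le> b" "b \<le> g" "\<forall>x\<in>S. b \<le> x \<and> x + g < n + b"
      by (auto simp: arc_complex_star_def arc_complex_rest_def)
    consider "u \<le> b" | "b < u" "n + b \<le> u + 2 * g" | "b < u" "u + 2 * g + 1 \<le> n + b" by linarith
    then show "S \<in> A' \<union> B'"
    proof cases
      case 1
      have "g + 1 \<le> x \<and> x < n" if "x \<in> S" for x
      proof -
        have "x < u \<or> u + g \<le> x" "b \<le> x" "x < n"
          using u b S that by auto
        then show ?thesis using 1 u(1) by linarith
      qed
      then show ?thesis by (auto simp: A'_def)
    next
      case 2
      have "1 \<le> x \<and> x < n - g" if "x \<in> S" for x
      proof -
        have "x < u \<or> u + g \<le> x" "b \<le> x" "x + g < n + b"
          using u b that by auto
        then show ?thesis using 2 u(2) b(1) n by linarith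
      qed
      then show ?thesis by (auto simp: B'_def)
    next
      case 3
      have "inner S"
        unfolding inner_def using S u b 3 by blast
      then show ?thesis by (simp add: B'_def)
    qed
  next
    fix S assume "S \<in> A' \<union> B'"
    then consider "S \<subseteq> {g + 1..<n}" | "S \<subseteq> {1..<n - g}" | "inner S"
      by (auto simp: A'_def B'_def)
    then show "S \<in> ?A \<inter> ?B"
    proof cases
      case 1
      then have "S \<in> ?A"
        using n by (auto simp: arc_complex_star_def intro!: exI[of _ 1])
      moreover have "S \<in> ?B"
        using 1 g by (auto simp: arc_complex_rest_def intro!: exI[of _ g])
      ultimately show ?thesis by blast
    next
      case 2
      then have "\<forall>x\<in>S. 1 \<le> x \<and> x < n - g" by auto
      then have *: "\<forall>x\<in>S. 1 \<le> x \<and> x < n - g \<and> x < n" by auto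
      then have "S \<in> ?A"
        using n by (auto simp: arc_complex_star_def intro!: exI[of _ "n - g"])
      moreover have "S \<in> ?B"
        using * g by (auto simp: arc_complex_rest_def intro!: exI[of _ 1])
      ultimately show ?thesis by blast
    next
      case 3
      then obtain b u where S: "S \<subseteq> {..<n}" and bu: "1 \<le> b" "b \<le> g" "b < u" "u + 2 * g + 1 \<le> n + b"
        and x: "\<forall>x\<in>S. b \<le> x \<and> x + g < n + b \<and> (x < u \<or> u + g \<le> x)"
        unfolding inner_def by blast
      have "1 \<le> u" "u + g \<le> n" using bu by linarith+
      then have "S \<in> ?A"
        using S x unfolding arc_complex_star_def by blast
      moreover have "S \<in> ?B"
        using S x bu unfolding arc_complex_rest_def by blast
      ultimately show ?thesis by blast
    qed
  qed
  \<comment> \<open>With all vertices up to \<open>g\<close> gone, \<open>g + 1\<close> becomes the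
    first vertex of a shorter cycle.\<close>
  have A'B': "A' \<inter> B' = (`) (\<lambda>x. x + (g + 1)) ` arc_complex (n - g - 1) g"
  proof (intro subset_antisym subsetI)
    fix S assume S: "S \<in> A' \<inter> B'"
    then have "S \<subseteq> {g + 1..<n}" by (simp add: A'_def)
    define T where "T = {x. x + (g + 1) \<in> S}"
    have "S = (\<lambda>x. x + (g + 1)) ` T"
    proof (intro subset_antisym subsetI)
      fix x assume "x \<in> S"
      then have "g + 1 \<le> x" using \<open>S \<subseteq> {g + 1..<n}\<close> by auto
      with \<open>x \<in> S\<close> show "x \<in> (\<lambda>x. x + (g + 1)) ` T"
        by (intro image_eqI[of _ _ "x - (g + 1)"]) (auto simp: T_def)
    qed (auto simp: T_def)
    moreover have "T \<in> arc_complex (n - g - 1) g"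
    proof -
      have T: "T \<subseteq> {..<n - g - 1}"
        using \<open>S \<subseteq> {g + 1..<n}\<close> by (auto simp: T_def)
      consider "S \<subseteq> {1..<n - g}" | "inner S"
        using S by (auto simp: B'_def)
      then show ?thesis
      proof cases
        case 1
        have "\<forall>x\<in>T. 0 \<le> x \<and> x + g < (n - g - 1) + 0"
        proof
          fix x assume "x \<in> T"
          then have "x + (g + 1) < n - g"
            using 1 by (auto simp: T_def)
          then show "0 \<le> x \<and> x + g < (n - g - 1) + 0" by linarith
        qed
        then show ?thesis
          using T unfolding arc_complex_def by blast
      next
        case 2
        then obtain b u where bu: "1 \<le> b" "b \<le> g" "b < u" "u + 2 * g + 1 \<le> n + b"
          and x: "\<forall>x\<in>S. b \<le> x \<and> x + g < n + b \<and> (x < u \<or> u + g \<le> x)"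
          unfolding inner_def by blast
        have y: "y + (g + 1) + g < n + b" "y + (g + 1) < u \<or> u + g \<le> y + (g + 1)" if "y \<in> T" for y
          using x that by (auto simp: T_def)
        show ?thesis
        proof (cases "g + 1 \<le> u")
          case True
          have "\<forall>y\<in>T. y < u - (g + 1) \<or> u - (g + 1) + g \<le> y"
          proof
            fix z assume "z \<in> T"
            from y(2)[OF this] True show "z < u - (g + 1) \<or> u - (g + 1) + g \<le> z" by linarith
          qed
          moreover have "u - (g + 1) + g \<le> n - g - 1"
            using True bu by linarith
          ultimately show ?thesis
            using T unfolding arc_complex_def by blast
        next
          case False
          \<comment> \<open>For \<open>u \<le> g\<close> the second arc avoids the first
            \<open>u - 1\<close> vertices of the short cycle, at least \<open>b\<close> of them, and
            the arc through 0 avoids its last \<open>g - b\<close>; together they give a wrapping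
            arc.\<close>
          have "\<forall>y\<in>T. b \<le> y \<and> y + g < n - g - 1 + b"
          proof
            fix z assume "z \<in> T"
            from y[OF this] False bu n show "b \<le> z \<and> z + g < n - g - 1 + b" by linarith
          qed
          then show ?thesis
            using T bu unfolding arc_complex_def by blast
        qed
      qed
    qed
    ultimately show "S \<in> (`) (\<lambda>x. x + (g + 1)) ` arc_complex (n - g - 1) g" by blast
  next
    fix S assume "S \<in> (`) (\<lambda>x. x + (g + 1)) ` arc_complex (n - g - 1) g"
    then obtain T where T: "T \<in> arc_complex (n - g - 1) g" and S: "S = (\<lambda>x. x + (g + 1)) ` T"
      by blast
    have "T \<subseteq> {..<n - g - 1}" using T by (simp add: arc_complex_def)
    then have "S \<in> A'"
      by (auto simp: S A'_def)
    have first: "S \<in> B'" if "\<forall>x\<in>T. x + g < n - g - 1"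
    proof -
      have "\<forall>x\<in>T. x + (g + 1) < n - g"
        using that by (metis (no_types, lifting) add.assoc less_diff_conv)
      then show ?thesis by (auto simp: S B'_def)
    qed
    consider u where "u + g \<le> n - g - 1" "\<forall>x\<in>T. x < u \<or> u + g \<le> x"
      | b where "b \<le> g" "\<forall>x\<in>T. b \<le> x \<and> x + g < n - g - 1 + b"
      using T by (auto simp: arc_complex_def)
    then have "S \<in> B'"
    proof cases
      case 1
      show ?thesis
      proof (cases "u + g = n - g - 1")
        case True
        have "\<forall>x\<in>T. x + g < n - g - 1"
        proof
          fix x assume "x \<in> T"
          then have "x < u \<or> u + g \<le> x" "x < n - g - 1"
            using 1 \<open>T \<subseteq> _\<close> by auto
          then show "x + g < n - g - 1" using True by linarith
        qed
        then show ?thesis by (rule first)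
      next
        case False
        \<comment> \<open>A linear arc of the short cycle is kept as the second arc; the arc through
          0 is taken with \<open>b = g\<close>, inside the deleted front.\<close>
        have "\<forall>x\<in>S. g \<le> x \<and> x + g < n + g \<and> (x < u + (g + 1) \<or> u + (g + 1) + g \<le> x)"
          using 1(2) \<open>T \<subseteq> _\<close> by (auto simp: S)
        moreover have "g < u + (g + 1)" "u + (g + 1) + 2 * g + 1 \<le> n + g"
          using 1(1) False by linarith+
        moreover have "S \<subseteq> {..<n}" using \<open>S \<in> A'\<close> by (auto simp: A'_def)
        ultimately have "inner S"
          unfolding inner_def using g by blast
        then show ?thesis by (simp add: B'_def)
      qed
    next
      case 2
      show ?thesis
      proof (cases "b = 0")
        case False
        \<comment> \<open>For a wrapping arc the second arc starts at \<open>b + 1\<close>; its end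
          covers the first \<open>b\<close> vertices of the short cycle, and the vertex
          \<open>b\<close> is the required separation.\<close>
        have "\<forall>x\<in>S. b \<le> x \<and> x + g < n + b \<and> (x < b + 1 \<or> b + 1 + g \<le> x)"
          using 2(2) by (auto simp: S)
        moreover have "1 \<le> b" "b < b + 1" "b + 1 + 2 * g + 1 \<le> n + b"
          using False n by linarith+
        moreover have "S \<subseteq> {..<n}" using \<open>S \<in> A'\<close> by (auto simp: A'_def)
        ultimately have "inner S"
          unfolding inner_def using 2(1) by blast
        then show ?thesis by (simp add: B'_def)
      qed (use 2 first in simp)
    qed
    with \<open>S \<in> A'\<close> show "S \<in> A' \<inter> B'" by blast
  qed
  have "{1..<n - g} \<subseteq> {..<n}" by auto
  then have sub: "A' \<union> B' \<subseteq> Pow {..<n}"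
    by (auto simp: A'_def B'_def inner_def)
  have down: "T \<in> B'" if "S \<in> B'" "T \<subseteq> S" for S T
  proof -
    have "inner T" if "inner S"
      using that \<open>T \<subseteq> S\<close> unfolding inner_def by (meson subset_iff)
    with that show ?thesis by (auto simp: B'_def)
  qed
  have "collapsible B'"
  proof -
    let ?X = "{n - g..<n}" and ?SS = "Pow {n - g..<n} - {{}}"
    have "collapses B' {U \<in> B'. U \<inter> ?X \<notin> ?SS}"
    proof (rule collapses_discard)
      show "\<exists>w. w \<notin> ?X \<and> (\<forall>U\<in>B'. U \<inter> ?X = S \<longrightarrow> insert w U \<in> B')" if S: "S \<in> ?SS" for S
      proof -
        have fin: "finite S" "S \<noteq> {}" "S \<subseteq> ?X"
          using S by (auto intro: finite_subset)
        define m where "m = Max S"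
        have m: "m \<in> S" "\<And>x. x \<in> S \<Longrightarrow> x \<le> m"
          using fin by (auto simp: m_def)
        then have mX: "n - g \<le> m" "m < n" using fin by auto
        \<comment> \<open>The avoided arc through 0 is rotated back until it starts right after the
          largest vertex \<open>m\<close>. It then consists of \<open>{m + 1..<n}\<close> and
          \<open>{..<w}\<close>, which releases the vertex \<open>w\<close>; this \<open>w\<close>
          depends on the trace alone.\<close>
        define w where "w = m + g + 1 - n"
        have w: "1 \<le> w" "w \<le> g" "m + g + 1 = n + w"
          using mX n by (auto simp: w_def)
        have "insert w U \<in> B'" if U: "U \<in> B'" "U \<inter> ?X = S" for U
        proof -
          have "\<not> U \<subseteq> {1..<n - g}"
            using U m(1) mX by fastforce
          then obtain b u where sub: "U \<subseteq> {..<n}" and bu: "1 \<le> b" "b \<le> g" "b < u" "u + 2 * g + 1 \<le> n + b"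
            and x: "\<And>x. x \<in> U \<Longrightarrow> b \<le> x \<and> x + g < n + b \<and> (x < u \<or> u + g \<le> x)"
            using U unfolding B'_def inner_def by blast
          have mU: "b \<le> m" "m + g < n + b" "m < u \<or> u + g \<le> m"
            using x[of m] m(1) U(2) by auto
          have le_m: "x \<le> m" if "x \<in> U" for x
          proof (rule ccontr)
            assume "\<not> x \<le> m"
            then have "x \<in> U \<inter> ?X"
              using that mX sub by auto
            with U(2) m(2) \<open>\<not> x \<le> m\<close> show False by auto
          qed
          have "w \<le> b" using mU w by linarith
          have um: "u + g \<le> m"
            using mU bu w by linarith
          have "\<forall>x\<in>insert w U. w \<le> x \<and> x + g < n + w \<and> (x < u \<or> u + g \<le> x)"
          proof
            fix y assume "y \<in> insert w U"
            then consider "y = w" | "y \<in> U" by blast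
            then show "w \<le> y \<and> y + g < n + w \<and> (y < u \<or> u + g \<le> y)"
            proof cases
              case 1
              then show ?thesis using \<open>w \<le> b\<close> bu n w by linarith
            next
              case 2
              then show ?thesis using x[of y] le_m[of y] \<open>w \<le> b\<close> w by linarith
            qed
          qed
          moreover have "w < u" "u + 2 * g + 1 \<le> n + w" "w < n"
            using um w bu \<open>w \<le> b\<close> n by linarith+
          ultimately have "inner (insert w U)"
            unfolding inner_def using w sub by blast
          then show ?thesis by (simp add: B'_def)
        qed
        moreover have "w \<notin> ?X" using w n by auto
        ultimately show ?thesis by blast
      qed
      show "U \<inter> ?X \<in> ?SS" if "S \<in> ?SS" "U \<in> B'" "S \<subseteq> U" for S U
        using that by blast
    qed (auto intro: finite_subset)
    \<comment> \<open>What survives is the full simplex on \<open>{1..<n - g}\<close>.\<close>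
    moreover have "collapsible {U \<in> B'. U \<inter> ?X \<notin> ?SS}"
    proof (rule collapsible_cone[of _ 1])
      fix U assume "U \<in> {U \<in> B'. U \<inter> ?X \<notin> ?SS}"
      then have U: "U \<in> B'" "U \<inter> ?X = {}" by auto
      have "0 \<notin> U" "U \<subseteq> {..<n}"
      proof -
        have "\<forall>x\<in>U. 1 \<le> x"
        proof (cases "inner U")
          case True
          then show ?thesis
            unfolding inner_def by (metis order.trans)
        next
          case False
          then show ?thesis
            using U(1) by (auto simp: B'_def)
        qed
        then show "0 \<notin> U" by auto
        show "U \<subseteq> {..<n}" using U(1) sub by blast
      qed
      have "U \<subseteq> {1..<n - g}"
      proof
        fix x assume "x \<in> U"
        then have "x \<noteq> 0" "x < n" "x \<notin> ?X"
          using \<open>0 \<notin> U\<close> \<open>U \<subseteq> {..<n}\<close> U(2) by auto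
        then show "x \<in> {1..<n - g}" by auto
      qed
      then have "insert 1 U \<subseteq> {1..<n - g}" using n by auto
      moreover have "{1..<n - g} \<inter> ?X = {}" by auto
      ultimately show "insert 1 U \<in> {U \<in> B'. U \<inter> ?X \<notin> ?SS}"
        unfolding B'_def by blast
    qed
    ultimately show ?thesis by (rule collapsible_if_collapses)
  qed
  moreover have "collapsible A'"
    using n unfolding A'_def by (intro collapsible_cone[of _ "g + 1"]) auto
  moreover have "simplicial A'"
    unfolding A'_def by (rule simplicialI[of "{g + 1..<n}"]) auto
  moreover have "simplicial B'"
    by (rule simplicialI[of "{..<n}", OF _ _ down]) (use sub in auto)
  moreover have "finite A'" "finite B'"
    using sub by (meson Un_subset_iff finite_Pow_iff finite_lessThan finite_subset)+
  moreover have "sphere_type j d (A' \<inter> B')"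
    unfolding A'B' by (rule sphere_type_image[OF simplicial_arc_complex _ _ assms(3), of UNIV]) (auto simp: inj_on_def)
  moreover have "{} \<in> A' \<inter> B'"
    by (simp add: A'_def B'_def)
  ultimately have "sphere_type j (Suc d) (?A \<inter> ?B)"
    unfolding AB by (intro sphere_type_union)
  moreover have "{} \<in> ?A \<inter> ?B"
    unfolding AB by (simp add: A'_def)
  ultimately have "sphere_type j (Suc (Suc d)) (?A \<union> ?B)"
    using g n
    by (intro sphere_type_union simplicial_arc_complex_star simplicial_arc_complex_rest
      collapsible_arc_complex_star collapsible_arc_complex_rest finite_arc_complex_pieces) auto
  then show ?thesis
    using arc_complex_decomposition[of g n] g n by simp
qed

text \<open>For \<open>q = 0\<close> the number of vertices is \<open>g + 1 + s\<close>: this is the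
  case of isolated points for \<open>s = 0\<close>, and within the range of the circle
  otherwise.\<close>

lemma sphere_type_arc_complex:
  assumes "1 \<le> g" "s \<le> g"
  shows "sphere_type (if s = 0 then g else 1) (2 * q + (if s = 0 then 0 else 1)) (arc_complex (Suc q * (g + 1) + s) g)"
proof (induction q)
  case 0
  show ?case
    using sphere_type_arc_complex_discrete[of g] sphere_type_arc_complex_circle[of g "Suc g + s"] assms by auto
next
  case (Suc q)
  have "Suc (Suc q) * (g + 1) + s - g - 1 = Suc q * (g + 1) + s"
    by simp
  then have reduce: "sphere_type j (Suc (Suc d)) (arc_complex (Suc (Suc q) * (g + 1) + s) g)"
    if "sphere_type j d (arc_complex (Suc q * (g + 1) + s) g)" for j d
    using that by (intro arc_complex_reduction[OF assms(1)]) (simp, simp only:)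
  from reduce[OF Suc.IH] show ?case
    by (simp only: mult_Suc_right add_2_eq_Suc add_Suc)
qed

section \<open>Powers of cycles\<close>

text \<open>The two disjuncts measure the two ways around the cycle, written without subtraction;
  the empty simplex is included.\<close>

definition cycle_cliques :: "nat \<Rightarrow> nat \<Rightarrow> nat set set" where
  "cycle_cliques n r = {S. S \<subseteq> {..<n} \<and> (\<forall>x\<in>S. \<forall>y\<in>S. x < y \<longrightarrow> y \<le> x + r \<or> x + n \<le> y + r)}"

section \<open>Distances in a cycle and cliques of its powers\<close>

lemma cycle_walk_near:
  assumes "(adj (cycle_graph n) ^^ k) u v" "u < n"
  shows "v < n \<and> (u \<le> v + k \<and> v \<le> u + k \<or> u + n \<le> v + k \<or> v + n \<le> u + k)"
  using assms(1)
proof (induction k arbitrary: v)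
  case 0
  then show ?case using assms(2) by simp
next
  case (Suc k)
  then obtain w where w: "(adj (cycle_graph n) ^^ k) u w" "adj (cycle_graph n) w v" by auto
  have "v < n" "w < n" "v = Suc w mod n \<or> w = Suc v mod n"
    using w(2) by (auto simp: cycle_graph_def)
  then have "v = Suc w \<or> w = Suc v \<or> (Suc w = n \<and> v = 0) \<or> (Suc v = n \<and> w = 0)"
    by (cases "Suc w = n"; cases "Suc v = n") auto
  then show ?case
    using Suc.IH[OF w(1)] \<open>v < n\<close> assms(2) by arith
qed

lemma cycle_walk:
  assumes "u < n"
  shows "(adj (cycle_graph n) ^^ k) u ((u + k) mod n)" "(adj (cycle_graph n) ^^ k) ((u + k) mod n) u"
proof -
  have "adj (cycle_graph n) ((u + k) mod n) ((u + Suc k) mod n)"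
    "adj (cycle_graph n) ((u + Suc k) mod n) ((u + k) mod n)" for k
    using assms by (auto simp: cycle_graph_def mod_Suc_eq)
  note step = this
  show "(adj (cycle_graph n) ^^ k) u ((u + k) mod n)"
  proof (induction k)
    case (Suc k)
    then show ?case using step(1)[of k] by (rule relpowp_Suc_I)
  qed (use assms in simp)
  show "(adj (cycle_graph n) ^^ k) ((u + k) mod n) u"
  proof (induction k)
    case (Suc k)
    from step(2)[of k] Suc show ?case by (rule relpowp_Suc_I2)
  qed (use assms in simp)
qed

lemma graph_dist_le_iff: "graph_dist G u v \<le> enat r \<longleftrightarrow> (\<exists>k\<le>r. (adj G ^^ k) u v)"
proof
  assume le: "graph_dist G u v \<le> enat r"
  let ?A = "{enat k |k. (adj G ^^ k) u v}"
  have "?A \<noteq> {}"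
  proof
    assume "?A = {}"
    then have "graph_dist G u v = \<infinity>"
      unfolding graph_dist_def by (simp add: top_enat_def)
    with le show False by simp
  qed
  then have "Inf ?A \<in> ?A"
    by (metis (no_types, lifting) Inf_enat_def LeastI ex_in_conv)
  then obtain k where "Inf ?A = enat k" "(adj G ^^ k) u v" by blast
  with le show "\<exists>k\<le>r. (adj G ^^ k) u v"
    unfolding graph_dist_def by auto
next
  assume "\<exists>k\<le>r. (adj G ^^ k) u v"
  then obtain k where k: "k \<le> r" "(adj G ^^ k) u v" by blast
  then have "graph_dist G u v \<le> enat k"
    unfolding graph_dist_def by (intro Inf_lower) blast
  with k(1) show "graph_dist G u v \<le> enat r"
    by (meson enat_ord_simps(1) order_trans)
qed

lemma cycle_dist_le_iff:
  assumes "u < v" "v < n"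
  shows "graph_dist (cycle_graph n) u v \<le> enat r \<longleftrightarrow> v \<le> u + r \<or> u + n \<le> v + r"
    and "graph_dist (cycle_graph n) v u \<le> enat r \<longleftrightarrow> v \<le> u + r \<or> u + n \<le> v + r"
proof -
  have u: "u < n" using assms by simp
  have 1: "(adj (cycle_graph n) ^^ (v - u)) u v" "(adj (cycle_graph n) ^^ (v - u)) v u"
    using cycle_walk[OF u, of "v - u"] assms by auto
  have "(v + (u + n - v)) mod n = u"
    using assms by simp
  then have 2: "(adj (cycle_graph n) ^^ (u + n - v)) u v" "(adj (cycle_graph n) ^^ (u + n - v)) v u"
    using cycle_walk[OF assms(2), of "u + n - v"] by auto
  show "graph_dist (cycle_graph n) u v \<le> enat r \<longleftrightarrow> v \<le> u + r \<or> u + n \<le> v + r"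
    unfolding graph_dist_le_iff
  proof
    assume "\<exists>k\<le>r. (adj (cycle_graph n) ^^ k) u v"
    then show "v \<le> u + r \<or> u + n \<le> v + r"
      using cycle_walk_near[OF _ u] assms by fastforce
  next
    assume "v \<le> u + r \<or> u + n \<le> v + r"
    then show "\<exists>k\<le>r. (adj (cycle_graph n) ^^ k) u v"
      using 1 2 by (metis add.commute le_diff_conv)
  qed
  show "graph_dist (cycle_graph n) v u \<le> enat r \<longleftrightarrow> v \<le> u + r \<or> u + n \<le> v + r"
    unfolding graph_dist_le_iff
  proof
    assume "\<exists>k\<le>r. (adj (cycle_graph n) ^^ k) v u"
    then show "v \<le> u + r \<or> u + n \<le> v + r"
      using cycle_walk_near[OF _ assms(2)] assms by fastforce
  next
    assume "v \<le> u + r \<or> u + n \<le> v + r"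
    then show "\<exists>k\<le>r. (adj (cycle_graph n) ^^ k) v u"
      using 1 2 by (metis add.commute le_diff_conv)
  qed
qed

lemma clique_complex_cycle_power:
  "insert {} (clique_complex (graph_power (cycle_graph n) r)) = cycle_cliques n r"
proof -
  have verts: "verts (graph_power (cycle_graph n) r) = {..<n}"
    by (simp add: graph_power_def cycle_graph_def)
  have adj: "adj (graph_power (cycle_graph n) r) u v \<longleftrightarrow> v \<le> u + r \<or> u + n \<le> v + r"
    "adj (graph_power (cycle_graph n) r) v u \<longleftrightarrow> v \<le> u + r \<or> u + n \<le> v + r"
    if "u < v" "v < n" for u v
    using that cycle_dist_le_iff[OF that] by (auto simp: graph_power_def cycle_graph_def)
  have iff: "(\<forall>u\<in>S. \<forall>v\<in>S. u \<noteq> v \<longrightarrow> adj (graph_power (cycle_graph n) r) u v) \<longleftrightarrow>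
      (\<forall>x\<in>S. \<forall>y\<in>S. x < y \<longrightarrow> y \<le> x + r \<or> x + n \<le> y + r)" if "S \<subseteq> {..<n}" for S
    using that adj by (metis lessThan_iff linorder_neq_iff subsetD)
  have "S \<in> insert {} (clique_complex (graph_power (cycle_graph n) r)) \<longleftrightarrow> S \<in> cycle_cliques n r" for S
  proof (cases "S \<subseteq> {..<n}")
    case True
    moreover have "finite S" using True finite_subset by blast
    ultimately show ?thesis
      by (cases "S = {}") (simp_all add: clique_complex_def verts cycle_cliques_def iff)
  next
    case False
    then show ?thesis
      by (auto simp: clique_complex_def verts cycle_cliques_def)
  qed
  then show ?thesis by blast
qed

lemma simplicial_cycle_cliques: "simplicial (cycle_cliques n r)"
proof (rule simplicialI[of "{..<n}"])
  fix S T assume "S \<in> cycle_cliques n r" "T \<subseteq> S"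
  then show "T \<in> cycle_cliques n r"
    unfolding cycle_cliques_def by blast
qed (auto simp: cycle_cliques_def)

text \<open>Three pairwise near vertices cannot surround the cycle, so a clique lies in an arc of
  \<open>r + 1\<close> vertices. In the first case this arc ends at \<open>p\<close>, the last
  vertex within distance \<open>r\<close> after the minimum \<open>m\<close>: a vertex beyond
  \<open>p\<close> is near both \<open>m\<close> and \<open>p\<close> only through the
  wrap-around.\<close>

lemma cycle_cliques_eq_arc_complex:
  assumes "3 * r < n"
  shows "cycle_cliques n r = arc_complex n (n - r - 1)"
proof (intro subset_antisym subsetI)
  fix S assume S: "S \<in> cycle_cliques n r"
  then have sub: "S \<subseteq> {..<n}" and near: "\<And>x y. x \<in> S \<Longrightarrow> y \<in> S \<Longrightarrow> x < y \<Longrightarrow> y \<le> x + r \<or> x + n \<le> y + r"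
    by (auto simp: cycle_cliques_def)
  have fin: "finite S" using sub finite_subset by blast
  show "S \<in> arc_complex n (n - r - 1)"
  proof (cases "S = {}")
    case True
    then show ?thesis using assms by (auto simp: arc_complex_def intro!: exI[of _ 0])
  next
    case False
    define m where "m = Min S"
    have m: "m \<in> S" "\<And>x. x \<in> S \<Longrightarrow> m \<le> x"
      using False fin by (auto simp: m_def)
    define L where "L = {x \<in> S. x \<le> m + r}"
    have "finite L" "m \<in> L" using fin m by (auto simp: L_def)
    define p where "p = Max L"
    have p: "p \<in> L" "\<And>x. x \<in> L \<Longrightarrow> x \<le> p"
      using Max_in[OF \<open>finite L\<close>] Max_ge[OF \<open>finite L\<close>] \<open>m \<in> L\<close> unfolding p_def by blast+
    have pm: "p \<in> S" "p \<le> m + r" using p(1) by (auto simp: L_def)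
    show ?thesis
    proof (cases "p + 1 + (n - r - 1) \<le> n")
      case True
      have "\<forall>x\<in>S. x < p + 1 \<or> p + 1 + (n - r - 1) \<le> x"
      proof
        fix x assume x: "x \<in> S"
        show "x < p + 1 \<or> p + 1 + (n - r - 1) \<le> x"
        proof (cases "x \<in> L")
          case False
          then have "m + r < x" using x by (simp add: L_def)
          then have "m + n \<le> x + r"
            using near[OF m(1) x] by linarith
          then have "p < x" "\<not> x \<le> p + r"
            using pm assms by linarith+
          then show ?thesis
            using near[OF pm(1) x] assms by linarith
        qed (use p in fastforce)
      qed
      with True sub show ?thesis
        unfolding arc_complex_def by blast
    next
      case False
      have "x \<in> L" if x: "x \<in> S" for x
      proof (rule ccontr)
        assume "x \<notin> L"
        then have "m + r < x" using x by (simp add: L_def)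
        then have "m + n \<le> x + r" using near[OF m(1) x] by linarith
        moreover have "x < n" using x sub by auto
        ultimately have "p < x" "\<not> x \<le> p + r" using pm assms by linarith+
        then have "p + n \<le> x + r" using near[OF pm(1) x] by linarith
        with False \<open>x < n\<close> assms show False by linarith
      qed
      then have "\<forall>x\<in>S. x \<le> p" using p(2) by blast
      \<comment> \<open>Here the clique lies between \<open>m\<close> and \<open>m + r\<close>, and
        the avoided arc surrounds it. The minimum handles a large \<open>m\<close>, where the
        avoided arc already fits before \<open>m\<close>.\<close>
      have b: "\<forall>x\<in>S. min m (n - r - 1) \<le> x \<and> x + (n - r - 1) < n + min m (n - r - 1)"
      proof
        fix x assume x: "x \<in> S"
        then have "m \<le> x" "x \<le> p" "x < n" using m(2) \<open>\<forall>x\<in>S. x \<le> p\<close> sub by auto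
        then show "min m (n - r - 1) \<le> x \<and> x + (n - r - 1) < n + min m (n - r - 1)"
          using pm assms by (auto simp: min_def)
      qed
      moreover have "min m (n - r - 1) \<le> n - r - 1" by simp
      ultimately show ?thesis
        using sub unfolding arc_complex_def by blast
    qed
  qed
next
  fix S assume S: "S \<in> arc_complex n (n - r - 1)"
  have "y \<le> x + r \<or> x + n \<le> y + r" if xy: "x \<in> S" "y \<in> S" "x < y" for x y
  proof -
    have "x < n" "y < n" using xy S by (auto simp: arc_complex_def)
    consider u where "u + (n - r - 1) \<le> n" "x < u \<or> u + (n - r - 1) \<le> x" "y < u \<or> u + (n - r - 1) \<le> y"
      | b where "b \<le> n - r - 1" "b \<le> x" "y + (n - r - 1) < n + b"
      using S xy(1,2) unfolding arc_complex_def by blast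
    then show ?thesis
      using assms \<open>x < n\<close> \<open>y < n\<close> \<open>x < y\<close> by cases linarith+
  qed
  then show "S \<in> cycle_cliques n r"
    using S by (auto simp: cycle_cliques_def arc_complex_def)
qed

text \<open>\<open>?Y\<close> consists of the non-neighbours of 0, \<open>?X\<close> and
  \<open>?X'\<close> of its neighbours on the two sides. All three are cliques, so in the
  intersection \<open>C\<close> of the two families of stars only pairs between \<open>?X\<close>
  and \<open>?X'\<close> impose conditions.\<close>

lemma cycle_cliques_reduction:
  assumes k: "2 \<le> k" "k \<le> r" and "sphere_type j d (arc_complex r (k - 1))"
  shows "sphere_type j (Suc (Suc d)) (cycle_cliques (2 * r + k) r)"
proof -
  let ?n = "2 * r + k"
  let ?K = "cycle_cliques ?n r"
  let ?Y = "{r + 1..<r + k}" and ?X = "{1..<r + 1}" and ?X' = "{r + k..<2 * r + k}"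
  define near where "near x y \<longleftrightarrow> (x < y \<longrightarrow> y \<le> x + r \<or> x + ?n \<le> y + r)" for x y :: nat
  have K: "S \<in> ?K \<longleftrightarrow> S \<subseteq> {..<?n} \<and> (\<forall>x\<in>S. \<forall>y\<in>S. near x y)" for S
    by (simp add: cycle_cliques_def near_def)
  have insert_K: "insert w S \<in> ?K \<longleftrightarrow> w < ?n \<and> S \<in> ?K \<and> (\<forall>x\<in>S. near w x \<and> near x w)" for w S
    unfolding K by (auto simp: near_def)
  have down: "T \<in> ?K" if "S \<in> ?K" "T \<subseteq> S" for S T
    using that unfolding K by blast
  define A where "A = {S \<in> ?K. \<exists>y\<in>?Y. insert y S \<in> ?K}"
  define B where "B = {S \<in> ?K. insert 0 S \<in> ?K}"
  \<comment> \<open>The lower bounds express adjacency of \<open>x\<close> and \<open>t\<close>, the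
    bound \<open>x + 2 * r\<close> a common neighbour in \<open>?Y\<close>. The \<open>t\<close>
    excluded for a given \<open>x\<close> are \<open>k - 1\<close> consecutive vertices of
    \<open>?X'\<close> read as a cycle of length \<open>r\<close>.\<close>
  define pair where "pair x t \<longleftrightarrow> t \<le> x + r \<or> (x + r + k \<le> t \<and> t \<le> x + 2 * r)" for x t
  define C where "C = {S. S \<subseteq> ?X \<union> ?X' \<and> (\<forall>x\<in>S \<inter> ?X. \<forall>t\<in>S \<inter> ?X'. pair x t)}"
  define A' where "A' = Pow ?X"
  define B' where "B' = {S \<in> C. \<exists>t\<in>?X'. insert t (S \<inter> ?X) \<in> C}"
  have near_Y: "near y y'" if "y \<in> ?Y" "y' \<in> ?Y" for y y'
    using that k by (auto simp: near_def)
  have AB: "A \<union> B = ?K"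
  proof (intro subset_antisym subsetI)
    fix S assume S: "S \<in> ?K"
    show "S \<in> A \<union> B"
    proof (cases "S \<inter> ?Y = {}")
      case True
      have "near 0 x \<and> near x 0" if "x \<in> S" for x
      proof -
        have "x < ?n" "x \<notin> ?Y" using that S True unfolding K by auto
        then show ?thesis by (auto simp: near_def)
      qed
      then have "insert 0 S \<in> ?K" using S k by (simp add: insert_K)
      with S show ?thesis by (simp add: B_def)
    next
      case False
      then obtain y where "y \<in> S" "y \<in> ?Y" by blast
      then show ?thesis
        using S insert_absorb[OF \<open>y \<in> S\<close>] unfolding A_def by (metis (mono_tags, lifting) CollectI UnI1)
    qed
  qed (auto simp: A_def B_def)
  have A_Int_B: "A \<inter> B = C"
  proof (intro subset_antisym subsetI)
    fix S assume "S \<in> A \<inter> B"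
    then obtain y where S: "S \<in> ?K" and y: "y \<in> ?Y" "\<And>x. x \<in> S \<Longrightarrow> near y x \<and> near x y"
      and 0: "\<And>x. x \<in> S \<Longrightarrow> near 0 x"
      by (auto simp: A_def B_def insert_K)
    have "x \<in> ?X \<union> ?X'" if "x \<in> S" for x
    proof -
      have "x < ?n" using S that unfolding K by auto
      moreover have "x \<noteq> 0" using y(2)[OF that] y(1) by (auto simp: near_def)
      ultimately show ?thesis
        using 0[OF that] by (auto simp: near_def)
    qed
    moreover have "pair x t" if "x \<in> S \<inter> ?X" "t \<in> S \<inter> ?X'" for x t
    proof -
      have "near x y" "near y t" "near x t" using that y(2) S unfolding K by auto
      then show ?thesis
        using that y(1) by (auto simp: near_def pair_def)
    qed
    ultimately show "S \<in> C"
      unfolding C_def by blast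
  next
    fix S assume "S \<in> C"
    then have S: "S \<subseteq> ?X \<union> ?X'" and pair: "\<And>x t. x \<in> S \<inter> ?X \<Longrightarrow> t \<in> S \<inter> ?X' \<Longrightarrow> pair x t"
      by (auto simp: C_def)
    have near: "near x y" if xy: "x \<in> S" "y \<in> S" for x y
    proof -
      consider "x \<in> ?X'" | "y \<in> ?X" | "x \<in> S \<inter> ?X" "y \<in> S \<inter> ?X'"
        using xy S by blast
      then show ?thesis
      proof cases
        case 3
        then show ?thesis
          using pair[OF 3] by (auto simp: near_def pair_def)
      qed (use xy S k in \<open>auto simp: near_def\<close>)
    qed
    have "S \<subseteq> {..<?n}"
      using S by auto
    with near have SK: "S \<in> ?K" unfolding K by blast
    have "near 0 x \<and> near x 0" if "x \<in> S" for x
      using S that by (auto simp: near_def)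
    then have "S \<in> B" using SK k by (simp add: insert_K B_def)
    \<comment> \<open>One \<open>y\<close> must serve all pairs. The largest vertex of
      \<open>?Y\<close> adjacent to the least \<open>m\<close> is \<open>r + min m (k - 1)\<close>;
      it is adjacent to all of \<open>S \<inter> ?X\<close>, and being largest it reaches furthest
      into \<open>?X'\<close>.\<close>
    have "\<exists>y\<in>?Y. (\<forall>x\<in>S \<inter> ?X. y \<le> x + r) \<and> (\<forall>t\<in>S \<inter> ?X'. t \<le> y + r)"
    proof (cases "S \<inter> ?X = {}")
      case True
      then show ?thesis using k by (intro bexI[of _ "r + k - 1"]) auto
    next
      case False
      define m where "m = Min (S \<inter> ?X)"
      have fin: "finite (S \<inter> ?X)" by simp
      have m: "m \<in> S \<inter> ?X" unfolding m_def using Min_in[OF fin False] .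
      have le: "m \<le> x" if "x \<in> S \<inter> ?X" for x
        unfolding m_def using fin that by (rule Min_le)
      have "t \<le> m + 2 * r" "t < 2 * r + k" if "t \<in> S \<inter> ?X'" for t
        using pair[OF m that] that m by (auto simp: pair_def)
      then have "\<forall>t\<in>S \<inter> ?X'. t \<le> r + min m (k - 1) + r"
        by (fastforce simp: min_def)
      moreover have "\<forall>x\<in>S \<inter> ?X. r + min m (k - 1) \<le> x + r"
        using le by (fastforce simp: min_def)
      moreover have "r + min m (k - 1) \<in> ?Y"
        using m k by auto
      ultimately show ?thesis by blast
    qed
    then obtain y where y: "y \<in> ?Y" "\<And>x. x \<in> S \<inter> ?X \<Longrightarrow> y \<le> x + r" "\<And>t. t \<in> S \<inter> ?X' \<Longrightarrow> t \<le> y + r" by blast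
    have "near y x \<and> near x y" if "x \<in> S" for x
    proof (cases "x \<in> ?X")
      case True
      then show ?thesis using y(2)[of x] y(1) that by (auto simp: near_def)
    next
      case False
      then have "x \<in> ?X'" using S that by blast
      then show ?thesis using y(3)[of x] y(1) that by (auto simp: near_def)
    qed
    moreover have "y < ?n" using y(1) by auto
    ultimately have "insert y S \<in> ?K" using SK by (simp add: insert_K)
    then have "S \<in> A" using SK y(1) unfolding A_def by blast
    with \<open>S \<in> B\<close> show "S \<in> A \<inter> B" by blast
  qed
  have disj: "?X \<inter> ?X' = {}" using k by auto
  have insert_C: "insert t S \<in> C \<longleftrightarrow> S \<in> C \<and> (\<forall>x\<in>S \<inter> ?X. pair x t)" if "t \<in> ?X'" for t S
  proof -
    have "insert t S \<inter> ?X = S \<inter> ?X" "insert t S \<inter> ?X' = insert t (S \<inter> ?X')"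
      using that disj by auto
    then show ?thesis
      using that unfolding C_def by auto
  qed
  have downC: "T \<in> C" if "S \<in> C" "T \<subseteq> S" for S T
    using that unfolding C_def by blast
  have "A' \<subseteq> C"
    using disj unfolding A'_def C_def by blast
  have C: "A' \<union> B' = C"
  proof (intro subset_antisym subsetI)
    fix S assume S: "S \<in> C"
    show "S \<in> A' \<union> B'"
    proof (cases "S \<inter> ?X' = {}")
      case True
      then show ?thesis using S unfolding A'_def C_def by blast
    next
      case False
      then obtain t where t: "t \<in> S" "t \<in> ?X'" by blast
      then have "insert t (S \<inter> ?X) \<in> C"
        by (intro downC[OF S]) auto
      then show ?thesis using S t(2) unfolding B'_def by blast
    qed
  qed (use \<open>A' \<subseteq> C\<close> in \<open>auto simp: B'_def\<close>)
  have A'B'_iff: "S \<in> A' \<inter> B' \<longleftrightarrow> S \<subseteq> ?X \<and> (\<exists>t\<in>?X'. \<forall>x\<in>S. pair x t)" for S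
  proof (cases "S \<subseteq> ?X")
    case True
    then have "S \<inter> ?X = S" "S \<in> A'" "S \<in> C" using \<open>A' \<subseteq> C\<close> by (auto simp: A'_def)
    then show ?thesis
      using insert_C[of _ S] by (auto simp: B'_def True)
  qed (auto simp: A'_def)
  \<comment> \<open>A set of vertices of \<open>?X\<close> belongs to \<open>B'\<close> iff a single
    \<open>t\<close> is paired with all of them, that is, iff it avoids the \<open>k - 1\<close>
    consecutive vertices excluded by \<open>t\<close>.\<close>
  have A'B': "A' \<inter> B' = (`) Suc ` arc_complex r (k - 1)"
  proof (intro subset_antisym subsetI)
    fix S assume "S \<in> A' \<inter> B'"
    then obtain t where S: "S \<subseteq> ?X" and t: "t \<in> ?X'" "\<And>x. x \<in> S \<Longrightarrow> pair x t"
      unfolding A'B'_iff by blast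
    define T where "T = {x. Suc x \<in> S}"
    have "S = Suc ` T"
    proof (intro subset_antisym subsetI)
      fix x assume "x \<in> S"
      then have "1 \<le> x" using S by auto
      with \<open>x \<in> S\<close> show "x \<in> Suc ` T"
        by (intro image_eqI[of _ _ "x - 1"]) (auto simp: T_def)
    qed (auto simp: T_def)
    moreover have "T \<in> arc_complex r (k - 1)"
    proof -
      have T: "T \<subseteq> {..<r}" using S by (auto simp: T_def)
      have x: "pair (Suc x) t" if "x \<in> T" for x
        using t(2) that by (simp add: T_def)
      show ?thesis
      proof (cases "t \<le> 2 * r + 1")
        case True
        have "t - r - k + (k - 1) \<le> r" using True t(1) k by auto
        moreover have "\<forall>x\<in>T. x < t - r - k \<or> t - r - k + (k - 1) \<le> x"
          using x t(1) k by (fastforce simp: pair_def)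
        ultimately show ?thesis
          using T unfolding arc_complex_def by blast
      next
        case False
        have "t - 2 * r - 1 \<le> k - 1" using t(1) by auto
        moreover have "\<forall>x\<in>T. t - 2 * r - 1 \<le> x \<and> x + (k - 1) < r + (t - 2 * r - 1)"
          using x T k False by (fastforce simp: pair_def)
        ultimately show ?thesis
          using T unfolding arc_complex_def by blast
      qed
    qed
    ultimately show "S \<in> (`) Suc ` arc_complex r (k - 1)" by blast
  next
    fix S assume "S \<in> (`) Suc ` arc_complex r (k - 1)"
    then obtain T where T: "T \<in> arc_complex r (k - 1)" and S: "S = Suc ` T" by blast
    have "T \<subseteq> {..<r}" using T by (simp add: arc_complex_def)
    then have "S \<subseteq> ?X" by (auto simp: S)
    \<comment> \<open>The value \<open>b = k - 1\<close> would correspond to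
      \<open>t = 2 * r + k\<close>, just outside \<open>?X'\<close>, so that arc is described by
      \<open>u = 0\<close> instead.\<close>
    consider u where "u + (k - 1) \<le> r" "\<forall>x\<in>T. x < u \<or> u + (k - 1) \<le> x"
      | b where "b < k - 1" "\<forall>x\<in>T. b \<le> x \<and> x + (k - 1) < r + b"
    proof -
      from T consider u where "u + (k - 1) \<le> r" "\<forall>x\<in>T. x < u \<or> u + (k - 1) \<le> x"
        | b where "b \<le> k - 1" "\<forall>x\<in>T. b \<le> x \<and> x + (k - 1) < r + b"
        by (auto simp: arc_complex_def)
      then show thesis
      proof cases
        case 2
        show ?thesis
        proof (cases "b = k - 1")
          case True
          then show ?thesis using 2 k by (intro that(1)[of 0]) auto
        next
          case False
          then have "b < k - 1" using 2(1) by simp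
          then show ?thesis using 2(2) by (rule that(2))
        qed
      qed (rule that(1))
    qed
    then have "\<exists>t\<in>?X'. \<forall>x\<in>S. pair x t"
    proof cases
      case 1
      then have "\<forall>x\<in>S. pair x (u + r + k)"
        using k by (fastforce simp: S pair_def)
      moreover have "u + r + k \<in> ?X'" using 1(1) k by auto
      ultimately show ?thesis by blast
    next
      case 2
      then have "\<forall>x\<in>S. pair x (b + 2 * r + 1)"
        using k by (fastforce simp: S pair_def)
      moreover have "b + 2 * r + 1 \<in> ?X'" using 2(1) k by auto
      ultimately show ?thesis by blast
    qed
    with \<open>S \<subseteq> ?X\<close> show "S \<in> A' \<inter> B'"
      unfolding A'B'_iff by blast
  qed
  have subK: "?K \<subseteq> Pow {..<?n}" unfolding cycle_cliques_def by blast
  have "collapsible A"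
  proof -
    let ?V = "{..<?n} - ?Y"
    have collapse: "collapses A {U \<in> A. U \<inter> ?V \<notin> Pow ?V - {{}}}"
    proof (rule collapses_discard)
      show "\<exists>w. w \<notin> ?V \<and> (\<forall>U\<in>A. U \<inter> ?V = S \<longrightarrow> insert w U \<in> A)" if S: "S \<in> Pow ?V - {{}}" for S
      proof (cases "\<exists>y\<in>?Y. insert y S \<in> ?K")
        case True
        then obtain y where y: "y \<in> ?Y" "insert y S \<in> ?K" by blast
        \<comment> \<open>As \<open>?Y\<close> is a clique, a \<open>y\<close> compatible with the
          trace is compatible with every simplex having this trace.\<close>
        have "insert y U \<in> A" if U: "U \<in> A" "U \<inter> ?V = S" for U
        proof -
          have UK: "U \<in> ?K" using U(1) by (simp add: A_def)
          have "near y x \<and> near x y" if x: "x \<in> U" for x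
          proof (cases "x \<in> ?Y")
            case True
            then show ?thesis using near_Y y(1) by blast
          next
            case False
            then have "x \<in> S" using U x UK unfolding K by blast
            then show ?thesis using y(2) unfolding insert_K by blast
          qed
          then have "insert y U \<in> ?K" using UK y(1) by (simp add: insert_K)
          then show ?thesis using y(1) by (auto simp: A_def intro!: bexI[of _ y])
        qed
        moreover have "y \<notin> ?V" using y(1) by simp
        ultimately show ?thesis by blast
      next
        case False
        have "U \<inter> ?V \<noteq> S" if U: "U \<in> A" for U
        proof
          assume S: "U \<inter> ?V = S"
          from U obtain y where "y \<in> ?Y" "insert y U \<in> ?K" by (auto simp: A_def)
          moreover have "insert y S \<subseteq> insert y U" using S by blast
          ultimately show False using False down by blast
        qed
        \<comment> \<open>No simplex of \<open>A\<close> has this trace, so any number outside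
          \<open>?V\<close> serves as apex.\<close>
        then show ?thesis by (intro exI[of _ ?n]) auto
      qed
      show "U \<inter> ?V \<in> Pow ?V - {{}}" if "S \<in> Pow ?V - {{}}" "S \<subseteq> U" for S U
        using that by blast
    qed (auto intro: finite_subset)
    have "collapsible {U \<in> A. U \<inter> ?V \<notin> Pow ?V - {{}}}"
    proof (rule collapsible_cone[of _ "r + 1"])
      fix U assume "U \<in> {U \<in> A. U \<inter> ?V \<notin> Pow ?V - {{}}}"
      then have U: "U \<in> ?K" "U \<inter> ?V = {}" by (auto simp: A_def)
      have "U \<subseteq> ?Y" using U unfolding K by blast
      have y: "r + 1 \<in> ?Y" "r + 1 < ?n" using k by auto
      then have K': "insert (r + 1) U \<in> ?K"
        using \<open>U \<subseteq> ?Y\<close> U(1) near_Y unfolding insert_K by blast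
      then have "insert (r + 1) U \<in> A"
        unfolding A_def using y(1) by (metis (mono_tags, lifting) CollectI insert_absorb2)
      moreover have "insert (r + 1) U \<inter> ?V = {}" using U(2) y(1) by blast
      ultimately show "insert (r + 1) U \<in> {U \<in> A. U \<inter> ?V \<notin> Pow ?V - {{}}}" by simp
    qed
    with collapse show ?thesis by (rule collapsible_if_collapses)
  qed
  have "collapsible B'"
  proof -
    have collapse: "collapses B' {U \<in> B'. U \<inter> ?X \<notin> Pow ?X - {{}}}"
    proof (rule collapses_discard)
      show "\<exists>w. w \<notin> ?X \<and> (\<forall>U\<in>B'. U \<inter> ?X = S \<longrightarrow> insert w U \<in> B')" if S: "S \<in> Pow ?X - {{}}" for S
      proof (cases "\<exists>t\<in>?X'. insert t S \<in> C")
        case True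
        then obtain t where t: "t \<in> ?X'" "insert t S \<in> C" by blast
        then have pair: "\<forall>x\<in>S \<inter> ?X. pair x t" using insert_C by blast
        have "t \<notin> ?X" using t(1) disj by blast
        have "insert t U \<in> B'" if U: "U \<in> B'" "U \<inter> ?X = S" for U
        proof -
          have "U \<in> C" using U(1) by (simp add: B'_def)
          then have "insert t U \<in> C"
            using insert_C[OF t(1)] pair U(2) by blast
          moreover have "insert t U \<inter> ?X = S" using U(2) \<open>t \<notin> ?X\<close> by blast
          ultimately show ?thesis
            unfolding B'_def using t by (metis (mono_tags, lifting) CollectI)
        qed
        with \<open>t \<notin> ?X\<close> show ?thesis by blast
      next
        case False
        have "U \<inter> ?X \<noteq> S" if U: "U \<in> B'" for U
          using U False unfolding B'_def by blast
        then show ?thesis by (intro exI[of _ 0]) auto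
      qed
      show "U \<inter> ?X \<in> Pow ?X - {{}}" if "S \<in> Pow ?X - {{}}" "S \<subseteq> U" for S U
        using that by blast
    qed (auto intro: finite_subset)
    have "collapsible {U \<in> B'. U \<inter> ?X \<notin> Pow ?X - {{}}}"
    proof (rule collapsible_cone[of _ "r + k"])
      fix U assume "U \<in> {U \<in> B'. U \<inter> ?X \<notin> Pow ?X - {{}}}"
      then have U: "U \<in> C" "U \<inter> ?X = {}" by (auto simp: B'_def)
      have t: "r + k \<in> ?X'" "r + k \<notin> ?X" using k by auto
      have "{} \<in> C" by (simp add: C_def)
      then have "insert (r + k) U \<in> C" "insert (r + k) {} \<in> C"
        using insert_C[OF t(1)] U by blast+
      moreover have "insert (r + k) U \<inter> ?X = {}" using U(2) t(2) by blast
      ultimately show "insert (r + k) U \<in> {U \<in> B'. U \<inter> ?X \<notin> Pow ?X - {{}}}"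
        unfolding B'_def using t(1) by (metis (mono_tags, lifting) CollectI DiffE singletonI)
    qed
    with collapse show ?thesis by (rule collapsible_if_collapses)
  qed
  have "collapsible A'"
    using k unfolding A'_def by (intro collapsible_cone[of _ 1]) auto
  have "collapsible B"
  proof (rule collapsible_cone[of _ 0])
    show "insert 0 S \<in> B" if "S \<in> B" for S
      using that unfolding B_def by simp
  qed
  have sA: "simplicial A"
  proof (rule simplicialI[of "{..<?n}"])
    fix S T assume S: "S \<in> A" and T: "T \<subseteq> S"
    then obtain y where y: "S \<in> ?K" "y \<in> ?Y" "insert y S \<in> ?K" by (auto simp: A_def)
    have "T \<in> ?K" "insert y T \<in> ?K"
      using down[OF y(1) T] down[OF y(3) insert_mono[OF T]] by auto
    then show "T \<in> A" using y(2) unfolding A_def by blast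
  qed (use subK in \<open>auto simp: A_def\<close>)
  have sB: "simplicial B"
  proof (rule simplicialI[of "{..<?n}"])
    fix S T assume S: "S \<in> B" and T: "T \<subseteq> S"
    then show "T \<in> B"
      using down[of S T] down[OF _ insert_mono[OF T]] unfolding B_def by blast
  qed (use subK in \<open>auto simp: B_def\<close>)
  have CK: "C \<subseteq> ?K" unfolding A_Int_B[symmetric] A_def by blast
  have sA': "simplicial A'"
    unfolding A'_def by (rule simplicialI[of ?X]) auto
  have sB': "simplicial B'"
  proof (rule simplicialI[of "{..<?n}"])
    fix S T assume S: "S \<in> B'" and T: "T \<subseteq> S"
    then obtain t where t: "S \<in> C" "t \<in> ?X'" "insert t (S \<inter> ?X) \<in> C" by (auto simp: B'_def)
    have "T \<in> C" "insert t (T \<inter> ?X) \<in> C"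
      using downC[OF t(1) T] downC[OF t(3), of "insert t (T \<inter> ?X)"] T by auto
    then show "T \<in> B'" using t(2) unfolding B'_def by blast
  next
    show "S \<subseteq> {..<?n}" if "S \<in> B'" for S
      using that CK subK unfolding B'_def by blast
  qed simp
  have fin: "finite A" "finite B" "finite A'" "finite B'"
  proof -
    have "finite ?K" using subK by (meson finite_Pow_iff finite_lessThan finite_subset)
    moreover have "A \<subseteq> ?K" "B \<subseteq> ?K" "A' \<subseteq> ?K" "B' \<subseteq> ?K"
      using AB C CK by blast+
    ultimately show "finite A" "finite B" "finite A'" "finite B'"
      by (meson finite_subset)+
  qed
  have "sphere_type j d (A' \<inter> B')"
    unfolding A'B' by (rule sphere_type_image[OF simplicial_arc_complex _ _ assms(3), of UNIV]) auto
  moreover have "{} \<in> A' \<inter> B'"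
    unfolding A'B'_iff using k by (auto intro!: bexI[of _ "r + k"])
  ultimately have "sphere_type j (Suc d) (A' \<union> B')"
    using sphere_type_union[OF sA' \<open>collapsible A'\<close> fin(3) sB' \<open>collapsible B'\<close> fin(4)] by blast
  then have "sphere_type j (Suc d) (A \<inter> B)"
    by (simp only: C A_Int_B)
  moreover have "{} \<in> A \<inter> B"
    unfolding A_Int_B C_def by simp
  ultimately have "sphere_type j (Suc (Suc d)) (A \<union> B)"
    using sphere_type_union[OF sA \<open>collapsible A\<close> fin(1) sB \<open>collapsible B\<close> fin(2)] by blast
  then show ?thesis by (simp only: AB)
qed

theorem corollary6p7:
  fixes n r :: nat
  assumes "n \<ge> 3" and "real r < real n / 2"
  shows "\<exists>l::nat.
    (real r = real l / (2 * real l + 1) * real n \<and>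
     geometric_realization (clique_complex (graph_power (cycle_graph n) r))
       homotopy_equivalent_space wedge_of_spheres (n - 2 * r - 1) (2 * l))
    \<or>
    (real l / (2 * real l + 1) * real n < real r \<and>
     real r < (real l + 1) / (2 * real l + 3) * real n \<and>
     geometric_realization (clique_complex (graph_power (cycle_graph n) r))
       homotopy_equivalent_space nsphere (2 * l + 1))"
proof -
  define k where "k = n - 2 * r"
  have "2 * r < n" using assms(2) by linarith
  then have n: "n = 2 * r + k" and "1 \<le> k"
    by (simp_all add: k_def)
  define l where "l = r div k"
  define s where "s = r mod k"
  have r: "r = l * k + s" and "s < k"
    using \<open>1 \<le> k\<close> by (simp_all add: l_def s_def)
  have realization: "geometric_realization (clique_complex (graph_power (cycle_graph n) r)) =
      geometric_realization (cycle_cliques n r)"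
    by (metis clique_complex_cycle_power geometric_realization_insert_empty)
  have type: "sphere_type (if s = 0 then k - 1 else 1) (2 * l + (if s = 0 then 0 else 1)) (cycle_cliques n r)"
  \<comment> \<open>All vertices are pairwise adjacent here; the arc complexes would have gap length
    0.\<close>
  proof (cases "k = 1")
    case True
    then have "cycle_cliques n r = Pow {..<n}"
      by (auto simp: cycle_cliques_def n)
    then show ?thesis
      using True \<open>s < k\<close> assms(1) sphere_type_simplex[of n] by simp
  next
    case False
    then have k: "2 \<le> k" using \<open>1 \<le> k\<close> by simp
    show ?thesis
    proof (cases "l = 0")
      case True
      then have "r < k" using r \<open>s < k\<close> by simp
      then have eq: "cycle_cliques n r = arc_complex n (n - r - 1)"
        by (intro cycle_cliques_eq_arc_complex) (simp add: n)
      show ?thesis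
      proof (cases "s = 0")
        case True
        then have "r = 0" "n = Suc (k - 1)" using r \<open>l = 0\<close> n k by simp_all
        then show ?thesis
          using sphere_type_arc_complex_discrete[of "k - 1"] \<open>l = 0\<close> True unfolding eq by simp
      next
        case False
        then have "sphere_type 1 1 (arc_complex n (n - r - 1))"
          using r \<open>l = 0\<close> \<open>r < k\<close> n by (intro sphere_type_arc_complex_circle) simp_all
        then show ?thesis
          using False \<open>l = 0\<close> unfolding eq by simp
      qed
    next
      case False
      then obtain q where q: "l = Suc q" by (cases l) auto
      have rq: "Suc q * ((k - 1) + 1) + s = r" using r q k by simp
      have "sphere_type (if s = 0 then k - 1 else 1) (2 * q + (if s = 0 then 0 else 1))
          (arc_complex (Suc q * ((k - 1) + 1) + s) (k - 1))"
        using k \<open>s < k\<close> by (intro sphere_type_arc_complex) simp_all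
      then have "sphere_type (if s = 0 then k - 1 else 1) (2 * q + (if s = 0 then 0 else 1)) (arc_complex r (k - 1))"
        unfolding rq .
      moreover have "k \<le> r" using r q by simp
      ultimately have "sphere_type (if s = 0 then k - 1 else 1)
          (Suc (Suc (2 * q + (if s = 0 then 0 else 1)))) (cycle_cliques (2 * r + k) r)"
        using k by (intro cycle_cliques_reduction)
      then show ?thesis
        by (simp only: n q mult_Suc_right add_2_eq_Suc add_Suc)
    qed
  qed
  have pos: "0 < 2 * real l + 1" "0 < 2 * real l + 3" by simp_all
  show ?thesis
  proof (cases "s = 0")
    case True
    have "n - 2 * r - 1 = k - 1" by (simp add: n)
    \<comment> \<open>Both sides equal \<open>l * k * (2 * l + 1)\<close>.\<close>
    moreover have "real r * (2 * real l + 1) = real l * real n"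
      using True by (simp add: n r algebra_simps)
    then have "real r = real l / (2 * real l + 1) * real n"
      using pos by (simp add: field_simps)
    ultimately show ?thesis
      using sphere_type_imp_wedge[OF type simplicial_cycle_cliques] True
      unfolding realization by (intro exI[of _ l]) simp
  next
    case False
    have "real l * real n < real r * (2 * real l + 1)"
      using False by (simp add: n r algebra_simps)
    then have "real l / (2 * real l + 1) * real n < real r"
      using pos by (simp add: field_simps)
    \<comment> \<open>Adding \<open>r * (2 * l + 2)\<close> to both sides gives the upper bound,
      since \<open>n = 2 * r + k\<close>.\<close>
    moreover have "real r < (real l + 1) * real k"
      using \<open>s < k\<close> by (simp add: r algebra_simps)
    then have "real r * (2 * real l + 3) < (real l + 1) * real n"
      by (simp add: n algebra_simps)
    then have "real r < (real l + 1) / (2 * real l + 3) * real n"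
      using pos by (simp add: field_simps)
    ultimately show ?thesis
      using sphere_type_imp_nsphere[OF _ simplicial_cycle_cliques, of "2 * l + 1" n r] type False
      unfolding realization by (intro exI[of _ l]) simp
  qed
qed

end
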